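(* Let $\beta=2/\log(e/2)\approx 6.51778$. In the random graph process $G_0,G_1,\dots,G_{\binom n2}$ on $[n]$ the following hold. (i) A.a.s., simultaneously for every $0\le m\le\binom n2$, $T(G_m)=\min\{\delta(G_m),\lfloor m/(n-1)\rfloor\}$. (ii) For any constant $\epsilon>0$, a.a.s. both: $\delta(G_m)\le\lfloor m/(n-1)\rfloor$ for every $0\le m\le \frac{(1-\epsilon)\beta}{2}n\log n$; and $\delta(G_m)>\lfloor m/(n-1)\rfloor$ for every $\frac{(1+\epsilon)\beta}{2}n\log n\le m\le\binom n2$.
   Context: The random graph process is defined by taking a uniformly random ordering $(e_1,\dots,e_{\binom n2})$ of the edges of the complete graph on $[n]$ and letting $G_m$ be the graph on $[n]$ with edge set $\{e_1,\dots,e_m\}$. "A.a.s." means with probability tending to $1$ as $n\to\infty$. For a graph $G$, $\delta(G)$ is the minimum degree and $T(G)$ the maximum number of pairwise edge-disjoint spanning trees of $G$. *)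

theory Defs
  imports Complex_Main
begin

text \<open>Graphs on vertex set [n] = {0..<n}, represented by their edge sets
  (sets of 2-element subsets of {0..<n}).\<close>

definition all_edges :: "nat \<Rightarrow> nat set set" where
  "all_edges n = {e. \<exists>u v. u < n \<and> v < n \<and> u \<noteq> v \<and> e = {u, v}}"

text \<open>Orderings of the edges of K_n (the sample space of the random graph process).\<close>
definition edge_orderings :: "nat \<Rightarrow> nat set list set" where
  "edge_orderings n = {xs. distinct xs \<and> set xs = all_edges n}"

text \<open>G_m: the graph formed by the first m edges of the ordering.\<close>
definition proc_graph :: "nat set list \<Rightarrow> nat \<Rightarrow> nat set set" where
  "proc_graph xs m = set (take m xs)"

text \<open>Probability (uniform measure on orderings) of an event.\<close>
definition proc_prob :: "nat \<Rightarrow> (nat set list \<Rightarrow> bool) \<Rightarrow> real" where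
  "proc_prob n P = real (card {xs \<in> edge_orderings n. P xs}) / real (card (edge_orderings n))"

definition degree :: "nat set set \<Rightarrow> nat \<Rightarrow> nat" where
  "degree E v = card {e \<in> E. v \<in> e}"

definition min_degree :: "nat \<Rightarrow> nat set set \<Rightarrow> nat" where
  "min_degree n E = Min ((degree E) ` {0..<n})"

definition adj_rel :: "nat set set \<Rightarrow> (nat \<times> nat) set" where
  "adj_rel E = {(u, v). {u, v} \<in> E \<and> u \<noteq> v}"

definition connected_on :: "nat \<Rightarrow> nat set set \<Rightarrow> bool" where
  "connected_on n E \<longleftrightarrow> (\<forall>u v. u < n \<longrightarrow> v < n \<longrightarrow> (u, v) \<in> (adj_rel E)\<^sup>*)"

text \<open>A cycle: a list of at least 3 distinct vertices, consecutive ones adjacent,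
  and the last adjacent to the first.\<close>
definition has_cycle :: "nat set set \<Rightarrow> bool" where
  "has_cycle E \<longleftrightarrow> (\<exists>vs. length vs \<ge> 3 \<and> distinct vs \<and>
      (\<forall>i. Suc i < length vs \<longrightarrow> {vs ! i, vs ! Suc i} \<in> E) \<and>
      {last vs, hd vs} \<in> E)"

text \<open>A spanning tree of the graph with edge set E on [n]: a connected acyclic
  spanning subgraph.\<close>
definition spanning_tree :: "nat \<Rightarrow> nat set set \<Rightarrow> nat set set \<Rightarrow> bool" where
  "spanning_tree n E T \<longleftrightarrow> T \<subseteq> E \<and> connected_on n T \<and> \<not> has_cycle T"

text \<open>T(G): maximum number of pairwise edge-disjoint spanning trees.\<close>
definition tree_packing :: "nat \<Rightarrow> nat set set \<Rightarrow> nat" where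
  "tree_packing n E = Max {k. \<exists>ts :: nat set set list. length ts = k \<and>
      (\<forall>i<k. spanning_tree n E (ts ! i)) \<and>
      (\<forall>i<k. \<forall>j<k. i \<noteq> j \<longrightarrow> ts ! i \<inter> ts ! j = {})}"

definition beta_const :: real where
  "beta_const = 2 / ln (exp 1 / 2)"

end

theory Submission
  imports Defs "HOL-Library.Disjoint_Sets" "HOL-Combinatorics.Multiset_Permutations"
    "HOL-Real_Asymp.Real_Asymp" "HOL-Analysis.Harmonic_Numbers"
begin

text \<open>
By the theorem of Tutte and Nash-Williams, \<open>T(G) \<ge> t\<close> as soon as every partition of the vertex set
into \<open>r\<close> parts is crossed by at least \<open>t (r - 1)\<close> edges. That theorem is proved here by a
shrinking argument as in Rado's theorem: give each edge the list of all \<open>t\<close> colours and delete colours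
while a rank condition holds; submodularity of the graph rank shows that one gets stuck only when all
lists are singletons, and then all colour classes are connected.

If all parts have at most \<open>99 n / 100\<close> vertices, the crossing bound follows by summing over the parts
the inequality \<open>e(W) \<le> m (|W| - 1) / (n - 1)\<close>, which a.a.s. holds for all these vertex sets \<open>W\<close> by
a Chernoff bound. Otherwise let \<open>U\<close> be the complement of the large part; then it suffices that at
least \<open>t |U|\<close> edges leave \<open>U\<close>. A minimal violating set \<open>U\<close> has no isolated vertex in its induced
subgraph, hence at least \<open>|U| / 2\<close> inner edges, and few edges leaving it.

All of this is monotone in \<open>m\<close> for fixed \<open>t\<close>, so that only one pair of times per \<open>t\<close> has to be
considered: at time \<open>time_lo n t\<close> the minimum degree is still below \<open>t\<close> or \<open>m\<close> is exactly
\<open>t (n - 1)\<close>, and yet the expected number of vertices of degree below \<open>t\<close> is so small that, up to the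
time \<open>time_hi n t\<close> at which the minimum degree has certainly reached \<open>t\<close>, no violating set \<open>U\<close> with two
or more vertices appears. The lower bounds on the number of vertices of small degree come
from the second moment method.
\<close>

section \<open>Graph rank and tree packing\<close>

text \<open>Origin of \<beta>: at time k (n - 1) a degree is nearly Poisson with mean 2 k, and it is
  at most k with probability (2/e)^k up to polynomial factors. So about n exp (-(1 - ln 2) k)
  vertices have degree at most k. This passes 1 at k = ln n / (1 - ln 2), that is at m = (\<beta>/2)
  n ln n, because ln (e/2) = 1 - ln 2.

  The obstacle in (i): the failure bounds for small cuts are only a small negative power of n, so a
  union bound over the quadratically many m is out of reach, and conditioning on the random time at
  which the minimum degree reaches t would destroy uniformity. Both are avoided by two deterministic
  times per t. Edges leaving a set are counted at the earlier time and edges inside it at the later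
  one; both counts are monotone, so every time in between is covered. The price is a joint estimate
  at two dependent times. The union over t is affordable because the bound for small cuts decays
  geometrically in t.\<close>

lemma all_edges_alt: "all_edges n = {e. e \<subseteq> {0..<n} \<and> card e = 2}"
proof (intro set_eqI iffI)
  fix e assume "e \<in> all_edges n"
  then show "e \<in> {e. e \<subseteq> {0..<n} \<and> card e = 2}" unfolding all_edges_def by clarsimp
next
  fix e assume e: "e \<in> {e. e \<subseteq> {0..<n} \<and> card e = 2}"
  then obtain u v where "e = {u, v}" "u \<noteq> v" unfolding card_2_iff by blast
  then show "e \<in> all_edges n" using e unfolding all_edges_def by auto
qed

lemma finite_all_edges [simp]: "finite (all_edges n)"
  unfolding all_edges_alt by (rule finite_subset[of _ "Pow {0..<n}"]) auto

lemma card_all_edges: "card (all_edges n) = n choose 2"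
  unfolding all_edges_alt using n_subsets[of "{0..<n}" 2] by simp

lemma all_edgesE:
  assumes "e \<in> all_edges n"
  obtains u v where "u < n" "v < n" "u \<noteq> v" "e = {u, v}"
  using assms unfolding all_edges_def by auto

lemma sym_adj_rel: "sym (adj_rel F)"
  unfolding adj_rel_def sym_def by (auto simp: insert_commute)

lemma reach_sym: "(u, v) \<in> (adj_rel F)\<^sup>* \<Longrightarrow> (v, u) \<in> (adj_rel F)\<^sup>*"
  by (rule symD[OF sym_rtrancl[OF sym_adj_rel]])

lemma adj_rel_mono: "F \<subseteq> G \<Longrightarrow> adj_rel F \<subseteq> adj_rel G"
  unfolding adj_rel_def by auto

lemma reach_mono: "F \<subseteq> G \<Longrightarrow> (u, v) \<in> (adj_rel F)\<^sup>* \<Longrightarrow> (u, v) \<in> (adj_rel G)\<^sup>*"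
  by (drule adj_rel_mono, drule rtrancl_mono) (rule subsetD)

lemma adj_rel_insert:
  "u \<noteq> v \<Longrightarrow> adj_rel (insert {u, v} F) = insert (u, v) (insert (v, u) (adj_rel F))"
  unfolding adj_rel_def by (auto simp: doubleton_eq_iff)

text \<open>A path needs the new edge at most once. The undirected edge enters
  \<open>adj_rel\<close> as two arcs, so \<open>rtrancl_insert\<close> is applied twice; routes
  through both arcs shorten to one of the three listed cases by transitivity.\<close>

lemma reach_insert:
  assumes "u \<noteq> v"
  shows "(x, y) \<in> (adj_rel (insert {u, v} F))\<^sup>* \<longleftrightarrow>
    (x, y) \<in> (adj_rel F)\<^sup>* \<or>
    (x, u) \<in> (adj_rel F)\<^sup>* \<and> (v, y) \<in> (adj_rel F)\<^sup>* \<or>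
    (x, v) \<in> (adj_rel F)\<^sup>* \<and> (u, y) \<in> (adj_rel F)\<^sup>*"
proof -
  let ?R = "(adj_rel F)\<^sup>*"
  have "(x, y) \<in> (adj_rel (insert {u, v} F))\<^sup>* \<longleftrightarrow>
    ((x, y) \<in> ?R \<or> (x, v) \<in> ?R \<and> (u, y) \<in> ?R) \<or>
    ((x, u) \<in> ?R \<or> (x, v) \<in> ?R \<and> (u, u) \<in> ?R) \<and> ((v, y) \<in> ?R \<or> (v, v) \<in> ?R \<and> (u, y) \<in> ?R)"
    unfolding adj_rel_insert[OF assms] rtrancl_insert by simp
  moreover have "(x, u) \<in> ?R \<Longrightarrow> (u, y) \<in> ?R \<Longrightarrow> (x, y) \<in> ?R"
    and "(x, v) \<in> ?R \<Longrightarrow> (v, y) \<in> ?R \<Longrightarrow> (x, y) \<in> ?R"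
    by (erule (1) rtrancl_trans)+
  ultimately show ?thesis by auto
qed

lemma reach_insert_absorb:
  assumes "u \<noteq> v" and uv: "(u, v) \<in> (adj_rel F)\<^sup>*"
  shows "(adj_rel (insert {u, v} F))\<^sup>* = (adj_rel F)\<^sup>*"
proof (rule set_eqI, clarify)
  fix x y
  have "(x, u) \<in> (adj_rel F)\<^sup>* \<Longrightarrow> (v, y) \<in> (adj_rel F)\<^sup>* \<Longrightarrow> (x, y) \<in> (adj_rel F)\<^sup>*"
    using uv rtrancl_trans by metis
  moreover have "(x, v) \<in> (adj_rel F)\<^sup>* \<Longrightarrow> (u, y) \<in> (adj_rel F)\<^sup>* \<Longrightarrow> (x, y) \<in> (adj_rel F)\<^sup>*"
    using reach_sym[OF uv] rtrancl_trans by metis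
  ultimately show "(x, y) \<in> (adj_rel (insert {u, v} F))\<^sup>* \<longleftrightarrow> (x, y) \<in> (adj_rel F)\<^sup>*"
    using reach_insert[OF assms(1), of x y F] by blast
qed

section \<open>Components of a graph and the rank of the cycle matroid\<close>

definition graph_component :: "nat \<Rightarrow> nat set set \<Rightarrow> nat \<Rightarrow> nat set" where
  "graph_component n F v = {w. w < n \<and> (v, w) \<in> (adj_rel F)\<^sup>*}"

definition graph_components :: "nat \<Rightarrow> nat set set \<Rightarrow> nat set set" where
  "graph_components n F = graph_component n F ` {0..<n}"

text \<open>The rank function of the cycle matroid of the complete graph: the number of edges of a
  spanning forest of \<open>F\<close>. Isolated vertices count as components, so edge sets can be
  compared without keeping track of the vertices they touch.\<close>

definition graph_rank :: "nat \<Rightarrow> nat set set \<Rightarrow> nat" where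
  "graph_rank n F = n - card (graph_components n F)"

lemma graph_component_eq_iff:
  assumes "v < n"
  shows "graph_component n F u = graph_component n F v \<longleftrightarrow> (u, v) \<in> (adj_rel F)\<^sup>*"
proof
  assume "graph_component n F u = graph_component n F v"
  moreover have "v \<in> graph_component n F v" using assms by (simp add: graph_component_def)
  ultimately show "(u, v) \<in> (adj_rel F)\<^sup>*" by (auto simp: graph_component_def)
next
  assume uv: "(u, v) \<in> (adj_rel F)\<^sup>*"
  have "(u, w) \<in> (adj_rel F)\<^sup>* \<longleftrightarrow> (v, w) \<in> (adj_rel F)\<^sup>*" for w
    using rtrancl_trans[OF uv, of w] rtrancl_trans[OF reach_sym[OF uv], of w] by blast
  then show "graph_component n F u = graph_component n F v" by (simp add: graph_component_def)
qed

lemma finite_graph_components [simp]: "finite (graph_components n F)"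
  unfolding graph_components_def by simp

lemma card_components_le: "card (graph_components n F) \<le> n"
  unfolding graph_components_def using card_image_le[of "{0..<n}" "graph_component n F"] by simp

lemma graph_rank_add: "graph_rank n F + card (graph_components n F) = n"
  unfolding graph_rank_def using card_components_le by simp

lemma partition_on_components: "partition_on {0..<n} (graph_components n F)"
proof (rule partition_onI)
  show "\<Union> (graph_components n F) = {0..<n}"
    unfolding graph_components_def graph_component_def by auto
next
  fix p q assume pq: "p \<in> graph_components n F" "q \<in> graph_components n F" "p \<noteq> q"
  then obtain x y where xy: "p = graph_component n F x" "q = graph_component n F y"
    by (auto simp: graph_components_def)
  show "disjnt p q"
  proof (rule ccontr)
    assume "\<not> disjnt p q"
    then obtain w where w: "w \<in> p" "w \<in> q" by (auto simp: disjnt_def)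
    then have "w < n" "(x, w) \<in> (adj_rel F)\<^sup>*" "(y, w) \<in> (adj_rel F)\<^sup>*"
      unfolding xy by (auto simp: graph_component_def)
    then have "graph_component n F x = graph_component n F w" "graph_component n F y = graph_component n F w"
      using graph_component_eq_iff by auto
    then show False using pq xy by simp
  qed
next
  show "{} \<notin> graph_components n F" unfolding graph_components_def graph_component_def by auto
qed

text \<open>An edge inside a component does not change reachability. Any other edge merges the two
  classes of its ends: two old classes disappear and their union appears, which is new because
  distinct classes are disjoint.\<close>

lemma card_components_insert:
  assumes "u < n" "v < n" "u \<noteq> v"
  shows "card (graph_components n F) =
    card (graph_components n (insert {u, v} F)) + (if (u, v) \<in> (adj_rel F)\<^sup>* then 0 else 1)"
proof (cases "(u, v) \<in> (adj_rel F)\<^sup>*")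
  case True
  then have "(adj_rel (insert {u, v} F))\<^sup>* = (adj_rel F)\<^sup>*"
    by (rule reach_insert_absorb[OF assms(3)])
  then show ?thesis using True by (simp add: graph_components_def graph_component_def)
next
  case False
  let ?C = "graph_component n F" and ?D = "graph_component n (insert {u, v} F)"
  have u: "?C u \<in> graph_components n F" "?C v \<in> graph_components n F" using assms by (auto simp: graph_components_def)
  have ne: "?C u \<noteq> ?C v" using False graph_component_eq_iff[OF assms(2)] by auto
  have Du: "?D x = ?C u \<union> ?C v" if "x = u \<or> x = v" for x
    unfolding graph_component_def using that reach_insert[OF assms(3), of x _ F] by (intro set_eqI) auto
  have Dw: "?D x = ?C u \<union> ?C v" if "?C x = ?C u \<or> ?C x = ?C v" "x < n" for x
  proof -
    have "(x, u) \<in> (adj_rel F)\<^sup>* \<or> (x, v) \<in> (adj_rel F)\<^sup>*"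
      using that graph_component_eq_iff assms by blast
    then have "?D x = ?D u"
      using graph_component_eq_iff[of u n "insert {u,v} F" x] assms reach_insert[OF assms(3)] by auto
    then show ?thesis using Du by auto
  qed
  have Dn: "?D x = ?C x" if "?C x \<noteq> ?C u" "?C x \<noteq> ?C v" "x < n" for x
    using that graph_component_eq_iff[of u n F x] graph_component_eq_iff[of v n F x] assms
    unfolding graph_component_def using reach_insert[OF assms(3)] by auto
  have eq: "graph_components n (insert {u, v} F) = insert (?C u \<union> ?C v) (graph_components n F - {?C u, ?C v})"
  proof (intro equalityI subsetI)
    fix A assume "A \<in> graph_components n (insert {u, v} F)"
    then obtain x where x: "x < n" "A = ?D x" by (auto simp: graph_components_def)
    then show "A \<in> insert (?C u \<union> ?C v) (graph_components n F - {?C u, ?C v})"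
      using Dw[of x] Dn[of x] by (cases "?C x = ?C u \<or> ?C x = ?C v") (auto simp: graph_components_def)
  next
    fix A assume "A \<in> insert (?C u \<union> ?C v) (graph_components n F - {?C u, ?C v})"
    then show "A \<in> graph_components n (insert {u, v} F)"
    proof
      assume "A = ?C u \<union> ?C v"
      then show ?thesis using Du[of u] assms by (auto simp: graph_components_def)
    next
      assume A: "A \<in> graph_components n F - {?C u, ?C v}"
      then have "A \<in> ?C ` {0..<n}" by (simp add: graph_components_def)
      then obtain x where x: "x < n" "A = ?C x" by (elim imageE) simp
      have "?D x = A" using Dn[of x] A x by simp
      then show ?thesis using x(1) unfolding graph_components_def by (intro image_eqI[of _ _ x]) simp_all
    qed
  qed
  have notin: "?C u \<union> ?C v \<notin> graph_components n F - {?C u, ?C v}"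
  proof
    assume "?C u \<union> ?C v \<in> graph_components n F - {?C u, ?C v}"
    then have a: "?C u \<union> ?C v \<in> graph_components n F" "?C u \<union> ?C v \<noteq> ?C u" by auto
    have "u \<in> ?C u" using assms by (simp add: graph_component_def)
    then have "\<not> disjnt (?C u \<union> ?C v) (?C u)" by (auto simp: disjnt_def)
    then show False
      using a u partition_onD2[OF partition_on_components[of n F]]
      by (meson disjointD disjnt_def)
  qed
  have "card (graph_components n F) = card (graph_components n F - {?C u, ?C v}) + 2"
  proof -
    have "card (graph_components n F - {?C u, ?C v}) = card (graph_components n F) - card {?C u, ?C v}"
      using u by (intro card_Diff_subset) auto
    moreover have "card {?C u, ?C v} \<le> card (graph_components n F)" using u by (intro card_mono) auto
    ultimately show ?thesis using ne by simp
  qed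
  then show ?thesis unfolding eq using notin False by simp
qed

lemma graph_rank_insert:
  assumes "u < n" "v < n" "u \<noteq> v"
  shows "graph_rank n (insert {u, v} F) =
    graph_rank n F + (if (u, v) \<in> (adj_rel F)\<^sup>* then 0 else 1)"
  using card_components_insert[OF assms, of F] graph_rank_add[of n F]
    graph_rank_add[of n "insert {u, v} F"] by (auto split: if_splits)

lemma graph_rank_empty [simp]: "graph_rank n {} = 0"
proof -
  have "inj_on (graph_component n {}) {0..<n}"
    by (rule inj_onI) (auto simp: graph_component_def adj_rel_def)
  then show ?thesis by (simp add: graph_rank_def graph_components_def card_image)
qed

lemma graph_rank_Un_le:
  assumes "F \<subseteq> all_edges n" "D \<subseteq> all_edges n"
  shows "graph_rank n F \<le> graph_rank n (F \<union> D)" and "graph_rank n (F \<union> D) \<le> graph_rank n F + card D"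
proof -
  have "finite D" using assms(2) finite_subset finite_all_edges by blast
  then have "graph_rank n F \<le> graph_rank n (F \<union> D) \<and> graph_rank n (F \<union> D) \<le> graph_rank n F + card D"
    using assms(2)
  proof (induction D rule: finite_induct)
    case (insert e D)
    then obtain u v where "u < n" "v < n" "u \<noteq> v" "e = {u, v}" by (auto elim: all_edgesE)
    then show ?case using insert graph_rank_insert[of u n v "F \<union> D"] by auto
  qed simp
  then show "graph_rank n F \<le> graph_rank n (F \<union> D)" "graph_rank n (F \<union> D) \<le> graph_rank n F + card D"
    by auto
qed

lemma graph_rank_mono: "F \<subseteq> G \<Longrightarrow> G \<subseteq> all_edges n \<Longrightarrow> graph_rank n F \<le> graph_rank n G"
  using graph_rank_Un_le(1)[of F n G] by (simp add: Un_absorb1)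

lemma graph_rank_le_card: "F \<subseteq> all_edges n \<Longrightarrow> graph_rank n F \<le> card F"
  using graph_rank_Un_le(2)[of "{}" n F] by simp

text \<open>An edge that joins two components of the larger set also joins two components of the
  smaller one, so every edge of \<open>D\<close> adds to the rank of \<open>A\<close> at least what
  it adds to the rank of \<open>B\<close>. This is the incremental form of submodularity.\<close>

lemma graph_rank_diminishing:
  assumes "A \<subseteq> B" "D \<subseteq> all_edges n"
  shows "graph_rank n (B \<union> D) + graph_rank n A \<le> graph_rank n (A \<union> D) + graph_rank n B"
proof -
  have "finite D" using assms(2) finite_subset finite_all_edges by blast
  then show ?thesis using assms(2)
  proof (induction D rule: finite_induct)
    case (insert e D)
    then obtain u v where e: "u < n" "v < n" "u \<noteq> v" "e = {u, v}" by (auto elim: all_edgesE)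
    have "(u, v) \<in> (adj_rel (A \<union> D))\<^sup>* \<Longrightarrow> (u, v) \<in> (adj_rel (B \<union> D))\<^sup>*"
      using reach_mono[of "A \<union> D" "B \<union> D"] assms(1) by blast
    then show ?case
      using insert e graph_rank_insert[of u n v "A \<union> D"] graph_rank_insert[of u n v "B \<union> D"] by auto
  qed simp
qed

lemma graph_rank_submodular:
  assumes "S \<subseteq> all_edges n" "T \<subseteq> all_edges n"
  shows "graph_rank n (S \<union> T) + graph_rank n (S \<inter> T) \<le> graph_rank n S + graph_rank n T"
  using graph_rank_diminishing[of "S \<inter> T" S T n] assms by (simp add: Un_absorb1 inf_commute)

lemma graph_rank_le: "n > 0 \<Longrightarrow> graph_rank n F \<le> n - 1"
proof -
  assume "n > 0"
  then have "graph_components n F \<noteq> {}" by (auto simp: graph_components_def)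
  then have "card (graph_components n F) > 0" by (simp add: card_gt_0_iff)
  then show ?thesis using graph_rank_add[of n F] by simp
qed

lemma connected_on_iff_graph_rank:
  assumes "n > 0"
  shows "connected_on n F \<longleftrightarrow> graph_rank n F = n - 1"
proof -
  have "connected_on n F \<longleftrightarrow> card (graph_components n F) = 1"
  proof
    assume "connected_on n F"
    then have "graph_components n F = {{0..<n}}"
      using assms unfolding connected_on_def graph_components_def graph_component_def by fastforce
    then show "card (graph_components n F) = 1" by simp
  next
    assume "card (graph_components n F) = 1"
    then obtain A where "graph_components n F = {A}" by (auto simp: card_1_singleton_iff)
    then have "\<And>u. u < n \<Longrightarrow> graph_component n F u = A" by (auto simp: graph_components_def)
    then show "connected_on n F"
      unfolding connected_on_def using graph_component_eq_iff by blast
  qed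
  then show ?thesis using graph_rank_add[of n F] assms by auto
qed

section \<open>Partitions of the edges into connected colour classes\<close>

definition crossing :: "nat set set \<Rightarrow> nat set set \<Rightarrow> nat set set" where
  "crossing P E = {e \<in> E. \<not> (\<exists>C\<in>P. e \<subseteq> C)}"

definition partition_connected :: "nat \<Rightarrow> nat \<Rightarrow> nat set set \<Rightarrow> bool" where
  "partition_connected n k E \<longleftrightarrow>
    (\<forall>P. partition_on {0..<n} P \<longrightarrow> k * (card P - 1) \<le> card (crossing P E))"

lemma partition_connected_mono:
  assumes "partition_connected n k F" "F \<subseteq> G" "finite G"
  shows "partition_connected n k G"
proof -
  have "card (crossing P F) \<le> card (crossing P G)" for P
    using assms by (intro card_mono) (auto simp: crossing_def)
  then show ?thesis using assms(1) order_trans unfolding partition_connected_def by blast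
qed

text \<open>The rank condition kept during the deletion of colours is that \<open>f A J\<close> is
  at least \<open>k * (n - 1)\<close> for every \<open>J \<subseteq> E\<close>, the lower bound
  known from matroid union. With full lists it is the crossing hypothesis for the partition into the
  components of \<open>J\<close>. With singleton lists the case \<open>J = E\<close> bounds the sum
  of the \<open>k\<close> ranks below by \<open>k * (n - 1)\<close>; no rank exceeds
  \<open>n - 1\<close>, so all are equal to it.\<close>

theorem tutte_nash_williams:
  assumes E: "E \<subseteq> all_edges n" and n: "n > 0" and k: "k > 0"
    and cross: "partition_connected n k E"
  shows "\<exists>c. \<forall>i<k. connected_on n {e \<in> E. c e = (i::nat)}"
proof -
  have finE: "finite E" using E finite_subset finite_all_edges by blast
  define f where "f A J = (\<Sum>i<k. graph_rank n {e \<in> J. i \<in> A e}) + card (E - J)"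
    for A :: "nat set \<Rightarrow> nat set" and J
  define Inv where "Inv A \<longleftrightarrow> (\<forall>e\<in>E. A e \<noteq> {} \<and> A e \<subseteq> {..<k}) \<and>
    (\<forall>J\<subseteq>E. k * (n - 1) \<le> f A J)" for A :: "nat set \<Rightarrow> nat set"
  have "Inv (\<lambda>_. {..<k})"
    unfolding Inv_def
  proof (intro conjI ballI allI impI)
    show "{..<k} \<noteq> {}" using k by auto
    fix J assume J: "J \<subseteq> E"
    have sub: "crossing (graph_components n J) E \<subseteq> E - J"
    proof
      fix e assume "e \<in> crossing (graph_components n J) E"
      then have e: "e \<in> {e \<in> E. \<not> (\<exists>C\<in>graph_components n J. e \<subseteq> C)}" by (simp add: crossing_def)
      then have "e \<in> all_edges n" using E by auto
      then obtain u v where uv: "u < n" "v < n" "u \<noteq> v" "e = {u, v}"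
        by (rule all_edgesE)
      have "e \<notin> J"
      proof
        assume "e \<in> J"
        then have "(u, v) \<in> adj_rel J" using uv by (auto simp: adj_rel_def)
        then have "e \<subseteq> graph_component n J u" using uv by (auto simp: graph_component_def)
        then show False using e uv by (auto simp: graph_components_def)
      qed
      then show "e \<in> E - J" using e by auto
    qed
    have "k * (card (graph_components n J) - 1) \<le> card (E - J)"
      using cross partition_on_components[of n J] card_mono[OF _ sub] finE
      unfolding partition_connected_def by (meson finite_Diff order_trans)
    moreover have "card (graph_components n J) - 1 + graph_rank n J = n - 1"
      using graph_rank_add[of n J] graph_rank_le[OF n, of J] by linarith
    moreover have "k * (n - 1) = k * (card (graph_components n J) - 1) + k * graph_rank n J"
      using calculation(2) by (metis distrib_left)
    ultimately show "k * (n - 1) \<le> f (\<lambda>_. {..<k}) J" by (simp add: f_def)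
  qed auto
  then obtain A where A: "Inv A" and
    Amin: "\<And>B. Inv B \<Longrightarrow> (\<Sum>e\<in>E. card (A e)) \<le> (\<Sum>e\<in>E. card (B e))"
    using ex_has_least_nat[of Inv _ "\<lambda>A. \<Sum>e\<in>E. card (A e)"] by blast
  have Afin: "finite (A e)" if "e \<in> E" for e using A that unfolding Inv_def
    using finite_subset by blast
  have single: "card (A e) \<le> 1" if e: "e \<in> E" for e
  proof (rule ccontr)
    assume "\<not> card (A e) \<le> 1"
    then obtain x y where xy: "x \<in> A e" "y \<in> A e" "x \<noteq> y"
      using Afin[OF e] using card_le_Suc0_iff_eq[OF Afin[OF e]] by auto
    have viol: "\<exists>J\<subseteq>E. e \<in> J \<and> f (A(e := A e - {z})) J < k * (n - 1)"
      if z: "z \<in> A e" for z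
    proof -
      let ?B = "A(e := A e - {z})"
      have "(\<Sum>e\<in>E. card (?B e)) < (\<Sum>e\<in>E. card (A e))"
      proof (rule sum_strict_mono_ex1[OF finE])
        show "\<forall>g\<in>E. card (?B g) \<le> card (A g)" using Afin by (auto intro!: card_mono)
        have "card (A e - {z}) < card (A e)" using Afin[OF e] z by (rule card_Diff1_less)
        then show "\<exists>g\<in>E. card (?B g) < card (A g)"
          using e by (intro bexI[of _ e]) (simp only: fun_upd_same)
      qed
      then have "\<not> Inv ?B" using Amin[of ?B] by linarith
      moreover have "A e - {z} \<noteq> {}" using xy by (cases "x = z") auto
      then have "\<forall>g\<in>E. ?B g \<noteq> {} \<and> ?B g \<subseteq> {..<k}"
        using A unfolding Inv_def by auto
      ultimately obtain J where J: "J \<subseteq> E" "f ?B J < k * (n - 1)"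
        unfolding Inv_def by (auto simp: not_le)
      have "e \<in> J"
      proof (rule ccontr)
        assume "e \<notin> J"
        then have "f ?B J = f A J"
          unfolding f_def by (intro arg_cong2[of _ _ _ _ "(+)"] sum.cong refl arg_cong[of _ _ "graph_rank n"]) auto
        then show False using A J unfolding Inv_def by (simp add: not_le[symmetric])
      qed
      then show ?thesis using J by blast
    qed
    obtain J1 where J1: "J1 \<subseteq> E" "e \<in> J1" "f (A(e := A e - {x})) J1 < k * (n - 1)"
      using viol xy by blast
    obtain J2 where J2: "J2 \<subseteq> E" "e \<in> J2" "f (A(e := A e - {y})) J2 < k * (n - 1)"
      using viol xy by blast
    let ?S = "\<lambda>i. {g \<in> J1. i \<in> (A(e := A e - {x})) g}"
    let ?T = "\<lambda>i. {g \<in> J2. i \<in> (A(e := A e - {y})) g}"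
    \<comment> \<open>Since \<open>x\<close> and \<open>y\<close> differ, the incidence of
      \<open>e\<close> deleted on one side survives on the other, and the unions recover all of
      \<open>A\<close> on \<open>J1 \<union> J2\<close>. Whether an intersection contains
      \<open>e\<close> depends on the colour; leaving \<open>e\<close> out gives one set that works
      for all colours.\<close>
    let ?I = "J1 \<inter> J2 - {e}"
    have "graph_rank n {g \<in> J1 \<union> J2. i \<in> A g} + graph_rank n {g \<in> ?I. i \<in> A g}
      \<le> graph_rank n (?S i) + graph_rank n (?T i)" for i
    proof -
      have "?S i \<union> ?T i = {g \<in> J1 \<union> J2. i \<in> A g}" using J1 J2 xy by auto
      moreover have "graph_rank n {g \<in> ?I. i \<in> A g} \<le> graph_rank n (?S i \<inter> ?T i)"
        using J1 E by (intro graph_rank_mono) auto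
      moreover have "graph_rank n (?S i \<union> ?T i) + graph_rank n (?S i \<inter> ?T i)
        \<le> graph_rank n (?S i) + graph_rank n (?T i)"
        using J1 J2 E by (intro graph_rank_submodular) auto
      ultimately show ?thesis by simp
    qed
    then have sums: "(\<Sum>i<k. graph_rank n {g \<in> J1 \<union> J2. i \<in> A g}) + (\<Sum>i<k. graph_rank n {g \<in> ?I. i \<in> A g})
      \<le> (\<Sum>i<k. graph_rank n (?S i)) + (\<Sum>i<k. graph_rank n (?T i))"
      unfolding sum.distrib[symmetric] by (intro sum_mono) auto
    have finJ: "finite J1" "finite J2" using J1 J2 finE finite_subset by auto
    have cD: "card (E - J) = card E - card J" if "J \<subseteq> E" for J
      using that finE finite_subset by (intro card_Diff_subset) blast+
    have IE: "?I \<subseteq> E" "J1 \<union> J2 \<subseteq> E" using J1 J2 by auto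
    note cU = cD[OF IE(1)] cD[OF IE(2)] cD[OF J1(1)] cD[OF J2(1)]
    have cI: "card ?I + 1 = card (J1 \<inter> J2)"
      using J1(2) J2(2) finJ card_Suc_Diff1[of "J1 \<inter> J2" e] by simp
    have "card J1 + card J2 = card (J1 \<union> J2) + card (J1 \<inter> J2)"
      using finJ by (rule card_Un_Int)
    moreover have "card (J1 \<union> J2) \<le> card E" "card J1 \<le> card E" "card J2 \<le> card E" "card ?I \<le> card E"
      using card_mono[OF finE IE(2)] card_mono[OF finE J1(1)] card_mono[OF finE J2(1)]
        card_mono[OF finE IE(1)] by simp_all
    ultimately have cards: "card (E - (J1 \<union> J2)) + card (E - ?I) \<le> card (E - J1) + card (E - J2) + 1"
      unfolding cU using cI by linarith
    \<comment> \<open>Leaving \<open>e\<close> out of the intersection costs 1. The two violated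
      inequalities between natural numbers are strict and gain 2, which is the
      contradiction.\<close>
    have "f A (J1 \<union> J2) + f A ?I \<le> f (A(e := A e - {x})) J1 + f (A(e := A e - {y})) J2 + 1"
      unfolding f_def using sums cards by linarith
    moreover have "k * (n - 1) \<le> f A (J1 \<union> J2)" "k * (n - 1) \<le> f A ?I"
      using A IE unfolding Inv_def by blast+
    ultimately show False using J1 J2 by linarith
  qed
  define c where "c e = (THE i. i \<in> A e)" for e
  have Ac: "A e = {c e}" if "e \<in> E" for e
  proof -
    have "A e \<noteq> {}" using A that unfolding Inv_def by auto
    then have "card (A e) = 1" using single[OF that] Afin[OF that]
      by (metis One_nat_def card_gt_0_iff le_antisym Suc_leI)
    then obtain i where "A e = {i}" by (auto simp: card_1_singleton_iff)
    then show ?thesis by (simp add: c_def)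
  qed
  have "k * (n - 1) \<le> f A E" using A unfolding Inv_def by auto
  also have "f A E = (\<Sum>i<k. graph_rank n {e \<in> E. c e = i})"
    unfolding f_def using Ac by (auto intro!: sum.cong arg_cong[of _ _ "graph_rank n"])
  finally have le: "k * (n - 1) \<le> (\<Sum>i<k. graph_rank n {e \<in> E. c e = i})" .
  have "graph_rank n {e \<in> E. c e = i} = n - 1" if "i < k" for i
  proof (rule ccontr)
    assume "graph_rank n {e \<in> E. c e = i} \<noteq> n - 1"
    then have "graph_rank n {e \<in> E. c e = i} < n - 1" using graph_rank_le[OF n] le_neq_implies_less by blast
    then have "(\<Sum>i<k. graph_rank n {e \<in> E. c e = i}) < (\<Sum>i<k. n - 1)"
      using that graph_rank_le[OF n] by (intro sum_strict_mono_ex1) auto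
    then show False using le by simp
  qed
  then show ?thesis using connected_on_iff_graph_rank[OF n] by blast
qed

section \<open>From connected colour classes to the tree packing number\<close>

lemma has_cycle_connected_Diff:
  assumes "connected_on n T" "has_cycle T"
  obtains e where "e \<in> T" "connected_on n (T - {e})"
proof -
  obtain vs where vs: "length vs \<ge> 3" "distinct vs"
    "\<And>i. Suc i < length vs \<Longrightarrow> {vs ! i, vs ! Suc i} \<in> T" "{last vs, hd vs} \<in> T"
    using assms(2) unfolding has_cycle_def by blast
  define l where "l = length vs - 1"
  have l: "l \<ge> 2" "l < length vs" "Suc l = length vs" using vs(1) by (auto simp: l_def)
  have ends: "last vs = vs ! l" "hd vs = vs ! 0"
    using vs(1) last_conv_nth[of vs] hd_conv_nth[of vs] by (cases "vs = []"; simp add: l_def)+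
  let ?e = "{vs ! 0, vs ! l}"
  let ?T = "T - {?e}"
  have e: "?e \<in> T" using vs(4) ends by (simp add: insert_commute)
  have len0: "0 < length vs" using vs(1) by auto
  have ne: "vs ! 0 \<noteq> vs ! l" using nth_eq_iff_index_eq[OF vs(2) len0 l(2)] l(1) by simp
  \<comment> \<open>The edge to be removed is the one that closes the cycle; its ends stay joined by
    the rest. Because the vertices are distinct and there are at least three of them, no consecutive
    pair coincides with the closing edge.\<close>
  have path: "(vs ! 0, vs ! i) \<in> (adj_rel ?T)\<^sup>*" if "i \<le> l" for i
    using that
  proof (induction i)
    case (Suc i)
    have i: "i < length vs" "Suc i < length vs" using Suc.prems l by linarith+
    have "{vs ! i, vs ! Suc i} \<noteq> ?e"
      using nth_eq_iff_index_eq[OF vs(2) i(1) len0] nth_eq_iff_index_eq[OF vs(2) i(1) l(2)]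
        nth_eq_iff_index_eq[OF vs(2) i(2) len0] nth_eq_iff_index_eq[OF vs(2) i(2) l(2)] l(1) Suc.prems
      unfolding doubleton_eq_iff by auto
    moreover have "vs ! i \<noteq> vs ! Suc i"
      using nth_eq_iff_index_eq[OF vs(2) i] by simp
    ultimately have "(vs ! i, vs ! Suc i) \<in> adj_rel ?T"
      using vs(3)[of i] l Suc.prems by (auto simp: adj_rel_def)
    moreover have "(vs ! 0, vs ! i) \<in> (adj_rel ?T)\<^sup>*" using Suc by simp
    ultimately show ?case by (rule rtrancl_into_rtrancl[rotated])
  qed simp
  have "(adj_rel (insert ?e ?T))\<^sup>* = (adj_rel ?T)\<^sup>*"
    by (rule reach_insert_absorb[OF ne path]) simp
  moreover have "insert ?e ?T = T" using e by auto
  ultimately have "connected_on n ?T" using assms(1) by (simp add: connected_on_def)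
  then show ?thesis using that e by blast
qed

text \<open>A connected subset of least cardinality is acyclic, since a cycle would contain a
  removable edge.\<close>

lemma connected_contains_spanning_tree:
  assumes "finite C" "connected_on n C" "C \<subseteq> E"
  shows "\<exists>T\<subseteq>C. spanning_tree n E T"
proof -
  obtain T where T: "T \<subseteq> C" "connected_on n T"
    and least: "\<And>S. S \<subseteq> C \<Longrightarrow> connected_on n S \<Longrightarrow> card T \<le> card S"
    using ex_has_least_nat[of "\<lambda>T. T \<subseteq> C \<and> connected_on n T" C card] assms by blast
  have "\<not> has_cycle T"
  proof
    assume "has_cycle T"
    then obtain e where e: "e \<in> T" "connected_on n (T - {e})"
      using has_cycle_connected_Diff[OF T(2)] by blast
    have "finite T" using T(1) assms(1) finite_subset by blast
    then have "card (T - {e}) < card T" using e(1) by (rule card_Diff1_less)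
    moreover have "card T \<le> card (T - {e})" using T e by (intro least) auto
    ultimately show False by simp
  qed
  then show ?thesis using T assms(3) unfolding spanning_tree_def by blast
qed

lemma le_min_degree_iff: "n > 0 \<Longrightarrow> k \<le> min_degree n E \<longleftrightarrow> (\<forall>v<n. k \<le> degree E v)"
  unfolding min_degree_def by (subst Min_ge_iff) auto

definition edge_disjoint_trees :: "nat \<Rightarrow> nat set set \<Rightarrow> nat set set list \<Rightarrow> bool" where
  "edge_disjoint_trees n E ts \<longleftrightarrow> (\<forall>i<length ts. spanning_tree n E (ts ! i)) \<and>
    (\<forall>i<length ts. \<forall>j<length ts. i \<noteq> j \<longrightarrow> ts ! i \<inter> ts ! j = {})"

text \<open>Every tree has at least \<open>n - 1\<close> edges, because the rank is bounded by the
  number of edges, and it has an edge at every vertex \<open>v\<close>. The latter follows from a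
  path to some second vertex, hence \<open>n \<ge> 2\<close>.\<close>

lemma edge_disjoint_trees_bound:
  assumes E: "E \<subseteq> all_edges n" and n: "n \<ge> 2" and ts: "edge_disjoint_trees n E ts"
  shows "length ts \<le> min_degree n E" "length ts * (n - 1) \<le> card E"
proof -
  let ?I = "{..<length ts}"
  have finE: "finite E" using E finite_subset finite_all_edges by blast
  have tsE: "ts ! i \<subseteq> E" and conn: "connected_on n (ts ! i)" if "i \<in> ?I" for i
    using ts that by (auto simp: edge_disjoint_trees_def spanning_tree_def)
  have fin: "finite (ts ! i)" if "i \<in> ?I" for i using tsE[OF that] finE finite_subset by blast
  have disj: "ts ! i \<inter> ts ! j = {}" if "i \<in> ?I" "j \<in> ?I" "i \<noteq> j" for i j
    using ts that by (auto simp: edge_disjoint_trees_def)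
  have "length ts * (n - 1) = (\<Sum>i\<in>?I. n - 1)" by simp
  also have "\<dots> \<le> (\<Sum>i\<in>?I. card (ts ! i))"
  proof (rule sum_mono)
    fix i assume i: "i \<in> ?I"
    have "graph_rank n (ts ! i) = n - 1"
      using connected_on_iff_graph_rank[of n] conn[OF i] n by simp
    moreover have "ts ! i \<subseteq> all_edges n" using tsE[OF i] E by blast
    ultimately show "n - 1 \<le> card (ts ! i)" using graph_rank_le_card by metis
  qed
  also have "\<dots> = card (\<Union>i\<in>?I. ts ! i)"
    using fin disj by (intro card_UN_disjoint[symmetric]) auto
  also have "\<dots> \<le> card E" using tsE finE by (intro card_mono) auto
  finally show "length ts * (n - 1) \<le> card E" .
  have "length ts \<le> degree E v" if v: "v < n" for v
  proof -
    have "length ts = (\<Sum>i\<in>?I. 1)" by simp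
    also have "\<dots> \<le> (\<Sum>i\<in>?I. card {e \<in> ts ! i. v \<in> e})"
    proof (rule sum_mono)
      fix i assume i: "i \<in> ?I"
      define w where "w = (if v = 0 then 1 else (0::nat))"
      have w: "w < n" "w \<noteq> v" using n by (auto simp: w_def)
      then have "(v, w) \<in> (adj_rel (ts ! i))\<^sup>*" using conn[OF i] v by (auto simp: connected_on_def)
      then obtain z where "(v, z) \<in> adj_rel (ts ! i)"
        using w(2) by (auto elim: converse_rtranclE)
      then have "{v, z} \<in> {e \<in> ts ! i. v \<in> e}" by (auto simp: adj_rel_def)
      then have "{e \<in> ts ! i. v \<in> e} \<noteq> {}" by blast
      then show "1 \<le> card {e \<in> ts ! i. v \<in> e}" using fin[OF i] by (simp add: Suc_le_eq card_gt_0_iff)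
    qed
    also have "\<dots> = card (\<Union>i\<in>?I. {e \<in> ts ! i. v \<in> e})"
      using fin disj by (intro card_UN_disjoint[symmetric]) auto
    also have "\<dots> \<le> degree E v"
      unfolding degree_def using tsE finE by (intro card_mono) auto
    finally show ?thesis .
  qed
  then show "length ts \<le> min_degree n E" using le_min_degree_iff n by simp
qed

text \<open>The trivial upper bounds do double duty: they make the set under \<open>Max\<close>
  finite and identify its largest element. The value 0 is attained by the empty list and is treated
  apart because the colouring theorem requires a positive number of colours.\<close>

lemma tree_packing_eqI:
  assumes E: "E \<subseteq> all_edges n" and n: "n \<ge> 2"
    and pc: "partition_connected n (min (min_degree n E) (card E div (n - 1))) E"
  shows "tree_packing n E = min (min_degree n E) (card E div (n - 1))"
proof -
  let ?t = "min (min_degree n E) (card E div (n - 1))"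
  let ?K = "{k. \<exists>ts. length ts = k \<and> edge_disjoint_trees n E ts}"
  have le: "k \<le> ?t" if k: "k \<in> ?K" for k
  proof -
    obtain ts where ts: "length ts = k" "edge_disjoint_trees n E ts" using k by auto
    have "k * (n - 1) \<le> card E" using edge_disjoint_trees_bound(2)[OF E n ts(2)] ts(1) by simp
    then have "k \<le> card E div (n - 1)" using n by (simp add: less_eq_div_iff_mult_less_eq)
    then show ?thesis using edge_disjoint_trees_bound(1)[OF E n ts(2)] ts(1) by simp
  qed
  have finE: "finite E" using E finite_subset finite_all_edges by blast
  have "?t \<in> ?K"
  proof (cases "?t = 0")
    case True
    have "edge_disjoint_trees n E []" by (simp add: edge_disjoint_trees_def)
    then show ?thesis using True by (metis (mono_tags, lifting) list.size(3) mem_Collect_eq)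
  next
    case False
    then obtain c where c: "\<And>i. i < ?t \<Longrightarrow> connected_on n {e \<in> E. c e = (i::nat)}"
      using tutte_nash_williams[OF E _ _ pc] n by auto
    have "\<exists>T. T \<subseteq> {e \<in> E. c e = i} \<and> spanning_tree n E T" if "i < ?t" for i
      using connected_contains_spanning_tree[OF _ c[OF that], of E] finE by auto
    then obtain T where T: "\<And>i. i < ?t \<Longrightarrow> T i \<subseteq> {e \<in> E. c e = i} \<and> spanning_tree n E (T i)"
      by metis
    have "T i \<inter> T j = {}" if "i < ?t" "j < ?t" "i \<noteq> j" for i j
      using T[OF that(1)] T[OF that(2)] that(3) by blast
    then have "edge_disjoint_trees n E (map T [0..<?t])"
      using T unfolding edge_disjoint_trees_def by simp
    moreover have "length (map T [0..<?t]) = ?t" by simp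
    ultimately show ?thesis by blast
  qed
  moreover have "?K \<subseteq> {..?t}" by (intro subsetI, drule le) simp
  then have "finite ?K" by (rule finite_subset) simp
  ultimately have "Max ?K = ?t" using le by (intro Max_eqI)
  moreover have "tree_packing n E = Max ?K"
    unfolding tree_packing_def edge_disjoint_trees_def
    by (intro arg_cong[of _ _ Max] Collect_cong ex_cong1) auto
  ultimately show ?thesis by simp
qed

section \<open>Cuts and sparse sets as certificates of partition connectivity\<close>

definition inner_edges :: "nat set set \<Rightarrow> nat set \<Rightarrow> nat set set" where
  "inner_edges E W = {e \<in> E. e \<subseteq> W}"

definition edge_cut :: "nat set set \<Rightarrow> nat set \<Rightarrow> nat set set" where
  "edge_cut E U = {e \<in> E. e \<inter> U \<noteq> {} \<and> \<not> e \<subseteq> U}"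

lemma degree_eq_card_edge_cut:
  assumes "E \<subseteq> all_edges n"
  shows "degree E v = card (edge_cut E {v})"
proof -
  have "\<not> e \<subseteq> {v}" if "e \<in> E" for e
  proof -
    have "e \<in> all_edges n" using that assms by auto
    then show ?thesis by (auto elim!: all_edgesE)
  qed
  then have "{e \<in> E. v \<in> e} = edge_cut E {v}" unfolding edge_cut_def by auto
  then show ?thesis by (simp add: degree_def)
qed

text \<open>If \<open>v\<close> has no neighbour inside \<open>U\<close>, the cut of
  \<open>U\<close> contains the disjoint union of the cut of \<open>U - {v}\<close> and the star at
  \<open>v\<close>; the star has at least \<open>t\<close> edges, and induction covers the rest.
  Otherwise the inner edges cover \<open>U\<close>, so there are at least half as many as vertices,
  rounded up, and \<open>dense\<close> applies. A singleton always falls into the first case, which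
  is why \<open>dense\<close> starts at size 2.\<close>

lemma edge_cut_lower_bound:
  assumes G: "G \<subseteq> all_edges n" and n: "n > 0" and deg: "t \<le> min_degree n G"
    and dense: "\<And>U. U \<subseteq> {0..<n} \<Longrightarrow> 2 \<le> card U \<Longrightarrow> card U \<le> a \<Longrightarrow>
      (card U + 1) div 2 \<le> card (inner_edges G U) \<Longrightarrow> t * card U \<le> card (edge_cut G U)"
    and U: "U \<subseteq> {0..<n}" "card U \<le> a"
  shows "t * card U \<le> card (edge_cut G U)"
  using U
proof (induction "card U" arbitrary: U rule: less_induct)
  case less
  have finG: "finite G" using G finite_subset finite_all_edges by blast
  have finU: "finite U" using less.prems finite_subset by blast
  show ?case
  proof (cases "\<exists>v\<in>U. \<forall>e\<in>G. v \<in> e \<longrightarrow> \<not> e \<subseteq> U")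
    case True
    then obtain v where v: "v \<in> U" "\<And>e. e \<in> G \<Longrightarrow> v \<in> e \<Longrightarrow> \<not> e \<subseteq> U" by blast
    let ?U = "U - {v}"
    have cU: "card U = Suc (card ?U)" using card_Suc_Diff1[OF finU v(1)] by simp
    have IH: "t * card ?U \<le> card (edge_cut G ?U)" using less cU by auto
    have pair: "\<exists>x y. e = {x, y} \<and> x \<noteq> y" if "e \<in> G" for e
      using that G by (meson all_edgesE subsetD)
    have dis: "edge_cut G ?U \<inter> edge_cut G {v} = {}"
    proof (rule ccontr)
      assume "edge_cut G ?U \<inter> edge_cut G {v} \<noteq> {}"
      then obtain e where e: "e \<in> G" "e \<inter> ?U \<noteq> {}" "e \<inter> {v} \<noteq> {}" by (auto simp: edge_cut_def)
      obtain x y where "e = {x, y}" using pair[OF e(1)] by auto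
      then have "v \<in> e" "e \<subseteq> U" using e v(1) by auto
      then show False using v(2) e(1) by auto
    qed
    have sub: "edge_cut G ?U \<union> edge_cut G {v} \<subseteq> edge_cut G U"
    proof
      fix e assume "e \<in> edge_cut G ?U \<union> edge_cut G {v}"
      then have e: "e \<in> G" "e \<inter> U \<noteq> {}" "e \<inter> ?U \<noteq> {} \<and> \<not> e \<subseteq> ?U \<or> v \<in> e"
        using v(1) by (auto simp: edge_cut_def)
      have "\<not> e \<subseteq> U" using e v(2)[OF e(1)] by auto
      then show "e \<in> edge_cut G U" using e by (auto simp: edge_cut_def)
    qed
    have "t \<le> degree G v" using deg le_min_degree_iff[OF n] v(1) less.prems by auto
    then have "t \<le> card (edge_cut G {v})" using degree_eq_card_edge_cut[OF G] by simp
    moreover have "card (edge_cut G ?U) + card (edge_cut G {v}) \<le> card (edge_cut G U)"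
      using card_mono[OF _ sub] finG dis card_Un_disjoint[OF _ _ dis] by (simp add: edge_cut_def)
    ultimately show ?thesis using IH cU by simp
  next
    case False
    then have nb: "\<And>v. v \<in> U \<Longrightarrow> \<exists>e\<in>G. v \<in> e \<and> e \<subseteq> U" by blast
    have card2: "card e = 2" if "e \<in> G" for e using that G by (auto simp: all_edges_alt)
    have finI: "finite (inner_edges G U)" using finG by (simp add: inner_edges_def)
    have "U \<subseteq> \<Union> (inner_edges G U)" using nb by (auto simp: inner_edges_def)
    then have "card U \<le> card (\<Union> (inner_edges G U))"
      using finI finU by (intro card_mono finite_Union) (auto simp: inner_edges_def intro: finite_subset)
    also have "\<dots> \<le> (\<Sum>e\<in>inner_edges G U. card e)" by (rule card_Union_le_sum_card)
    also have "\<dots> = (\<Sum>e\<in>inner_edges G U. 2)" using card2 by (intro sum.cong) (auto simp: inner_edges_def)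
    finally have le: "card U \<le> 2 * card (inner_edges G U)" by simp
    show ?thesis
    proof (cases "U = {}")
      case False
      then obtain v e where "v \<in> U" "e \<in> G" "e \<subseteq> U" using nb by blast
      then have 2: "2 \<le> card U" using card2 card_mono[OF finU, of e] by simp
      have "(card U + 1) div 2 \<le> card (inner_edges G U)" using le by linarith
      with less.prems(1) 2 less.prems(2) show ?thesis by (rule dense)
    qed simp
  qed
qed

text \<open>Two graphs occur because sparsity is known only at one fixed time, while the cut bound
  concerns a later graph. Crossing edges of \<open>G0\<close> are crossing edges of
  \<open>G\<close>, so it suffices that the earlier graph already has \<open>t * (n - 1)\<close>
  edges.\<close>

lemma partition_connectedI:
  assumes G: "G \<subseteq> all_edges n" and G0: "G0 \<subseteq> G" and n: "n \<ge> 2"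
    and t: "t * (n - 1) \<le> card G0"
    and small: "\<And>U. U \<subseteq> {0..<n} \<Longrightarrow> 100 * card U \<le> n \<Longrightarrow> t * card U \<le> card (edge_cut G U)"
    and sparse: "\<And>W. W \<subseteq> {0..<n} \<Longrightarrow> W \<noteq> {} \<Longrightarrow> 100 * card W \<le> 99 * n \<Longrightarrow>
      card (inner_edges G0 W) * (n - 1) \<le> card G0 * (card W - 1)"
  shows "partition_connected n t G"
  unfolding partition_connected_def
proof (intro allI impI)
  fix P assume P: "partition_on {0..<n} P"
  have finG: "finite G" using G by (rule finite_subset) simp
  have finG0: "finite G0" using G0 finG by (rule finite_subset)
  have finP: "finite P" using P by (rule finite_elements[rotated]) simp
  have PV: "\<Union>P = {0..<n}" and Pd: "disjoint P" and Pne: "{} \<notin> P"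
    using P by (auto dest: partition_onD1 partition_onD2 partition_onD3)
  have CV: "C \<subseteq> {0..<n}" if "C \<in> P" for C using that PV by blast
  then have finC: "finite C" if "C \<in> P" for C by (rule finite_subset[OF _ finite_atLeastLessThan]) (rule that)
  have sumP: "(\<Sum>C\<in>Q. card C) = card (\<Union>Q)" if "Q \<subseteq> P" for Q
  proof (rule card_Union_disjoint[symmetric])
    show "pairwise disjnt Q" using Pd that unfolding pairwise_def disjnt_def disjoint_def by blast
    show "finite C" if "C \<in> Q" for C using finC that \<open>Q \<subseteq> P\<close> by blast
  qed
  have pos: "1 \<le> card C" if "C \<in> P" for C
    using that Pne finC[OF that] by (cases "C = {}") (auto simp: Suc_le_eq card_gt_0_iff)
  show "t * (card P - 1) \<le> card (crossing P G)"
  proof (cases "\<exists>C\<in>P. 99 * n < 100 * card C")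
    case True
    then obtain C where C: "C \<in> P" "99 * n < 100 * card C" by blast
    \<comment> \<open>Every part other than \<open>C\<close> lies in \<open>U\<close> and is
      nonempty, so \<open>card P - 1\<close> is at most \<open>card U\<close>; and an edge leaving
      \<open>U\<close> goes to \<open>C\<close>, hence crosses.\<close>
    define U where "U = {0..<n} - C"
    have "card U = n - card C"
      unfolding U_def using card_Diff_subset[OF finC[OF C(1)] CV[OF C(1)]] by simp
    then have "100 * card U \<le> n" using C by simp
    then have tU: "t * card U \<le> card (edge_cut G U)" by (intro small) (auto simp: U_def)
    have "edge_cut G U \<subseteq> crossing P G"
    proof
      fix e assume e: "e \<in> edge_cut G U"
      then have "e \<subseteq> {0..<n}" using G by (auto simp: edge_cut_def all_edges_alt)
      then obtain a b where ab: "a \<in> e" "a \<notin> C" "b \<in> e" "b \<in> C" using e by (auto simp: edge_cut_def U_def)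
      have "\<not> e \<subseteq> D" if "D \<in> P" for D
      proof
        assume "e \<subseteq> D"
        then have "D = C" using ab Pd that C by (auto simp: disjoint_def)
        then show False using ab \<open>e \<subseteq> D\<close> by auto
      qed
      then show "e \<in> crossing P G" using e by (auto simp: crossing_def edge_cut_def)
    qed
    then have "card (edge_cut G U) \<le> card (crossing P G)"
      using finG by (intro card_mono) (auto simp: crossing_def)
    moreover have "card P - 1 \<le> card U"
    proof -
      have "card P - 1 = (\<Sum>D\<in>P - {C}. 1)" using C finP by simp
      also have "\<dots> \<le> (\<Sum>D\<in>P - {C}. card D)" using pos by (intro sum_mono) auto
      also have "\<dots> = card (\<Union>(P - {C}))" by (rule sumP) auto
      also have "\<dots> \<le> card U"
      proof (rule card_mono)
        show "\<Union>(P - {C}) \<subseteq> U" using PV Pd C unfolding U_def disjoint_def by blast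
      qed (simp add: U_def)
      finally show ?thesis .
    qed
    ultimately show ?thesis
      using tU mult_le_mono2[of "card P - 1" "card U" t] by linarith
  next
    case False
    have split: "card G0 = (\<Sum>C\<in>P. card (inner_edges G0 C)) + card (crossing P G0)"
    proof -
      have "G0 = (\<Union>C\<in>P. inner_edges G0 C) \<union> crossing P G0" by (auto simp: inner_edges_def crossing_def)
      moreover have "(\<Union>C\<in>P. inner_edges G0 C) \<inter> crossing P G0 = {}" by (auto simp: inner_edges_def crossing_def)
      moreover have "card (\<Union>C\<in>P. inner_edges G0 C) = (\<Sum>C\<in>P. card (inner_edges G0 C))"
      proof (rule card_UN_disjoint[OF finP])
        show "\<forall>C\<in>P. finite (inner_edges G0 C)" using finG0 by (simp add: inner_edges_def)
        show "\<forall>C\<in>P. \<forall>D\<in>P. C \<noteq> D \<longrightarrow> inner_edges G0 C \<inter> inner_edges G0 D = {}"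
        proof (intro ballI impI equals0I)
          fix C D e assume CD: "C \<in> P" "D \<in> P" "C \<noteq> D" and e: "e \<in> inner_edges G0 C \<inter> inner_edges G0 D"
          have "e \<in> all_edges n" using e G0 G by (auto simp: inner_edges_def)
          then have "e \<noteq> {}" by (auto elim: all_edgesE)
          moreover have "e \<subseteq> C \<inter> D" using e by (auto simp: inner_edges_def)
          moreover have "C \<inter> D = {}" using CD Pd unfolding disjoint_def by blast
          ultimately show False by blast
        qed
      qed
      moreover have "finite (\<Union>C\<in>P. inner_edges G0 C)" "finite (crossing P G0)"
        using finG0 finP by (auto simp: inner_edges_def crossing_def)
      ultimately show ?thesis using card_Un_disjoint by metis
    qed
    have "(\<Sum>C\<in>P. card (inner_edges G0 C)) * (n - 1) = (\<Sum>C\<in>P. card (inner_edges G0 C) * (n - 1))"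
      by (rule sum_distrib_right)
    also have "\<dots> \<le> (\<Sum>C\<in>P. card G0 * (card C - 1))"
    proof (rule sum_mono)
      fix C assume C: "C \<in> P"
      show "card (inner_edges G0 C) * (n - 1) \<le> card G0 * (card C - 1)"
        using False C PV Pne by (intro sparse) auto
    qed
    also have "\<dots> = card G0 * (\<Sum>C\<in>P. card C - 1)" by (rule sum_distrib_left[symmetric])
    also have "(\<Sum>C\<in>P. card C - 1) = n - card P"
    proof -
      have "(\<Sum>C\<in>P. card C - 1) + card P = (\<Sum>C\<in>P. card C - 1 + 1)" by (simp only: sum.distrib) simp
      also have "\<dots> = (\<Sum>C\<in>P. card C)" using pos by (intro sum.cong refl) (metis le_add_diff_inverse2)
      also have "\<dots> = n" using sumP[of P] PV by simp
      finally show ?thesis by simp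
    qed
    finally have 1: "(\<Sum>C\<in>P. card (inner_edges G0 C)) * (n - 1) \<le> card G0 * (n - card P)" .
    have "P \<noteq> {}" using PV n by auto
    then have P1: "1 \<le> card P" using finP by (simp add: Suc_le_eq card_gt_0_iff)
    have "card P = (\<Sum>C\<in>P. 1)" by simp
    also have "\<dots> \<le> (\<Sum>C\<in>P. card C)" using pos by (intro sum_mono) auto
    finally have Pn: "card P \<le> n" using sumP[of P] PV by simp
    \<comment> \<open>The parts together hold at most a fraction (n - card P) / (n - 1) of the edges
      of \<open>G0\<close>, which leaves a fraction (card P - 1) / (n - 1) for the crossing edges.
      Everything is multiplied by \<open>n - 1\<close> to stay in the natural numbers.\<close>
    have "card G0 * (card P - 1) + card G0 * (n - card P) = card G0 * (n - 1)"
      using P1 Pn by (simp add: distrib_left[symmetric])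
    also have "\<dots> = (\<Sum>C\<in>P. card (inner_edges G0 C)) * (n - 1) + card (crossing P G0) * (n - 1)"
      using split by (simp add: distrib_right[symmetric])
    finally have "card G0 * (card P - 1) \<le> card (crossing P G0) * (n - 1)" using 1 by linarith
    moreover have "t * (n - 1) * (card P - 1) \<le> card G0 * (card P - 1)" using t by (rule mult_le_mono1)
    moreover have "(t * (card P - 1)) * (n - 1) = t * (n - 1) * (card P - 1)" by (simp only: ac_simps)
    ultimately have "(t * (card P - 1)) * (n - 1) \<le> card (crossing P G0) * (n - 1)" by linarith
    then have "t * (card P - 1) \<le> card (crossing P G0)" using n by simp
    also have "\<dots> \<le> card (crossing P G)"
      using G0 finG by (intro card_mono) (auto simp: crossing_def)
    finally show ?thesis .
  qed
qed

section \<open>Random orderings\<close>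

definition subsets_of_size :: "'a set \<Rightarrow> nat \<Rightarrow> 'a set set" where
  "subsets_of_size X m = {A. A \<subseteq> X \<and> card A = m}"

lemma finite_subsets_of_size [simp]: "finite X \<Longrightarrow> finite (subsets_of_size X m)"
  unfolding subsets_of_size_def by simp

lemma card_subsets_of_size: "finite X \<Longrightarrow> card (subsets_of_size X m) = card X choose m"
  unfolding subsets_of_size_def by (rule n_subsets)

text \<open>A permutation amounts to the set \<open>A\<close> of its first \<open>m\<close>
  elements, an ordering of \<open>A\<close> and an ordering of the rest. \<open>R\<close> sees the
  prefix only as a set but the suffix as a list, so that a later time can still be examined within
  the suffix.\<close>

lemma card_permutations_split:
  assumes X: "finite X" and m: "m \<le> card X"
  shows "card {xs \<in> permutations_of_set X. R (set (take m xs)) (drop m xs)} =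
    (\<Sum>A\<in>subsets_of_size X m. fact m * card {zs \<in> permutations_of_set (X - A). R A zs})"
proof -
  let ?S = "SIGMA A : subsets_of_size X m. permutations_of_set A \<times> {zs \<in> permutations_of_set (X - A). R A zs}"
  let ?T = "{xs \<in> permutations_of_set X. R (set (take m xs)) (drop m xs)}"
  have "bij_betw (\<lambda>(A, ys, zs). ys @ zs) ?S ?T"
  proof (rule bij_betw_byWitness[where f' = "\<lambda>xs. (set (take m xs), take m xs, drop m xs)"])
    have len: "length ys = m" if "card A = m" "ys \<in> permutations_of_set A" for A :: "'a set" and ys
      using that length_finite_permutations_of_set by blast
    show "\<forall>a\<in>?S. (\<lambda>xs. (set (take m xs), take m xs, drop m xs)) ((\<lambda>(A, ys, zs). ys @ zs) a) = a"
      using len by (auto simp: subsets_of_size_def permutations_of_setD)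
    show "\<forall>xs\<in>?T. (\<lambda>(A, ys, zs). ys @ zs) (set (take m xs), take m xs, drop m xs) = xs" by simp
    show "(\<lambda>(A, ys, zs). ys @ zs) ` ?S \<subseteq> ?T"
    proof clarify
      fix A ys zs
      assume a: "A \<in> subsets_of_size X m" "ys \<in> permutations_of_set A"
        "zs \<in> permutations_of_set (X - A)" "R A zs"
      then have "length ys = m" using len by (auto simp: subsets_of_size_def)
      then show "ys @ zs \<in> permutations_of_set X \<and> R (set (take m (ys @ zs))) (drop m (ys @ zs))"
        using a by (auto simp: subsets_of_size_def permutations_of_set_def)
    qed
    show "(\<lambda>xs. (set (take m xs), take m xs, drop m xs)) ` ?T \<subseteq> ?S"
    proof
      fix a assume "a \<in> (\<lambda>xs. (set (take m xs), take m xs, drop m xs)) ` ?T"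
      then obtain xs where xs: "xs \<in> permutations_of_set X" "R (set (take m xs)) (drop m xs)"
        and a: "a = (set (take m xs), take m xs, drop m xs)" by auto
      have d: "distinct xs" "set xs = X" using xs(1) by (auto dest: permutations_of_setD)
      have app: "take m xs @ drop m xs = xs" by simp
      have dd: "distinct (take m xs)" "distinct (drop m xs)" "set (take m xs) \<inter> set (drop m xs) = {}"
        "set (take m xs) \<union> set (drop m xs) = X"
        using d app by (auto simp: set_take_disj_set_drop_if_distinct simp flip: set_append)
      have "length xs = card X" using d distinct_card by fastforce
      then have "card (set (take m xs)) = m" using dd(1) m by (simp add: distinct_card)
      moreover have "set (drop m xs) = X - set (take m xs)" using dd by blast
      ultimately show "a \<in> ?S" unfolding a using dd xs(2) d
        by (auto simp: subsets_of_size_def permutations_of_set_def dest: in_set_takeD)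
    qed
  qed
  then have "card ?T = card ?S" by (simp add: bij_betw_same_card)
  also have "\<dots> = (\<Sum>A\<in>subsets_of_size X m. card (permutations_of_set A \<times> {zs \<in> permutations_of_set (X - A). R A zs}))"
    using X by (intro card_SigmaI) auto
  also have "\<dots> = (\<Sum>A\<in>subsets_of_size X m. fact m * card {zs \<in> permutations_of_set (X - A). R A zs})"
  proof (rule sum.cong[OF refl])
    fix A assume A: "A \<in> subsets_of_size X m"
    then have "finite A" using X by (auto simp: subsets_of_size_def intro: finite_subset)
    then have "card (permutations_of_set A) = fact m"
      using A by (auto simp: subsets_of_size_def)
    then show "card (permutations_of_set A \<times> {zs \<in> permutations_of_set (X - A). R A zs}) =
      fact m * card {zs \<in> permutations_of_set (X - A). R A zs}"
      unfolding card_cartesian_product by simp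
  qed
  finally show ?thesis .
qed

lemma card_permutations_prefix:
  assumes X: "finite X" and m: "m \<le> card X"
  shows "card {xs \<in> permutations_of_set X. Q (set (take m xs))} =
    card {A \<in> subsets_of_size X m. Q A} * (fact m * fact (card X - m))"
proof -
  have "card {xs \<in> permutations_of_set X. Q (set (take m xs))} =
    (\<Sum>A\<in>subsets_of_size X m. fact m * card {zs \<in> permutations_of_set (X - A). Q A})"
    using card_permutations_split[OF X m, of "\<lambda>A zs. Q A"] by simp
  also have "\<dots> = (\<Sum>A\<in>subsets_of_size X m. if Q A then fact m * fact (card X - m) else 0)"
    using X by (intro sum.cong) (auto simp: subsets_of_size_def card_Diff_subset finite_subset)
  also have "\<dots> = card {A \<in> subsets_of_size X m. Q A} * (fact m * fact (card X - m))"
    using X by (simp add: sum.If_cases Int_def)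
  finally show ?thesis .
qed

definition subset_prob :: "'a set \<Rightarrow> nat \<Rightarrow> ('a set \<Rightarrow> bool) \<Rightarrow> real" where
  "subset_prob X m Q = real (card {A \<in> subsets_of_size X m. Q A}) / real (card X choose m)"

text \<open>The ground set is arbitrary because conditioning on a prefix set \<open>A\<close> leaves
  a uniform ordering of \<open>X - A\<close>, to which the same results are applied again.\<close>

definition ordering_prob :: "'a set \<Rightarrow> ('a list \<Rightarrow> bool) \<Rightarrow> real" where
  "ordering_prob X P = real (card {xs \<in> permutations_of_set X. P xs}) / fact (card X)"

lemma ordering_prob_prefix:
  assumes X: "finite X" and m: "m \<le> card X"
  shows "ordering_prob X (\<lambda>xs. Q (set (take m xs))) = subset_prob X m Q"
proof -
  have "fact (card X) = real (card X choose m) * (fact m * fact (card X - m))"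
    using binomial_fact_lemma[OF m] by (metis mult.commute of_nat_fact of_nat_mult)
  then show ?thesis
    unfolding ordering_prob_def subset_prob_def card_permutations_prefix[OF X m] by simp
qed

lemma ordering_prob_mono:
  assumes "finite X" "\<And>xs. xs \<in> permutations_of_set X \<Longrightarrow> P xs \<Longrightarrow> Q xs"
  shows "ordering_prob X P \<le> ordering_prob X Q"
  unfolding ordering_prob_def using assms
  by (intro divide_right_mono) (auto intro!: card_mono)

lemma ordering_prob_nonneg: "0 \<le> ordering_prob X P"
  unfolding ordering_prob_def by simp

lemma ordering_prob_not:
  assumes "finite X"
  shows "ordering_prob X (\<lambda>xs. \<not> P xs) = 1 - ordering_prob X P"
proof -
  have "card (permutations_of_set X) = card {xs \<in> permutations_of_set X. P xs} + card {xs \<in> permutations_of_set X. \<not> P xs}"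
    by (subst card_Un_disjoint[symmetric]) (auto intro: arg_cong[of _ _ card])
  then have "real (card {xs \<in> permutations_of_set X. P xs}) + real (card {xs \<in> permutations_of_set X. \<not> P xs}) = fact (card X)"
    using assms by (metis card_permutations_of_set of_nat_add of_nat_fact)
  then show ?thesis unfolding ordering_prob_def by (simp add: field_simps)
qed

lemma ordering_prob_disj_le:
  "ordering_prob X (\<lambda>xs. P xs \<or> Q xs) \<le> ordering_prob X P + ordering_prob X Q"
proof -
  have "{xs \<in> permutations_of_set X. P xs \<or> Q xs} =
    {xs \<in> permutations_of_set X. P xs} \<union> {xs \<in> permutations_of_set X. Q xs}" by auto
  then have "card {xs \<in> permutations_of_set X. P xs \<or> Q xs}
    \<le> card {xs \<in> permutations_of_set X. P xs} + card {xs \<in> permutations_of_set X. Q xs}"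
    by (simp only: card_Un_le)
  then have "real (card {xs \<in> permutations_of_set X. P xs \<or> Q xs})
    \<le> real (card {xs \<in> permutations_of_set X. P xs}) + real (card {xs \<in> permutations_of_set X. Q xs})"
    by linarith
  then show ?thesis unfolding ordering_prob_def add_divide_distrib[symmetric]
    by (rule divide_right_mono) simp
qed

lemma ordering_prob_bex_le:
  assumes "finite I"
  shows "ordering_prob X (\<lambda>xs. \<exists>i\<in>I. P i xs) \<le> (\<Sum>i\<in>I. ordering_prob X (P i))"
  using assms
proof (induction I rule: finite_induct)
  case empty
  then show ?case by (simp add: ordering_prob_def)
next
  case (insert i I)
  have "ordering_prob X (\<lambda>xs. \<exists>j\<in>insert i I. P j xs) = ordering_prob X (\<lambda>xs. P i xs \<or> (\<exists>j\<in>I. P j xs))"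
    by simp
  also have "\<dots> \<le> ordering_prob X (P i) + ordering_prob X (\<lambda>xs. \<exists>j\<in>I. P j xs)"
    by (rule ordering_prob_disj_le)
  finally show ?case using insert by simp
qed

lemma subset_prob_mono:
  assumes "finite X" "\<And>A. A \<subseteq> X \<Longrightarrow> card A = m \<Longrightarrow> P A \<Longrightarrow> Q A"
  shows "subset_prob X m P \<le> subset_prob X m Q"
  unfolding subset_prob_def using assms
  by (intro divide_right_mono) (auto intro!: card_mono simp: subsets_of_size_def)

lemma subset_prob_bex_le:
  assumes "finite X" "m \<le> card X" "finite I"
  shows "subset_prob X m (\<lambda>A. \<exists>i\<in>I. P i A) \<le> (\<Sum>i\<in>I. subset_prob X m (P i))"
  using ordering_prob_bex_le[OF assms(3), of X "\<lambda>i xs. P i (set (take m xs))"]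
    ordering_prob_prefix[OF assms(1,2), of "\<lambda>A. \<exists>i\<in>I. P i A"] ordering_prob_prefix[OF assms(1,2)]
  by simp

lemma subsets_of_size_superset:
  assumes X: "finite X" and K: "K \<subseteq> X"
  shows "card {A \<in> subsets_of_size X m. K \<subseteq> A \<and> Q (A - K)} =
    (if card K \<le> m then card {B \<in> subsets_of_size (X - K) (m - card K). Q B} else 0)"
proof (cases "card K \<le> m")
  case True
  have finK: "finite K" using X K finite_subset by blast
  have "bij_betw (\<lambda>A. A - K) {A \<in> subsets_of_size X m. K \<subseteq> A \<and> Q (A - K)}
      {B \<in> subsets_of_size (X - K) (m - card K). Q B}"
  proof (rule bij_betw_byWitness[where f' = "\<lambda>B. B \<union> K"])
    have "card (B \<union> K) = m" if "B \<subseteq> X - K" "card B = m - card K" for B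
      using that True X K finK
      by (subst card_Un_disjoint) (auto intro: finite_subset)
    moreover have "B \<union> K - K = B" if "B \<subseteq> X - K" for B using that by blast
    ultimately show "(\<lambda>B. B \<union> K) ` {B \<in> subsets_of_size (X - K) (m - card K). Q B}
      \<subseteq> {A \<in> subsets_of_size X m. K \<subseteq> A \<and> Q (A - K)}"
      using K by (auto simp: subsets_of_size_def)
  qed (use finK in \<open>auto simp: subsets_of_size_def card_Diff_subset\<close>)
  then show ?thesis using True by (simp add: bij_betw_same_card)
next
  case False
  have "{A \<in> subsets_of_size X m. K \<subseteq> A \<and> Q (A - K)} = {}"
    using False X card_mono[of _ K] by (auto simp: subsets_of_size_def intro: finite_subset)
  then show ?thesis using False by (simp only: card.empty if_False)
qed

text \<open>Divided by the binomial coefficient on the right, this is the probability that a random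
  \<open>s\<close>-subset of an \<open>N\<close>-set contains a given \<open>k\<close>-set, as a
  product of conditional probabilities. \<open>binomial_diff\<close> is the counterpart for avoiding
  a given \<open>k\<close>-set.\<close>

lemma binomial_diff_diff:
  assumes "k \<le> s" "s \<le> N"
  shows "real ((N - k) choose (s - k)) = real (N choose s) * (\<Prod>i<k. real (s - i) / real (N - i))"
  using assms
proof (induction k)
  case (Suc k)
  define a where "a = N - Suc k"
  define b where "b = s - Suc k"
  have ab: "N - k = Suc a" "s - k = Suc b" using Suc.prems by (auto simp: a_def b_def)
  have "real (Suc b) * real (Suc a choose Suc b) = real (Suc a) * real (a choose b)"
    using Suc_times_binomial[of b a] by (metis of_nat_mult)
  then have "real (a choose b) = real (Suc a choose Suc b) * (real (Suc b) / real (Suc a))"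
    by (simp add: field_simps)
  then show ?case using Suc ab by (simp add: a_def b_def mult.assoc)
qed simp

lemma binomial_diff:
  assumes "k + m \<le> N"
  shows "real ((N - k) choose m) = real (N choose m) * (\<Prod>i<k. real (N - m - i) / real (N - i))"
proof -
  have "(N - k) choose m = (N - k) choose (N - m - k)"
    using assms binomial_symmetric[of m "N - k"] by (simp add: add.commute)
  moreover have "N choose m = N choose (N - m)" using assms binomial_symmetric[of m N] by simp
  ultimately show ?thesis using binomial_diff_diff[of k "N - m" N] assms by simp
qed

lemma prod_ratio_le:
  assumes "s \<le> N"
  shows "(\<Prod>i<k. real (s - i) / real (N - i)) \<le> (real s / real N) ^ k"
proof -
  have "(\<Prod>i<k. real (s - i) / real (N - i)) \<le> (\<Prod>i<k. real s / real N)"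
  proof (rule prod_mono, safe)
    fix i
    show "real (s - i) / real (N - i) \<le> real s / real N"
    proof (cases "i < s")
      case True
      then have "real i * real s \<le> real i * real N" using assms by (intro mult_left_mono) auto
      then show ?thesis using True assms by (simp add: of_nat_diff field_simps)
    qed auto
  qed auto
  then show ?thesis by simp
qed

text \<open>Given \<open>K \<subseteq> A\<close>, the remainder \<open>A - K\<close> is a uniform
  subset of \<open>X - K\<close>. The probability of \<open>K \<subseteq> A\<close> is a product of
  factors (m - i) / (N - i), with N the size of \<open>X\<close>, each at most m / N: sampling
  without replacement only helps.\<close>

lemma subset_prob_superset_conj_le:
  assumes X: "finite X" and K: "K \<subseteq> X" and m: "m \<le> card X" "card K \<le> m"
  shows "subset_prob X m (\<lambda>A. K \<subseteq> A \<and> Q (A - K))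
    \<le> (real m / real (card X)) ^ card K * subset_prob (X - K) (m - card K) Q"
proof -
  let ?c = "real (card {B \<in> subsets_of_size (X - K) (m - card K). Q B})"
  let ?b = "real ((card X - card K) choose (m - card K))"
  have finK: "finite K" using X K finite_subset by blast
  have cXK: "card (X - K) = card X - card K" using finK K by (rule card_Diff_subset)
  have "subset_prob X m (\<lambda>A. K \<subseteq> A \<and> Q (A - K)) = ?c / real (card X choose m)"
    unfolding subset_prob_def subsets_of_size_superset[OF X K] using m by simp
  also have "\<dots> = (?b / real (card X choose m)) * (?c / ?b)"
    using m by simp
  also have "?b / real (card X choose m) = (\<Prod>i<card K. real (m - i) / real (card X - i))"
    using m by (subst binomial_diff_diff) auto
  also have "\<dots> * (?c / ?b) \<le> (real m / real (card X)) ^ card K * (?c / ?b)"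
    using prod_ratio_le[OF m(1)] by (intro mult_right_mono) auto
  finally show ?thesis by (simp add: subset_prob_def cXK)
qed

lemma subset_prob_le_1: "finite X \<Longrightarrow> subset_prob X m Q \<le> 1"
proof -
  assume X: "finite X"
  have "card {A \<in> subsets_of_size X m. Q A} \<le> card (subsets_of_size X m)"
    using X by (intro card_mono) auto
  then have "card {A \<in> subsets_of_size X m. Q A} \<le> card X choose m"
    using card_subsets_of_size[OF X] by simp
  then show ?thesis unfolding subset_prob_def by (auto simp: divide_le_eq_1 simp del: binomial_eq_0_iff zero_less_binomial_iff)
qed

lemma subset_prob_superset_le:
  assumes X: "finite X" and K: "K \<subseteq> X" and m: "m \<le> card X"
  shows "subset_prob X m (\<lambda>A. K \<subseteq> A) \<le> (real m / real (card X)) ^ card K"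
proof (cases "card K \<le> m")
  case True
  have "subset_prob X m (\<lambda>A. K \<subseteq> A \<and> True)
    \<le> (real m / real (card X)) ^ card K * subset_prob (X - K) (m - card K) (\<lambda>_. True)"
    using subset_prob_superset_conj_le[OF X K m True, of "\<lambda>_. True"] .
  also have "\<dots> \<le> (real m / real (card X)) ^ card K * 1"
    using X by (intro mult_left_mono subset_prob_le_1) auto
  finally show ?thesis by simp
next
  case False
  have "subset_prob X m (\<lambda>A. K \<subseteq> A) = 0"
    unfolding subset_prob_def using subsets_of_size_superset[OF X K, of m "\<lambda>_. True"] False by simp
  then show ?thesis by simp
qed

text \<open>Conditioned on the first \<open>m0\<close> elements, the elements at positions \<open>m0..<m1\<close> are a uniformly
  random subset of the remaining ones.\<close>
lemma ordering_prob_two_times: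
  assumes X: "finite X" and F: "F \<subseteq> X" and m: "m0 \<le> m1" "m1 \<le> card X"
    and Q: "\<And>A. Q A \<Longrightarrow> A \<inter> F = {}"
  shows "ordering_prob X (\<lambda>xs. Q (set (take m0 xs)) \<and> F \<subseteq> set (take m1 xs))
    \<le> (real m1 / real (card X)) ^ card F * subset_prob X m0 Q"
proof -
  let ?N = "card X"
  let ?p = "real m1 / real ?N"
  let ?R = "\<lambda>A zs. Q A \<and> F \<subseteq> set (take (m1 - m0) zs)"
  have m0: "m0 \<le> ?N" using m by simp
  have eq: "{xs \<in> permutations_of_set X. Q (set (take m0 xs)) \<and> F \<subseteq> set (take m1 xs)} =
    {xs \<in> permutations_of_set X. ?R (set (take m0 xs)) (drop m0 xs)}"
  proof -
    have "F \<subseteq> set (take m1 xs) \<longleftrightarrow> F \<subseteq> set (take (m1 - m0) (drop m0 xs))" if "Q (set (take m0 xs))" for xs :: "'a list"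
    proof -
      have "take m1 xs = take m0 xs @ take (m1 - m0) (drop m0 xs)"
        using m(1) by (metis le_add_diff_inverse take_add)
      then show ?thesis using Q[OF that] by auto
    qed
    then show ?thesis by blast
  qed
  \<comment> \<open>A prefix satisfying \<open>Q\<close> misses \<open>F\<close>, so all of
    \<open>F\<close> has to appear in the next \<open>m1 - m0\<close> positions. The density (m1 -
    m0) / (N - m0) there, with N the size of \<open>X\<close>, is at most m1 / N because
    \<open>m1\<close> is at most N.\<close>
  have inner: "real (card {zs \<in> permutations_of_set (X - A). ?R A zs}) \<le>
      (if Q A then ?p ^ card F * fact (?N - m0) else 0)" if A: "A \<in> subsets_of_size X m0" for A
  proof (cases "Q A")
    case True
    have finA: "finite A" using A X by (auto simp: subsets_of_size_def intro: finite_subset)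
    have c: "card (X - A) = ?N - m0" using A finA by (auto simp: subsets_of_size_def card_Diff_subset)
    have le: "m1 - m0 \<le> card (X - A)" using m c by simp
    have "real (card {zs \<in> permutations_of_set (X - A). F \<subseteq> set (take (m1 - m0) zs)}) / fact (card (X - A))
      = subset_prob (X - A) (m1 - m0) (\<lambda>B. F \<subseteq> B)"
      using ordering_prob_prefix[OF _ le, of "\<lambda>B. F \<subseteq> B"] X by (simp add: ordering_prob_def)
    also have "\<dots> \<le> (real (m1 - m0) / real (card (X - A))) ^ card F"
      using X F Q[OF True] le by (intro subset_prob_superset_le) auto
    also have "\<dots> \<le> ?p ^ card F"
    proof (rule power_mono)
      show "real (m1 - m0) / real (card (X - A)) \<le> ?p"
      proof (cases "?N = m0")
        case False
        have "real m0 * real m1 \<le> real m0 * real ?N" using m by (intro mult_left_mono) auto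
        then show ?thesis unfolding c using m m0 False by (simp add: of_nat_diff field_simps)
      qed (use c in simp)
    qed simp
    finally show ?thesis using True c by (simp add: field_simps)
  qed simp
  have "real (card {xs \<in> permutations_of_set X. Q (set (take m0 xs)) \<and> F \<subseteq> set (take m1 xs)}) =
    (\<Sum>A\<in>subsets_of_size X m0. fact m0 * real (card {zs \<in> permutations_of_set (X - A). ?R A zs}))"
    unfolding eq card_permutations_split[OF X m0, of ?R] by simp
  also have "\<dots> \<le> (\<Sum>A\<in>subsets_of_size X m0. fact m0 * (if Q A then ?p ^ card F * fact (?N - m0) else 0))"
    using inner by (intro sum_mono mult_left_mono) auto
  also have "\<dots> = (\<Sum>A\<in>subsets_of_size X m0. if Q A then ?p ^ card F * (fact m0 * fact (?N - m0)) else 0)"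
    by (intro sum.cong) auto
  also have "\<dots> = real (card {A \<in> subsets_of_size X m0. Q A}) * (?p ^ card F * (fact m0 * fact (?N - m0)))"
    using X by (simp add: sum.If_cases Int_def)
  finally have "ordering_prob X (\<lambda>xs. Q (set (take m0 xs)) \<and> F \<subseteq> set (take m1 xs)) \<le>
    real (card {A \<in> subsets_of_size X m0. Q A}) * (?p ^ card F * (fact m0 * fact (?N - m0))) / fact ?N"
    unfolding ordering_prob_def by (rule divide_right_mono) simp
  also have "fact ?N = real (?N choose m0) * (fact m0 * fact (?N - m0))"
    using binomial_fact_lemma[OF m0] by (metis mult.commute of_nat_fact of_nat_mult)
  finally show ?thesis unfolding subset_prob_def by (simp add: mult.commute)
qed

text \<open>The moment generating function of a hypergeometric count is dominated by that of the
  binomial count with the same mean. Expanding x^j in powers of \<open>x - 1\<close> turns the sum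
  into containment counts; \<open>x \<ge> 1\<close> makes the coefficients nonnegative, so those
  counts may be bounded from above.\<close>

lemma sum_subsets_power_le:
  fixes x :: real
  assumes X: "finite X" and D: "D \<subseteq> X" and m: "m \<le> card X" and x: "x \<ge> 1"
  shows "(\<Sum>A\<in>subsets_of_size X m. x ^ card (A \<inter> D))
    \<le> real (card X choose m) * (1 + (x - 1) * (real m / real (card X))) ^ card D"
proof -
  let ?p = "real m / real (card X)"
  have finD: "finite D" using X D finite_subset by blast
  have expand: "(1 + y) ^ card S = (\<Sum>K\<in>Pow S. y ^ card K)" if "finite S" for y :: real and S :: "'a set"
  proof -
    have "(\<Prod>a\<in>S. y + 1) = (\<Sum>K\<in>Pow S. (\<Prod>a\<in>K. y) * (\<Prod>a\<in>S - K. 1))"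
      by (rule prod_add[OF that])
    then show ?thesis by (simp add: add.commute)
  qed
  have "(\<Sum>A\<in>subsets_of_size X m. x ^ card (A \<inter> D))
    = (\<Sum>A\<in>subsets_of_size X m. \<Sum>K\<in>Pow D. if K \<subseteq> A then (x - 1) ^ card K else 0)"
  proof (rule sum.cong[OF refl])
    fix A
    have "x ^ card (A \<inter> D) = (\<Sum>K\<in>Pow (A \<inter> D). (x - 1) ^ card K)"
      using expand[of "A \<inter> D" "x - 1"] finD by simp
    also have "\<dots> = (\<Sum>K\<in>Pow D. if K \<subseteq> A then (x - 1) ^ card K else 0)"
      using finD by (intro sum.mono_neutral_cong_left) auto
    finally show "x ^ card (A \<inter> D) = (\<Sum>K\<in>Pow D. if K \<subseteq> A then (x - 1) ^ card K else 0)" .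
  qed
  also have "\<dots> = (\<Sum>K\<in>Pow D. \<Sum>A\<in>subsets_of_size X m. if K \<subseteq> A then (x - 1) ^ card K else 0)"
    by (rule sum.swap)
  also have "\<dots> = (\<Sum>K\<in>Pow D. (x - 1) ^ card K * real (card {A \<in> subsets_of_size X m. K \<subseteq> A}))"
    using X by (simp add: sum.If_cases Int_def mult.commute)
  also have "\<dots> \<le> (\<Sum>K\<in>Pow D. (x - 1) ^ card K * (real (card X choose m) * ?p ^ card K))"
  proof (rule sum_mono, rule mult_left_mono)
    fix K assume "K \<in> Pow D"
    then have "subset_prob X m (\<lambda>A. K \<subseteq> A) \<le> ?p ^ card K"
      using X D m by (intro subset_prob_superset_le) auto
    then show "real (card {A \<in> subsets_of_size X m. K \<subseteq> A}) \<le> real (card X choose m) * ?p ^ card K"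
      using m by (simp add: subset_prob_def field_simps)
  qed (use x in simp)
  also have "\<dots> = real (card X choose m) * (\<Sum>K\<in>Pow D. ((x - 1) * ?p) ^ card K)"
    unfolding power_mult_distrib sum_distrib_left by (simp only: mult_ac)
  also have "\<dots> = real (card X choose m) * (1 + (x - 1) * ?p) ^ card D"
    using expand[OF finD] by simp
  finally show ?thesis .
qed

lemma power_le_exp:
  fixes y :: real
  assumes "0 \<le> 1 + y"
  shows "(1 + y) ^ d \<le> exp (y * real d)"
proof -
  have "(1 + y) ^ d \<le> exp y ^ d" using assms by (intro power_mono exp_ge_add_one_self)
  then show ?thesis by (simp add: exp_of_nat_mult[symmetric] mult.commute)
qed

lemma subset_prob_upper_tail:
  assumes X: "finite X" and D: "D \<subseteq> X" and m: "m \<le> card X" and s: "s \<ge> 0"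
  shows "subset_prob X m (\<lambda>A. a \<le> real (card (A \<inter> D)))
    \<le> exp ((exp s - 1) * (real m / real (card X)) * real (card D) - s * a)"
proof -
  let ?p = "real m / real (card X)"
  let ?S = "subsets_of_size X m"
  have "real (card {A \<in> ?S. a \<le> real (card (A \<inter> D))}) * exp (s * a)
    = (\<Sum>A\<in>{A \<in> ?S. a \<le> real (card (A \<inter> D))}. exp (s * a))" by simp
  also have "\<dots> \<le> (\<Sum>A\<in>{A \<in> ?S. a \<le> real (card (A \<inter> D))}. exp s ^ card (A \<inter> D))"
    using s by (intro sum_mono) (auto simp: exp_of_nat_mult[symmetric] mult.commute[of _ s] intro!: mult_left_mono)
  also have "\<dots> \<le> (\<Sum>A\<in>?S. exp s ^ card (A \<inter> D))"
    using X by (intro sum_mono2) auto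
  also have "\<dots> \<le> real (card X choose m) * (1 + (exp s - 1) * ?p) ^ card D"
    using X D m s by (intro sum_subsets_power_le) auto
  also have "\<dots> \<le> real (card X choose m) * exp ((exp s - 1) * ?p * real (card D))"
    using s by (intro mult_left_mono power_le_exp) auto
  finally show ?thesis
    using m unfolding subset_prob_def exp_diff by (simp add: field_simps)
qed

text \<open>A direct Chernoff argument would need the moment generating function below 1, where the
  expansion has negative coefficients. Passing to the complement of \<open>A\<close> turns few
  elements of \<open>D\<close> into many, and \<open>sum_subsets_power_le\<close> applies. With q =
  1 - p, the identity exp (-s) (1 + (exp s - 1) q) = 1 - (1 - exp (-s)) p restores the usual
  form.\<close>

lemma subset_prob_lower_tail:
  assumes X: "finite X" and D: "D \<subseteq> X" and m: "m \<le> card X" and s: "s \<ge> 0"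
  shows "subset_prob X m (\<lambda>A. real (card (A \<inter> D)) \<le> a)
    \<le> exp (s * a - (1 - exp (- s)) * (real m / real (card X)) * real (card D))"
proof -
  let ?N = "card X"
  let ?p = "real m / real ?N"
  let ?q = "real (?N - m) / real ?N"
  let ?S = "subsets_of_size X m"
  let ?d = "card D"
  have finD: "finite D" using X D finite_subset by blast
  have "real (card {A \<in> ?S. real (card (A \<inter> D)) \<le> a}) * exp (- (s * a))
    = (\<Sum>A\<in>{A \<in> ?S. real (card (A \<inter> D)) \<le> a}. exp (- (s * a)))" by simp
  also have "\<dots> \<le> (\<Sum>A\<in>{A \<in> ?S. real (card (A \<inter> D)) \<le> a}. exp (- s * real (card (A \<inter> D))))"
    using s by (intro sum_mono) (auto intro!: mult_left_mono)
  also have "\<dots> \<le> (\<Sum>A\<in>?S. exp (- s * real (card (A \<inter> D))))"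
    using X by (intro sum_mono2) auto
  also have "\<dots> = (\<Sum>B\<in>subsets_of_size X (?N - m). exp (- s * real (card ((X - B) \<inter> D))))"
  proof (rule sum.reindex_bij_betw[symmetric])
    show "bij_betw (\<lambda>B. X - B) (subsets_of_size X (?N - m)) ?S"
      using X m by (intro bij_betw_byWitness[where f' = "\<lambda>A. X - A"])
        (auto simp: subsets_of_size_def card_Diff_subset finite_subset)
  qed
  also have "\<dots> = (\<Sum>B\<in>subsets_of_size X (?N - m). exp (- s * real ?d) * exp s ^ card (B \<inter> D))"
  proof (rule sum.cong[OF refl])
    fix B assume "B \<in> subsets_of_size X (?N - m)"
    have "(X - B) \<inter> D = D - (B \<inter> D)" using D by auto
    then have "card ((X - B) \<inter> D) + card (B \<inter> D) = ?d"
      using finD card_Diff_subset[of "B \<inter> D" D] card_mono[of D "B \<inter> D"] by simp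
    then have c: "real (card ((X - B) \<inter> D)) = real ?d - real (card (B \<inter> D))" by linarith
    show "exp (- s * real (card ((X - B) \<inter> D))) = exp (- s * real ?d) * exp s ^ card (B \<inter> D)"
      unfolding c by (simp add: exp_of_nat_mult[symmetric] exp_add[symmetric] algebra_simps)
  qed
  also have "\<dots> = exp (- s * real ?d) * (\<Sum>B\<in>subsets_of_size X (?N - m). exp s ^ card (B \<inter> D))"
    by (rule sum_distrib_left[symmetric])
  also have "\<dots> \<le> exp (- s * real ?d) * (real (?N choose (?N - m)) * (1 + (exp s - 1) * ?q) ^ ?d)"
    using X D m s by (intro mult_left_mono sum_subsets_power_le) auto
  also have "\<dots> = real (?N choose m) * (exp (- s) * (1 + (exp s - 1) * ?q)) ^ ?d"
    using binomial_symmetric[OF m]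
    by (simp add: power_mult_distrib exp_of_nat_mult[symmetric] mult_ac)
  also have "(exp (- s) * (1 + (exp s - 1) * ?q)) ^ ?d \<le> exp (- ((1 - exp (- s)) * ?p) * real ?d)"
  proof (cases "?d = 0")
    case False
    then have N: "?N > 0" using X D by (metis card_0_eq card_gt_0_iff finD subset_empty)
    then have q: "?q = 1 - ?p" using m by (simp add: of_nat_diff diff_divide_distrib)
    have es: "exp (- s) * exp s = 1" by (simp add: exp_minus)
    have "a * (1 + (b - 1) * q) = a + (a * b - a) * q" for a b q :: real
      by (simp add: algebra_simps)
    then have "exp (- s) * (1 + (exp s - 1) * ?q) = exp (- s) + (exp (- s) * exp s - exp (- s)) * ?q" .
    also have "\<dots> = 1 + - ((1 - exp (- s)) * ?p)" unfolding es q by (simp add: algebra_simps)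
    finally have "exp (- s) * (1 + (exp s - 1) * ?q) = 1 + - ((1 - exp (- s)) * ?p)" .
    moreover have "0 \<le> exp (- s) * (1 + (exp s - 1) * ?q)" using s by simp
    ultimately show ?thesis using power_le_exp by metis
  qed simp
  finally show ?thesis
    using m unfolding subset_prob_def exp_diff
    by (simp add: exp_minus field_simps mult_left_mono)
qed

text \<open>Since \<open>K\<close> and \<open>D\<close> are disjoint, conditioning on
  \<open>K \<subseteq> A\<close> only takes \<open>card K\<close> draws away from \<open>D\<close>.
  The density on \<open>X - K\<close> is weakened to denominator \<open>card X\<close>, so that the
  exponent depends on \<open>K\<close> through its size alone.\<close>

lemma subset_prob_superset_lower_tail:
  assumes X: "finite X" and D: "D \<subseteq> X" and K: "K \<subseteq> X" "K \<inter> D = {}" and m: "m \<le> card X" and s: "s \<ge> 0"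
  shows "subset_prob X m (\<lambda>A. K \<subseteq> A \<and> real (card (A \<inter> D)) \<le> a)
    \<le> (real m / real (card X)) ^ card K *
      exp (s * a - (1 - exp (- s)) * ((real m - real (card K)) / real (card X)) * real (card D))"
proof (cases "card K \<le> m")
  case True
  have finK: "finite K" using X K finite_subset by blast
  have cXK: "card (X - K) = card X - card K" using finK K(1) by (rule card_Diff_subset)
  have "(A - K) \<inter> D = A \<inter> D" for A using K(2) by blast
  then have "subset_prob X m (\<lambda>A. K \<subseteq> A \<and> real (card (A \<inter> D)) \<le> a)
    \<le> (real m / real (card X)) ^ card K * subset_prob (X - K) (m - card K) (\<lambda>B. real (card (B \<inter> D)) \<le> a)"
    using subset_prob_superset_conj_le[OF X K(1) m True, of "\<lambda>B. real (card (B \<inter> D)) \<le> a"] by simp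
  also have "\<dots> \<le> (real m / real (card X)) ^ card K *
    exp (s * a - (1 - exp (- s)) * (real (m - card K) / real (card (X - K))) * real (card D))"
    using X D K m s by (intro mult_left_mono subset_prob_lower_tail) (auto simp: cXK)
  also have "\<dots> \<le> (real m / real (card X)) ^ card K *
    exp (s * a - (1 - exp (- s)) * ((real m - real (card K)) / real (card X)) * real (card D))"
  proof -
    have "(real m - real (card K)) / real (card X) \<le> real (m - card K) / real (card (X - K))"
    proof (cases "card X = card K")
      case False
      then show ?thesis unfolding cXK using True m
        by (intro frac_le) (auto simp: of_nat_diff)
    qed (use True m in \<open>simp add: cXK\<close>)
    then have "(1 - exp (- s)) * ((real m - real (card K)) / real (card X)) * real (card D)
      \<le> (1 - exp (- s)) * (real (m - card K) / real (card (X - K))) * real (card D)"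
      using s by (intro mult_right_mono mult_left_mono) auto
    then show ?thesis by (intro mult_left_mono) auto
  qed
  finally show ?thesis .
next
  case False
  have "subset_prob X m (\<lambda>A. K \<subseteq> A \<and> real (card (A \<inter> D)) \<le> a) \<le> subset_prob X m (\<lambda>A. K \<subseteq> A)"
    using X by (intro subset_prob_mono) auto
  also have "\<dots> = 0"
    unfolding subset_prob_def using subsets_of_size_superset[OF X K(1), of m "\<lambda>_. True"] False by simp
  finally show ?thesis by (simp add: order_trans)
qed

section \<open>The second moment method\<close>

lemma card_subsets_of_size_split:
  assumes X: "finite X" and S: "S \<subseteq> X" and k: "k \<le> m"
  shows "card {A \<in> subsets_of_size X m. card (A \<inter> S) = k \<and> Q (A - S)} =
    (card S choose k) * card {B \<in> subsets_of_size (X - S) (m - k). Q B}"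
proof -
  have finS: "finite S" using X S finite_subset by blast
  have "bij_betw (\<lambda>A. (A \<inter> S, A - S)) {A \<in> subsets_of_size X m. card (A \<inter> S) = k \<and> Q (A - S)}
    (subsets_of_size S k \<times> {B \<in> subsets_of_size (X - S) (m - k). Q B})"
  proof (rule bij_betw_byWitness[where f' = "\<lambda>(C, B). C \<union> B"])
    show "\<forall>A\<in>{A \<in> subsets_of_size X m. card (A \<inter> S) = k \<and> Q (A - S)}.
      (case (A \<inter> S, A - S) of (C, B) \<Rightarrow> C \<union> B) = A" by auto
    have CB: "(C \<union> B) \<inter> S = C" "(C \<union> B) - S = B" if "C \<subseteq> S" "B \<subseteq> X - S" for C B
      using that by auto
    then show "\<forall>p\<in>subsets_of_size S k \<times> {B \<in> subsets_of_size (X - S) (m - k). Q B}.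
      (\<lambda>A. (A \<inter> S, A - S)) (case p of (C, B) \<Rightarrow> C \<union> B) = p"
      by (auto simp: subsets_of_size_def)
    show "(\<lambda>A. (A \<inter> S, A - S)) ` {A \<in> subsets_of_size X m. card (A \<inter> S) = k \<and> Q (A - S)}
      \<subseteq> subsets_of_size S k \<times> {B \<in> subsets_of_size (X - S) (m - k). Q B}"
    proof (rule image_subsetI)
      fix A assume "A \<in> {A \<in> subsets_of_size X m. card (A \<inter> S) = k \<and> Q (A - S)}"
      then have A: "A \<in> subsets_of_size X m" "k = card (A \<inter> S)" "Q (A - S)" by auto
      have "finite A" using A X by (auto simp: subsets_of_size_def intro: finite_subset)
      then have "card (A - S) = card A - card (A \<inter> S)" by (simp add: card_Diff_subset_Int)
      then show "(A \<inter> S, A - S) \<in> subsets_of_size S k \<times>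
        {B \<in> subsets_of_size (X - S) (m - k). Q B}"
        using A by (auto simp: subsets_of_size_def)
    qed
    show "(\<lambda>(C, B). C \<union> B) ` (subsets_of_size S k \<times> {B \<in> subsets_of_size (X - S) (m - k). Q B})
      \<subseteq> {A \<in> subsets_of_size X m. card (A \<inter> S) = k \<and> Q (A - S)}"
    proof (rule image_subsetI)
      fix p assume "p \<in> subsets_of_size S k \<times> {B \<in> subsets_of_size (X - S) (m - k). Q B}"
      then obtain C B where p: "p = (C, B)" and
        CB': "C \<in> subsets_of_size S k" "B \<in> subsets_of_size (X - S) (m - k)" "Q B" by auto
      then have sub: "C \<subseteq> S" "B \<subseteq> X - S" and c: "card C = k" "card B = m - k"
        by (auto simp: subsets_of_size_def)
      have "finite C" "finite B" using sub finS X finite_subset by (blast intro: finite_subset)+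
      then have "card (C \<union> B) = m" using sub c k by (subst card_Un_disjoint) auto
      then show "(case p of (C, B) \<Rightarrow> C \<union> B) \<in> {A \<in> subsets_of_size X m. card (A \<inter> S) = k \<and> Q (A - S)}"
        unfolding p using CB[OF sub] c CB'(3) sub S by (auto simp: subsets_of_size_def)
    qed
  qed
  then show ?thesis
    using finS by (simp add: bij_betw_same_card card_cartesian_product card_subsets_of_size)
qed

lemma card_subsets_of_size_Int:
  assumes X: "finite X" and S: "S \<subseteq> X" and k: "k \<le> m"
  shows "card {A \<in> subsets_of_size X m. card (A \<inter> S) = k} = (card S choose k) * ((card X - card S) choose (m - k))"
proof -
  have "finite S" using X S finite_subset by blast
  then have "card (subsets_of_size (X - S) (m - k)) = (card X - card S) choose (m - k)"
    using X S by (simp add: card_subsets_of_size card_Diff_subset)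
  then show ?thesis using card_subsets_of_size_split[OF X S k, of "\<lambda>_. True"] by simp
qed

lemma card_subsets_of_size_Int_Int:
  assumes X: "finite X" and S: "S \<subseteq> X" and T: "T \<subseteq> X" and ST: "S \<inter> T = {}" and k: "2 * k \<le> m"
    and c: "card S = f" "card T = f"
  shows "card {A \<in> subsets_of_size X m. card (A \<inter> S) = k \<and> card (A \<inter> T) = k} =
    (f choose k) * ((f choose k) * ((card X - 2 * f) choose (m - 2 * k)))"
proof -
  have "finite S" using X S finite_subset by blast
  then have cXS: "card (X - S) = card X - f" using c S by (simp add: card_Diff_subset)
  have "(A - S) \<inter> T = A \<inter> T" for A using ST by auto
  then have "card {A \<in> subsets_of_size X m. card (A \<inter> S) = k \<and> card (A \<inter> T) = k} =
    (f choose k) * card {B \<in> subsets_of_size (X - S) (m - k). card (B \<inter> T) = k}"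
    using card_subsets_of_size_split[OF X S, of k m "\<lambda>B. card (B \<inter> T) = k"] k c by simp
  also have "card {B \<in> subsets_of_size (X - S) (m - k). card (B \<inter> T) = k} =
    (f choose k) * ((card X - f - f) choose (m - k - k))"
  proof -
    have "T \<subseteq> X - S" "k \<le> m - k" using T ST k by auto
    then show ?thesis using card_subsets_of_size_Int[of "X - S" T k "m - k"] X c cXS by simp
  qed
  finally show ?thesis by (simp add: mult_2)
qed

text \<open>Case distinction on the common element \<open>e\<close>; here \<open>f\<close> counts
  the other elements of each set. If \<open>e\<close> is chosen it serves both sets at once, so the
  two sets together use only 2 k - 1 elements of \<open>A\<close>, which explains
  \<open>m - 2 * k + 1\<close>.\<close>

lemma card_subsets_of_size_pair:
  assumes X: "finite X" and S: "S \<subseteq> X" and T: "T \<subseteq> X" and ST: "S \<inter> T = {e}"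
    and k: "2 * k \<le> m" "0 < m" and c: "card S = Suc f" "card T = Suc f"
  shows "card {A \<in> subsets_of_size X m. card (A \<inter> S) = k \<and> card (A \<inter> T) = k} =
    (f choose k) * ((f choose k) * ((card X - 1 - 2 * f) choose (m - 2 * k))) +
    (if k = 0 then 0 else
      (f choose (k - 1)) * ((f choose (k - 1)) * ((card X - 1 - 2 * f) choose (m - 2 * k + 1))))"
proof -
  let ?X = "X - {e}" let ?S = "S - {e}" let ?T = "T - {e}"
  let ?L = "{A \<in> subsets_of_size X m. card (A \<inter> S) = k \<and> card (A \<inter> T) = k}"
  have fin: "finite S" "finite T" using X S T finite_subset by blast+
  have e: "e \<in> S" "e \<in> T" "e \<in> X" using ST S by auto
  have c': "card ?S = f" "card ?T = f" "card ?X = card X - 1" using c e X fin by auto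
  have dis: "?S \<inter> ?T = {}" using ST by auto
  have sub: "?S \<subseteq> ?X" "?T \<subseteq> ?X" using S T by blast+
  have out: "{A \<in> ?L. e \<notin> A} =
    {A \<in> subsets_of_size ?X m. card (A \<inter> ?S) = k \<and> card (A \<inter> ?T) = k}"
  proof (rule set_eqI)
    fix A
    show "A \<in> {A \<in> ?L. e \<notin> A} \<longleftrightarrow>
      A \<in> {A \<in> subsets_of_size ?X m. card (A \<inter> ?S) = k \<and> card (A \<inter> ?T) = k}"
    proof (cases "e \<in> A")
      case True
      then show ?thesis by (auto simp: subsets_of_size_def)
    next
      case False
      then have "A \<inter> ?S = A \<inter> S" "A \<inter> ?T = A \<inter> T" "A \<subseteq> ?X \<longleftrightarrow> A \<subseteq> X" by auto
      then show ?thesis using False by (simp add: subsets_of_size_def)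
    qed
  qed
  have cout: "card {A \<in> ?L. e \<notin> A} = (f choose k) * ((f choose k) * ((card X - 1 - 2 * f) choose (m - 2 * k)))"
    unfolding out c'(3)[symmetric] using X k
    by (intro card_subsets_of_size_Int_Int[OF _ sub dis _ c'(1,2)]) simp_all
  have cin: "card {A \<in> ?L. e \<in> A} = (if k = 0 then 0 else
      (f choose (k - 1)) * ((f choose (k - 1)) * ((card X - 1 - 2 * f) choose (m - 2 * k + 1))))"
  proof (cases "k = 0")
    case True
    have "{A \<in> ?L. e \<in> A} = {}"
    proof (rule equals0I)
      fix A assume "A \<in> {A \<in> ?L. e \<in> A}"
      then have "card (A \<inter> S) = 0" "e \<in> A \<inter> S" using True e by auto
      then show False using fin by (metis card_0_eq empty_iff finite_Int)
    qed
    then have "card {A \<in> ?L. e \<in> A} = 0" by (simp only: card.empty)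
    then show ?thesis by (simp only: if_P[OF True])
  next
    case False
    have ci: "card ((A - {e}) \<inter> (Z - {e})) = k - 1 \<longleftrightarrow> card (A \<inter> Z) = k"
      if "e \<in> A" "e \<in> Z" "finite Z" for A Z
    proof -
      have "(A - {e}) \<inter> (Z - {e}) = A \<inter> Z - {e}" by auto
      then have "card ((A - {e}) \<inter> (Z - {e})) = card (A \<inter> Z) - 1" using that by simp
      moreover have "card (A \<inter> Z) > 0" using that by (auto simp: card_gt_0_iff)
      ultimately show ?thesis using False by auto
    qed
    have "{A \<in> ?L. e \<in> A} = {A \<in> subsets_of_size X m. {e} \<subseteq> A \<and>
      (card ((A - {e}) \<inter> ?S) = k - 1 \<and> card ((A - {e}) \<inter> ?T) = k - 1)}"
      using ci e fin by auto
    then have "card {A \<in> ?L. e \<in> A} =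
      card {B \<in> subsets_of_size ?X (m - 1). card (B \<inter> ?S) = k - 1 \<and> card (B \<inter> ?T) = k - 1}"
      using subsets_of_size_superset[OF X, of "{e}" m "\<lambda>B. card (B \<inter> ?S) = k - 1 \<and> card (B \<inter> ?T) = k - 1"]
        e k by simp
    also have "\<dots> = (f choose (k - 1)) * ((f choose (k - 1)) * ((card ?X - 2 * f) choose (m - 1 - 2 * (k - 1))))"
      using k by (intro card_subsets_of_size_Int_Int[OF _ sub dis _ c'(1,2)]) (use X in simp_all)
    also have "m - 1 - 2 * (k - 1) = m - 2 * k + 1" using k False by auto
    finally show ?thesis using c' False by simp
  qed
  have "?L = {A \<in> ?L. e \<notin> A} \<union> {A \<in> ?L. e \<in> A}" by blast
  then have "card ?L = card {A \<in> ?L. e \<notin> A} + card {A \<in> ?L. e \<in> A}"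
    using X by (subst card_Un_disjoint[symmetric]) (auto intro: arg_cong[of _ _ card])
  then show ?thesis unfolding cout cin .
qed

text \<open>Chebyshev's inequality in counting form: where no event occurs, the number
  \<open>Z\<close> of events deviates from its mean by the whole mean. The first summand is the
  reciprocal of the mean, the second the ratio of pair probabilities to squared single ones; the
  bound is useful when the mean is large and that ratio is close to 1.\<close>

lemma second_moment:
  fixes c1 c2 :: real
  assumes fin: "finite \<Omega>" "finite I" and ne: "I \<noteq> {}" "c1 > 0"
    and c1: "\<And>v. v \<in> I \<Longrightarrow> real (card {A \<in> \<Omega>. E v A}) = c1"
    and c2: "\<And>u v. u \<in> I \<Longrightarrow> v \<in> I \<Longrightarrow> u \<noteq> v \<Longrightarrow> real (card {A \<in> \<Omega>. E u A \<and> E v A}) \<le> c2"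
    and c2_nonneg: "0 \<le> c2"
  shows "real (card {A \<in> \<Omega>. \<forall>v\<in>I. \<not> E v A}) / real (card \<Omega>)
    \<le> real (card \<Omega>) / (real (card I) * c1) + c2 * real (card \<Omega>) / c1\<^sup>2 - 1"
proof -
  define M where "M = real (card \<Omega>)"
  define n where "n = real (card I)"
  define Z where "Z A = (\<Sum>v\<in>I. of_bool (E v A) :: real)" for A
  define \<mu> where "\<mu> = n * c1 / M"
  have n: "n > 0" using fin ne by (simp add: n_def card_gt_0_iff)
  obtain v where v: "v \<in> I" using ne by auto
  then have "{A \<in> \<Omega>. E v A} \<noteq> {}" using c1[OF v] ne(2) by (metis card.empty less_irrefl of_nat_0)
  then have M: "M > 0" using fin by (auto simp: M_def card_gt_0_iff)
  have EZ: "(\<Sum>A\<in>\<Omega>. Z A) = n * c1"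
  proof -
    have "(\<Sum>A\<in>\<Omega>. Z A) = (\<Sum>v\<in>I. \<Sum>A\<in>\<Omega>. of_bool (E v A))" unfolding Z_def by (rule sum.swap)
    also have "\<dots> = (\<Sum>v\<in>I. c1)" using fin c1 by (intro sum.cong) (auto simp: Int_def)
    finally show ?thesis by (simp add: n_def)
  qed
  have EZ2: "(\<Sum>A\<in>\<Omega>. (Z A)\<^sup>2) \<le> n * c1 + n\<^sup>2 * c2"
  proof -
    have "(\<Sum>A\<in>\<Omega>. (Z A)\<^sup>2) = (\<Sum>A\<in>\<Omega>. \<Sum>u\<in>I. \<Sum>v\<in>I. of_bool (E u A \<and> E v A))"
      unfolding Z_def power2_eq_square sum_product by (intro sum.cong) auto
    also have "\<dots> = (\<Sum>u\<in>I. \<Sum>A\<in>\<Omega>. \<Sum>v\<in>I. of_bool (E u A \<and> E v A))" by (rule sum.swap)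
    also have "\<dots> = (\<Sum>u\<in>I. \<Sum>v\<in>I. \<Sum>A\<in>\<Omega>. of_bool (E u A \<and> E v A))"
      by (intro sum.cong refl) (rule sum.swap)
    also have "\<dots> = (\<Sum>u\<in>I. \<Sum>v\<in>I. real (card {A \<in> \<Omega>. E u A \<and> E v A}))"
      using fin by (intro sum.cong refl) (simp add: Int_def)
    also have "\<dots> \<le> (\<Sum>u\<in>I. \<Sum>v\<in>I. (if u = v then c1 else 0) + c2)"
    proof (intro sum_mono)
      fix u v assume "u \<in> I" "v \<in> I"
      then show "real (card {A \<in> \<Omega>. E u A \<and> E v A}) \<le> (if u = v then c1 else 0) + c2"
        using c1[of v] c2[of u v] c2_nonneg by auto
    qed
    also have "\<dots> = n * c1 + n\<^sup>2 * c2"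
      using fin by (simp add: sum.distrib n_def power2_eq_square algebra_simps)
    finally show ?thesis .
  qed
  define M0 where "M0 = real (card {A \<in> \<Omega>. \<forall>v\<in>I. \<not> E v A})"
  have "M0 * \<mu>\<^sup>2 = (\<Sum>A\<in>{A \<in> \<Omega>. \<forall>v\<in>I. \<not> E v A}. (Z A - \<mu>)\<^sup>2)"
    by (simp add: M0_def Z_def)
  also have "\<dots> \<le> (\<Sum>A\<in>\<Omega>. (Z A - \<mu>)\<^sup>2)" using fin by (intro sum_mono2) auto
  also have "\<dots> = (\<Sum>A\<in>\<Omega>. (Z A)\<^sup>2) - 2 * \<mu> * (\<Sum>A\<in>\<Omega>. Z A) + M * \<mu>\<^sup>2"
  proof -
    have "(Z A - \<mu>)\<^sup>2 = (Z A)\<^sup>2 - 2 * \<mu> * Z A + \<mu>\<^sup>2" for A by (simp add: power2_diff)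
    then show ?thesis by (simp only: sum.distrib sum_subtractf sum_distrib_left[symmetric]) (simp add: M_def)
  qed
  also have "\<dots> \<le> n * c1 + n\<^sup>2 * c2 - M * \<mu>\<^sup>2"
  proof -
    have "\<mu> * (n * c1) = M * \<mu>\<^sup>2" using M by (simp add: \<mu>_def power2_eq_square)
    then show ?thesis using EZ2 unfolding EZ by linarith
  qed
  finally have "M0 * \<mu>\<^sup>2 \<le> n * c1 + n\<^sup>2 * c2 - M * \<mu>\<^sup>2" .
  then have "M0 * \<mu>\<^sup>2 / (M * \<mu>\<^sup>2) \<le> (n * c1 + n\<^sup>2 * c2 - M * \<mu>\<^sup>2) / (M * \<mu>\<^sup>2)"
    using M by (intro divide_right_mono) auto
  moreover have "\<mu> > 0" using M n ne by (simp add: \<mu>_def)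
  moreover have "(n * c1 + n\<^sup>2 * c2) / (M * \<mu>\<^sup>2) = M / (n * c1) + c2 * M / c1\<^sup>2"
    using M n ne by (simp add: \<mu>_def field_simps power2_eq_square)
  ultimately show ?thesis using M by (simp add: M0_def M_def n_def diff_divide_distrib)
qed

section \<open>Correlation between the degrees of two vertices\<close>

lemma prod_ratio_ge:
  assumes "k \<le> s" "s \<le> N"
  shows "((real s - real k) / real N) ^ k \<le> (\<Prod>i<k. real (s - i) / real (N - i))"
proof -
  have "(\<Prod>i<k. (real s - real k) / real N) \<le> (\<Prod>i<k. real (s - i) / real (N - i))"
  proof (rule prod_mono, safe)
    fix i assume "i < k"
    then show "(real s - real k) / real N \<le> real (s - i) / real (N - i)"
      using assms by (intro frac_le) auto
  qed (use assms in auto)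
  then show ?thesis by simp
qed

text \<open>Two sets of \<open>f\<close> edges with one common edge in a ground set of size \<open>N\<close>, and random \<open>m\<close>-subsets that
  meet each of them in \<open>k\<close> edges. The factors below compare binomial coefficients when the two sets
  are removed one after the other: first the \<open>k\<close> chosen edges, then the edges not chosen. Since \<open>k\<close>
  is below the mean, the second removal is no more likely than the first up to the factor \<open>slack\<close>.\<close>
locale two_stars =
  fixes N f k m :: nat
  assumes k_less: "k < f" and f_small: "2 * f < N" and m_small: "m + 2 * f < N"
    and mean: "k * (N + f) \<le> f * m" and km: "2 * k \<le> m" "0 < m"
begin

definition In1 where "In1 = (\<Prod>i<k. real (m - i) / real (N - i))"
definition Out1 where "Out1 = (\<Prod>i<f - k. real (N - m - i) / real (N - k - i))"
definition In2 where "In2 = (\<Prod>i<k. real (m - k - i) / real (N - f - i))"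
text \<open>There is one factor fewer than in \<open>Out1\<close>, since the common edge has already
  gone with the first set.\<close>

definition Out2 where "Out2 = (\<Prod>i<f - k - 1. real (N - f - (m - k) - i) / real (N - f - k - i))"

lemma one_star: "real ((N - f) choose (m - k)) = real (N choose m) * In1 * Out1"
proof -
  have "real ((N - k) choose (m - k)) = real (N choose m) * In1"
    unfolding In1_def using km m_small by (intro binomial_diff_diff) auto
  moreover have e: "N - k - (f - k) = N - f" "N - k - (m - k) = N - m" using k_less km by auto
  have "real ((N - f) choose (m - k)) = real ((N - k) choose (m - k)) * Out1"
    using binomial_diff[of "f - k" "m - k" "N - k"] km m_small k_less unfolding e Out1_def by simp
  ultimately show ?thesis by simp
qed

lemma both_stars:
  "real ((N - 2 * f + 1) choose (m - 2 * k)) = real ((N - f) choose (m - k)) * In2 * Out2"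
proof -
  have "real ((N - f - k) choose (m - k - k)) = real ((N - f) choose (m - k)) * In2"
    unfolding In2_def using km m_small by (intro binomial_diff_diff) auto
  moreover have e: "N - f - k - (f - k - 1) = N - 2 * f + 1" "N - f - k - (m - k - k) = N - f - (m - k)"
    using k_less km f_small by auto
  have "real ((N - 2 * f + 1) choose (m - k - k)) = real ((N - f - k) choose (m - k - k)) * Out2"
    using binomial_diff[of "f - k - 1" "m - k - k" "N - f - k"] km m_small k_less
    unfolding e Out2_def by simp
  moreover have "m - k - k = m - 2 * k" by simp
  ultimately show ?thesis by (simp only:)
qed

lemma In1_pos: "In1 > 0"
  unfolding In1_def using km m_small by (intro prod_pos) auto

lemma Out1_pos: "Out1 > 0"
  unfolding Out1_def using km m_small k_less by (intro prod_pos) auto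

text \<open>Compared factor by factor: removing the first set shrinks the denominator
  \<open>N - i\<close> to \<open>N - f - i\<close>. The quotient of the two is at most N / (N - 2 f)
  because i is at most N / 2.\<close>

lemma In2_le: "In2 \<le> (real N / (real N - 2 * real f)) ^ k * In1"
proof -
  have "In2 \<le> (\<Prod>i<k. (real N / (real N - 2 * real f)) * (real (m - i) / real (N - i)))"
    unfolding In2_def
  proof (rule prod_mono, safe)
    fix i assume i: "i < k"
    have "real (m - k - i) / real (N - f - i) \<le> real (m - i) / (real N - real f - real i)"
      using i k_less f_small by (intro frac_le) (auto simp: of_nat_diff)
    also have "\<dots> \<le> (real N / (real N - 2 * real f)) * (real (m - i) / real (N - i))"
    proof -
      have a: "real N - 2 * real f > 0" "real N - real f - real i > 0" "real (N - i) = real N - real i" "real N - real i > 0"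
        using i k_less f_small by (auto simp: of_nat_diff)
      have "(real N - 2 * real f) * (real N - real i) \<le> real N * (real N - real f - real i)"
      proof -
        have "real i * real f \<le> real N * real f / 2 \<and> 0 \<le> real N * real f"
          using i k_less f_small mult_right_mono[of "real i" "real N / 2" "real f"] by auto
        then show ?thesis by (simp add: algebra_simps)
      qed
      then have "1 \<le> real N / ((real N - 2 * real f) * (real N - real i)) * (real N - real f - real i)"
        using a by (subst times_divide_eq_left, subst le_divide_eq_1_pos) simp_all
      then have "1 / (real N - real f - real i) \<le> real N / ((real N - 2 * real f) * (real N - real i))"
        using a by (subst pos_divide_le_eq) simp_all
      then have "1 / (real N - real f - real i) \<le> (real N / (real N - 2 * real f)) * (1 / real (N - i))"
        using a by simp
      then have "real (m - i) * (1 / (real N - real f - real i)) \<le>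
        real (m - i) * ((real N / (real N - 2 * real f)) * (1 / real (N - i)))"
        by (rule mult_left_mono) simp
      then show ?thesis by (simp add: mult_ac)
    qed
    finally show "real (m - k - i) / real (N - f - i) \<le> (real N / (real N - 2 * real f)) * (real (m - i) / real (N - i))" .
  qed auto
  also have "\<dots> = (real N / (real N - 2 * real f)) ^ k * In1"
    unfolding In1_def prod.distrib by simp
  finally show ?thesis .
qed

text \<open>For corresponding factors, cross multiplication leaves the difference f m - k (N + f) +
  k^2 + k i, which is nonnegative by \<open>mean\<close>. The surplus last factor of
  \<open>Out1\<close> is at least (N - m - f) / N, which accounts for the additional
  quotient.\<close>

lemma Out2_le: "Out2 \<le> Out1 * (real N / (real N - real m - real f))"
proof -
  define g where "g = f - k - 1"
  have g: "f - k = Suc g" using k_less by (simp add: g_def)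
  have "Out2 \<le> (\<Prod>i<g. real (N - m - i) / real (N - k - i))"
    unfolding Out2_def g_def[symmetric]
  proof (rule prod_mono, safe)
    fix i assume i: "i < g"
    have nn: "real (N - f - (m - k) - i) = real N - real f - real m + real k - real i"
      "real (N - f - k - i) = real N - real f - real k - real i"
      "real (N - m - i) = real N - real m - real i"
      "real (N - k - i) = real N - real k - real i"
      using i g m_small f_small km by (auto simp: of_nat_diff)
    have pos: "real N - real f - real k - real i > 0" "real N - real k - real i > 0"
      using i g m_small f_small km by (auto simp flip: nn)
    have "real k * (real N + real f) \<le> real f * real m"
      using mean by (metis of_nat_add of_nat_le_iff of_nat_mult)
    moreover have "0 \<le> real k * real k + real k * real i" by simp
    ultimately have "(real N - real f - real m + real k - real i) * (real N - real k - real i)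
      \<le> (real N - real m - real i) * (real N - real f - real k - real i)"
      by (simp add: algebra_simps add_increasing2)
    then show "real (N - f - (m - k) - i) / real (N - f - k - i) \<le> real (N - m - i) / real (N - k - i)"
      unfolding nn using pos by (simp add: divide_le_eq pos_le_divide_eq)
  qed auto
  also have "\<dots> \<le> (\<Prod>i<g. real (N - m - i) / real (N - k - i)) *
    ((real (N - m - g) / real (N - k - g)) * (real N / (real N - real m - real f)))"
  proof -
    have nn: "real (N - m - g) = real N - real m - real g" "real (N - k - g) = real N - real k - real g"
      using g m_small km by (auto simp: of_nat_diff)
    have pos: "real N - real m - real f > 0" "real N - real k - real g > 0" "real g \<le> real f"
      using g m_small km by (auto simp flip: nn)
    have "1 \<le> (real (N - m - g) / real (N - k - g)) * (real N / (real N - real m - real f))"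
    proof -
      have "(real N - real k - real g) * (real N - real m - real f) \<le> real N * (real N - real m - real g)"
        using pos by (intro mult_mono) auto
      then have "1 \<le> (real N * (real N - real m - real g)) / ((real N - real k - real g) * (real N - real m - real f))"
        using pos by (subst le_divide_eq_1_pos) simp_all
      then show ?thesis unfolding nn by (simp add: mult.commute)
    qed
    then have "(\<Prod>i<g. real (N - m - i) / real (N - k - i)) * 1 \<le> (\<Prod>i<g. real (N - m - i) / real (N - k - i)) *
      ((real (N - m - g) / real (N - k - g)) * (real N / (real N - real m - real f)))"
      by (rule mult_left_mono) (simp add: prod_nonneg)
    then show ?thesis by (simp only: mult_1_right)
  qed
  also have "\<dots> = Out1 * (real N / (real N - real m - real f))"
    unfolding Out1_def g by simp
  finally show ?thesis .
qed

definition slack where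
  "slack = (real N / (real N - 2 * real f)) ^ k * (real N / (real N - real m - real f))"

lemma both_stars_le:
  "real ((N - 2 * f + 1) choose (m - 2 * k)) * real (N choose m)
    \<le> slack * (real ((N - f) choose (m - k)))\<^sup>2"
proof -
  have "In2 * Out2 \<le> ((real N / (real N - 2 * real f)) ^ k * In1) * (Out1 * (real N / (real N - real m - real f)))"
  proof (rule mult_mono[OF In2_le Out2_le])
    show "0 \<le> (real N / (real N - 2 * real f)) ^ k * In1" using In1_pos f_small by simp
    show "0 \<le> Out2" unfolding Out2_def by (intro prod_nonneg) auto
  qed
  also have "\<dots> = slack * (In1 * Out1)" by (simp add: slack_def)
  finally have "In2 * Out2 \<le> slack * (In1 * Out1)" .
  then have "real ((N - f) choose (m - k)) * real (N choose m) * (In2 * Out2)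
    \<le> real ((N - f) choose (m - k)) * real (N choose m) * (slack * (In1 * Out1))"
    by (rule mult_left_mono) simp
  then show ?thesis unfolding both_stars power2_eq_square by (simp add: one_star mult_ac)
qed

text \<open>The hypergeometric probability that a random \<open>m\<close>-set meets a given set of
  \<open>f\<close> edges in exactly \<open>k\<close> edges.\<close>

definition q where
  "q = real (f choose k) * real ((N - f) choose (m - k)) / real (N choose m)"

lemma q_lower:
  "q \<ge> real (f choose k) * ((real m - real k) / real N) ^ k * ((real N - real m - real f) / real N) ^ f"
proof -
  have M: "real (N choose m) > 0" using m_small by simp
  have qe: "q = real (f choose k) * (In1 * Out1)" unfolding q_def one_star using M by simp
  have "((real N - real m - real f) / real N) ^ f \<le> ((real N - real m - real f) / real N) ^ (f - k)"
    using m_small by (intro power_decreasing) auto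
  also have "\<dots> = (\<Prod>i<f - k. (real N - real m - real f) / real N)" by simp
  also have "\<dots> \<le> Out1" unfolding Out1_def
  proof (rule prod_mono, safe)
    fix i assume i: "i < f - k"
    show "(real N - real m - real f) / real N \<le> real (N - m - i) / real (N - k - i)"
      using i m_small km by (intro frac_le) (auto simp: of_nat_diff)
  qed (use m_small in auto)
  finally have O: "((real N - real m - real f) / real N) ^ f \<le> Out1" .
  have I: "((real m - real k) / real N) ^ k \<le> In1"
    unfolding In1_def using km m_small by (intro prod_ratio_ge) auto
  have "((real m - real k) / real N) ^ k * ((real N - real m - real f) / real N) ^ f \<le> In1 * Out1"
    using I O m_small km In1_pos by (intro mult_mono) auto
  then show ?thesis unfolding qe by (simp add: mult.assoc mult_left_mono)
qed

lemma q_pos: "q > 0"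
  unfolding q_def one_star using In1_pos Out1_pos k_less m_small by simp

text \<open>\<open>N - 2 * f + 1\<close> is the number of edges outside both sets, which share one
  edge. The summands treat the shared edge as absent and as present; the guard for
  \<open>k = 0\<close> is needed because \<open>k - 1\<close> would truncate to 0.\<close>

definition pair_count :: nat where
  "pair_count = ((f - 1) choose k) * (((f - 1) choose k) * ((N - 2 * f + 1) choose (m - 2 * k))) +
    (if k = 0 then 0 else
      ((f - 1) choose (k - 1)) * (((f - 1) choose (k - 1)) * ((N - 2 * f + 1) choose (m - 2 * k + 1))))"

text \<open>Up to \<open>slack\<close>, the summand without the shared edge is at most the square of
  the single count. The other one carries the relative weight (k/f)^2 N / (m - 2 k + 1): (k/f)^2
  because \<open>(f - 1) choose (k - 1)\<close> is k/f times \<open>f choose k\<close>, and the rest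
  from raising the lower index of the last binomial coefficient by one.\<close>

lemma pair_count_le:
  "real pair_count * real (N choose m) \<le>
    slack * (1 + (real k / real f)\<^sup>2 * (real N / real (m - 2 * k + 1))) *
      (real (f choose k) * real ((N - f) choose (m - k)))\<^sup>2"
proof -
  let ?R = "N - 2 * f + 1"
  let ?j = "m - 2 * k"
  let ?c = "real (f choose k)"
  let ?b = "real ((N - f) choose (m - k))"
  let ?M = "real (N choose m)"
  have 1: "real ((f - 1) choose k) \<le> ?c" by (intro of_nat_mono binomial_right_mono) simp
  have slack0: "0 \<le> slack" unfolding slack_def using f_small m_small by simp
  have A: "real ((f - 1) choose k) * (real ((f - 1) choose k) * real (?R choose ?j)) * ?M \<le> slack * (?c * ?b)\<^sup>2"
  proof -
    have "real ((f - 1) choose k) * real ((f - 1) choose k) \<le> ?c * ?c" using 1 by (intro mult_mono) auto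
    then have "(real ((f - 1) choose k) * real ((f - 1) choose k)) * (real (?R choose ?j) * ?M) \<le> (?c * ?c) * (slack * ?b\<^sup>2)"
      by (rule mult_mono[OF _ both_stars_le]) simp_all
    then show ?thesis by (simp only: power2_eq_square mult_ac)
  qed
  have B: "real ((f - 1) choose (k - 1)) * (real ((f - 1) choose (k - 1)) * real (?R choose (?j + 1))) * ?M
      \<le> slack * ((real k / real f)\<^sup>2 * (real N / real (?j + 1))) * (?c * ?b)\<^sup>2" if "k \<noteq> 0"
  proof -
    have "k * (f choose k) = f * ((f - 1) choose (k - 1))"
      using that times_binomial_minus1_eq by simp
    then have "real k * ?c = real f * real ((f - 1) choose (k - 1))" by (metis of_nat_mult)
    then have kf: "real ((f - 1) choose (k - 1)) = (real k / real f) * ?c"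
      using k_less by (simp add: field_simps)
    have "(?R choose (?j + 1)) * (?j + 1) = (?R choose ?j) * (?R - ?j)"
      using binomial_absorb_comp[of ?R ?j] binomial_absorption[of ?j ?R] by (simp add: mult.commute)
    then have "real (?R choose (?j + 1)) * real (?j + 1) = real (?R choose ?j) * real (?R - ?j)"
      by (metis of_nat_mult)
    also have "\<dots> \<le> real (?R choose ?j) * real N"
      using f_small k_less by (intro mult_left_mono) auto
    finally have "real (?R choose (?j + 1)) \<le> real (?R choose ?j) * (real N / real (?j + 1))"
      by (simp add: field_simps)
    then have "real (?R choose (?j + 1)) * ?M \<le> real (?R choose ?j) * (real N / real (?j + 1)) * ?M"
      by (rule mult_right_mono) simp
    also have "\<dots> = (real N / real (?j + 1)) * (real (?R choose ?j) * ?M)" by (simp only: mult_ac)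
    also have "\<dots> \<le> (real N / real (?j + 1)) * (slack * ?b\<^sup>2)"
      using both_stars_le by (intro mult_left_mono) auto
    finally have "((real k / real f) * ?c)\<^sup>2 * (real (?R choose (?j + 1)) * ?M) \<le>
      ((real k / real f) * ?c)\<^sup>2 * ((real N / real (?j + 1)) * (slack * ?b\<^sup>2))"
      by (rule mult_left_mono) simp
    then show ?thesis unfolding kf by (simp only: power2_eq_square mult_ac)
  qed
  show ?thesis
  proof (cases "k = 0")
    case True
    have "pair_count = ((f - 1) choose k) * (((f - 1) choose k) * (?R choose ?j))"
      unfolding pair_count_def using True by auto
    moreover have "1 + (real k / real f)\<^sup>2 * (real N / real (?j + 1)) = 1" using True by simp
    ultimately show ?thesis using A by (simp only: of_nat_mult mult_1_right)
  next
    case False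
    then show ?thesis using A B[OF False] unfolding pair_count_def
      by (simp only: if_False of_nat_add of_nat_mult distrib_right distrib_left mult_1_right)
  qed
qed

text \<open>Degree exactly \<open>k\<close> is used instead of degree at most \<open>k\<close>, so
  that the counts are products of binomial coefficients. Nothing is lost, as a minimum degree above
  \<open>k\<close> excludes degree \<open>k\<close> as well.\<close>

theorem no_exact_star:
  assumes X: "finite X" "card X = N" and I: "finite I" "I \<noteq> {}"
    and S: "\<And>v. v \<in> I \<Longrightarrow> S v \<subseteq> X" "\<And>v. v \<in> I \<Longrightarrow> card (S v) = f"
    and SS: "\<And>u v. u \<in> I \<Longrightarrow> v \<in> I \<Longrightarrow> u \<noteq> v \<Longrightarrow> \<exists>e. S u \<inter> S v = {e}"
  shows "subset_prob X m (\<lambda>A. \<forall>v\<in>I. card (A \<inter> S v) \<noteq> k) \<le>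
    1 / (real (card I) * q) + slack * (1 + (real k / real f)\<^sup>2 * (real N / real (m - 2 * k + 1))) - 1"
proof -
  let ?\<Omega> = "subsets_of_size X m"
  let ?c1 = "real (f choose k) * real ((N - f) choose (m - k))"
  let ?M = "real (N choose m)"
  have M: "?M > 0" "card ?\<Omega> = N choose m" using m_small X card_subsets_of_size by auto
  have c1: "?c1 = q * ?M" using M by (simp add: q_def)
  then have c1pos: "?c1 > 0" using q_pos M by simp
  have "real (card {A \<in> ?\<Omega>. \<forall>v\<in>I. \<not> card (A \<inter> S v) = k}) / real (card ?\<Omega>)
    \<le> real (card ?\<Omega>) / (real (card I) * ?c1) + real pair_count * real (card ?\<Omega>) / ?c1\<^sup>2 - 1"
  proof (rule second_moment)
    show "real (card {A \<in> ?\<Omega>. card (A \<inter> S v) = k}) = ?c1" if "v \<in> I" for v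
      using card_subsets_of_size_Int[OF X(1) S(1)[OF that], of k m] S(2)[OF that] X(2) km by simp
    show "real (card {A \<in> ?\<Omega>. card (A \<inter> S u) = k \<and> card (A \<inter> S v) = k}) \<le> real pair_count"
      if uv: "u \<in> I" "v \<in> I" "u \<noteq> v" for u v
    proof -
      obtain e where e: "S u \<inter> S v = {e}" using SS[OF uv] by auto
      have "N - 1 - 2 * (f - 1) = N - 2 * f + 1" using k_less f_small by auto
      then show ?thesis
        using card_subsets_of_size_pair[OF X(1) S(1)[OF uv(1)] S(1)[OF uv(2)] e km, of "f - 1"]
          S(2)[OF uv(1)] S(2)[OF uv(2)] k_less X(2) by (simp add: pair_count_def)
    qed
  qed (use X I c1pos in auto)
  also have "real (card ?\<Omega>) / (real (card I) * ?c1) = 1 / (real (card I) * q)"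
    unfolding c1 M(2) using M by simp
  also have "real pair_count * real (card ?\<Omega>) / ?c1\<^sup>2 \<le>
      slack * (1 + (real k / real f)\<^sup>2 * (real N / real (m - 2 * k + 1)))"
    unfolding M(2) by (subst pos_divide_le_eq[OF zero_less_power[OF c1pos]]) (rule pair_count_le)
  finally show ?thesis unfolding subset_prob_def using M(2) X by simp
qed

end

section \<open>Existence of vertices of small degree\<close>

lemma proc_prob_eq: "proc_prob n P = ordering_prob (all_edges n) P"
proof -
  have "edge_orderings n = permutations_of_set (all_edges n)"
    unfolding edge_orderings_def permutations_of_set_def by auto
  then show ?thesis by (simp add: proc_prob_def ordering_prob_def)
qed

lemma real_choose_2: "real (n choose 2) = real n * (real n - 1) / 2"
proof (cases n)
  case (Suc k)
  have "even (n * (n - 1))" using Suc by auto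
  then have "real (n * (n - 1) div 2) = real (n * (n - 1)) / 2" by (simp add: real_of_nat_div)
  then show ?thesis using Suc by (simp add: choose_two algebra_simps)
qed simp

lemma edge_cut_Int: "A \<subseteq> all_edges n \<Longrightarrow> edge_cut A U = A \<inter> edge_cut (all_edges n) U"
  unfolding edge_cut_def by auto

lemma inner_edges_Int: "A \<subseteq> all_edges n \<Longrightarrow> inner_edges A W = A \<inter> inner_edges (all_edges n) W"
  unfolding inner_edges_def by auto

lemma card_inner_all_edges:
  assumes "W \<subseteq> {0..<n}"
  shows "card (inner_edges (all_edges n) W) = card W choose 2"
proof -
  have "inner_edges (all_edges n) W = {e. e \<subseteq> W \<and> card e = 2}"
    unfolding inner_edges_def all_edges_alt using assms by auto
  then show ?thesis using n_subsets[of W 2] finite_subset[OF assms] by simp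
qed

lemma card_edge_cut_all_edges:
  assumes U: "U \<subseteq> {0..<n}"
  shows "card (edge_cut (all_edges n) U) = card U * (n - card U)"
proof -
  have fin: "finite U" using U finite_subset by blast
  have "bij_betw (\<lambda>(a, b). {a, b}) (U \<times> ({0..<n} - U)) (edge_cut (all_edges n) U)"
  proof (rule bij_betw_imageI)
    show "inj_on (\<lambda>(a, b). {a, b}) (U \<times> ({0..<n} - U))"
      by (auto simp: inj_on_def doubleton_eq_iff)
    show "(\<lambda>(a, b). {a, b}) ` (U \<times> ({0..<n} - U)) = edge_cut (all_edges n) U"
    proof (intro equalityI subsetI)
      fix e assume "e \<in> (\<lambda>(a, b). {a, b}) ` (U \<times> ({0..<n} - U))"
      then obtain a b where "a \<in> U" "b \<in> {0..<n} - U" "e = {a, b}" by auto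
      moreover from this have "a < n" "b < n" "a \<noteq> b" using U by auto
      then have "{a, b} \<in> all_edges n" unfolding all_edges_def by blast
      ultimately show "e \<in> edge_cut (all_edges n) U" unfolding edge_cut_def by auto
    next
      fix e assume e: "e \<in> edge_cut (all_edges n) U"
      then obtain u v where uv: "u < n" "v < n" "e = {u, v}"
        unfolding edge_cut_def all_edges_def by auto
      then have "u \<in> U \<and> v \<notin> U \<or> v \<in> U \<and> u \<notin> U" using e unfolding edge_cut_def by auto
      then show "e \<in> (\<lambda>(a, b). {a, b}) ` (U \<times> ({0..<n} - U))"
      proof
        assume "u \<in> U \<and> v \<notin> U"
        then show ?thesis using uv by (intro image_eqI[of _ _ "(u, v)"]) auto
      next
        assume "v \<in> U \<and> u \<notin> U"
        then show ?thesis using uv by (intro image_eqI[of _ _ "(v, u)"]) auto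
      qed
    qed
  qed
  then have "card (edge_cut (all_edges n) U) = card (U \<times> ({0..<n} - U))"
    by (simp add: bij_betw_same_card)
  then show ?thesis using fin U by (simp add: card_cartesian_product card_Diff_subset)
qed

lemma star_Int_star:
  assumes "u < n" "v < n" "u \<noteq> v"
  shows "edge_cut (all_edges n) {u} \<inter> edge_cut (all_edges n) {v} = {{u, v}}"
proof (intro equalityI subsetI)
  fix e assume e: "e \<in> edge_cut (all_edges n) {u} \<inter> edge_cut (all_edges n) {v}"
  then obtain x y where "e = {x, y}" by (auto simp: edge_cut_def all_edges_def)
  then show "e \<in> {{u, v}}" using e assms by (auto simp: edge_cut_def)
qed (use assms in \<open>auto simp: edge_cut_def all_edges_def\<close>)

lemma pow_le_fact_choose: "k \<le> f \<Longrightarrow> (real f - real k) ^ k \<le> fact k * real (f choose k)"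
proof (induction k)
  case (Suc k)
  have "(real f - real (Suc k)) ^ k \<le> (real f - real k) ^ k" using Suc.prems by (intro power_mono) auto
  also have "\<dots> \<le> fact k * real (f choose k)" using Suc by simp
  finally have "(real f - real (Suc k)) ^ k * (real f - real (Suc k))
    \<le> (fact k * real (f choose k)) * (real f - real k)"
    using Suc.prems by (intro mult_mono) auto
  also have "\<dots> = fact k * real ((f choose k) * (f - k))"
    using Suc.prems by (simp add: of_nat_diff)
  also have "(f choose k) * (f - k) = Suc k * (f choose Suc k)"
    using binomial_absorb_comp[of f k] binomial_absorption[of k f] by (simp add: mult.commute)
  finally show ?case by (simp add: algebra_simps)
qed simp

text \<open>A weak Stirling bound; the induction step is e \<le> (1 + 1/k)^(k + 1). The excess
  polynomial factor is harmless because \<open>k\<close> will be of order ln n.\<close>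

lemma fact_le_exp_pow:
  assumes "k > 0"
  shows "fact k \<le> exp (1 - real k) * real k ^ (k + 1)"
  using assms
proof (induction k rule: nat_induct_non_zero)
  case (Suc k)
  have k: "real k > 0" using Suc by simp
  have "1 / (real k + 1) \<le> ln (1 + 1 / real k)"
  proof -
    have "ln (real k / (real k + 1)) \<le> real k / (real k + 1) - 1"
      using k by (intro ln_le_minus_one) auto
    also have "\<dots> = - (1 / (real k + 1))" using k by (simp add: field_simps)
    finally have "1 / (real k + 1) \<le> - ln (real k / (real k + 1))" by simp
    also have "\<dots> = ln ((real k + 1) / real k)" using k by (simp add: ln_div)
    also have "(real k + 1) / real k = 1 + 1 / real k" using k by (simp add: field_simps)
    finally show ?thesis .
  qed
  then have "1 \<le> (real k + 1) * ln (1 + 1 / real k)" using k by (simp add: field_simps)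
  then have "exp 1 \<le> exp ((real k + 1) * ln (1 + 1 / real k))" by simp
  also have "\<dots> = exp (ln (1 + 1 / real k)) ^ (k + 1)"
    by (subst exp_of_nat_mult[symmetric]) (simp add: add.commute)
  also have "exp (ln (1 + 1 / real k)) = 1 + 1 / real k" using k by (simp add: add_pos_pos)
  finally have e: "exp 1 * real k ^ (k + 1) \<le> (1 + 1 / real k) ^ (k + 1) * real k ^ (k + 1)"
    by (rule mult_right_mono) simp
  also have "\<dots> = (real k + 1) ^ (k + 1)"
    using k by (simp add: power_mult_distrib[symmetric] distrib_right del: power_Suc)
  finally have e: "exp 1 * real k ^ (k + 1) \<le> (real k + 1) ^ (k + 1)" .
  have "fact (Suc k) = (real k + 1) * fact k" by simp
  also have "\<dots> \<le> (real k + 1) * (exp (1 - real k) * real k ^ (k + 1))"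
    using Suc by (intro mult_left_mono) auto
  also have "exp (1 - real k) = exp (1 - real (Suc k)) * exp 1" by (simp flip: exp_add)
  also have "(real k + 1) * (exp (1 - real (Suc k)) * exp 1 * real k ^ (k + 1)) =
    (real k + 1) * exp (1 - real (Suc k)) * (exp 1 * real k ^ (k + 1))" by simp
  also have "\<dots> \<le> (real k + 1) * exp (1 - real (Suc k)) * (real k + 1) ^ (k + 1)"
    using e by (intro mult_left_mono) auto
  finally show ?case by (simp add: mult_ac add.commute)
qed simp

lemma one_minus_ge_exp:
  fixes x :: real
  assumes "0 \<le> x" "x < 1"
  shows "exp (- (x / (1 - x))) \<le> 1 - x"
proof -
  have "1 / (1 - x) = 1 + x / (1 - x)" using assms by (simp add: field_simps)
  also have "\<dots> \<le> exp (x / (1 - x))" by (rule exp_ge_add_one_self)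
  finally have "inverse (exp (x / (1 - x))) \<le> inverse (1 / (1 - x))"
    using assms by (intro le_imp_inverse_le) auto
  then show ?thesis by (simp add: exp_minus)
qed

text \<open>The first two factors bound \<open>slack\<close> for k \<le> 4 ln n and m \<le> 10 n ln
  n, where N / (N - 2 f) equals 1 + 4 / (n - 4). The third bounds the share of the common edge. All
  three tend to 1.\<close>

definition sm_err :: "nat \<Rightarrow> real" where
  "sm_err n = exp (16 * ln (real n) / (real n - 4)) * (1 / (1 - (20 * ln (real n) + 2) / (real n - 1))) *
    (1 + 4 * ln (real n) / (real n - 1)) - 1"

text \<open>The first summand is the reciprocal of a lower bound for the expected number of vertices of degree
  \<open>k\<close>, and \<open>sm_err\<close> bounds the relative excess of the pair correlations.\<close>
lemma min_degree_gt_prob: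
  "\<forall>\<^sub>F n in sequentially. \<forall>k m. real k \<le> 4 * ln (real n) \<longrightarrow> k * n \<le> m \<longrightarrow> 0 < m \<longrightarrow>
     real m \<le> 10 * real n * ln (real n) \<longrightarrow>
     subset_prob (all_edges n) m (\<lambda>A. k < min_degree n A) \<le>
       2 * (real k + 1) * exp (2 * real m / real n + 4 - (1 + ln 2) * real k) / real n + sm_err n"
proof -
  have 1: "\<forall>\<^sub>F n in sequentially. real n > 10 + 4 * ln (real n)"
    and 2: "\<forall>\<^sub>F n in sequentially. 10 * real n * ln (real n) + 2 * real n < real n * (real n - 1) / 2"
    and 3: "\<forall>\<^sub>F n in sequentially. 64 * (ln (real n))\<^sup>2 \<le> real n - 1"
    and 4: "\<forall>\<^sub>F n in sequentially. (20 * ln (real n) + 2) / (real n - 1) < 1"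
    and 5: "\<forall>\<^sub>F n in sequentially. (20 * ln (real n) + 2) *
      ((20 * ln (real n) + 2) / (real n - 1) / (1 - (20 * ln (real n) + 2) / (real n - 1))) \<le> 1"
    by real_asymp+
  show ?thesis using 1 2 3 4 5
  proof eventually_elim
    fix n :: nat
    let ?L = "ln (real n)"
    assume n1: "real n > 10 + 4 * ?L"
      and n2: "10 * real n * ?L + 2 * real n < real n * (real n - 1) / 2"
      and n3: "64 * ?L\<^sup>2 \<le> real n - 1"
      and n4: "(20 * ?L + 2) / (real n - 1) < 1"
      and n5: "(20 * ?L + 2) * ((20 * ?L + 2) / (real n - 1) / (1 - (20 * ?L + 2) / (real n - 1))) \<le> 1"
    show "\<forall>k m. real k \<le> 4 * ?L \<longrightarrow> k * n \<le> m \<longrightarrow> 0 < m \<longrightarrow> real m \<le> 10 * real n * ?L \<longrightarrow>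
     subset_prob (all_edges n) m (\<lambda>A. k < min_degree n A) \<le>
       2 * (real k + 1) * exp (2 * real m / real n + 4 - (1 + ln 2) * real k) / real n + sm_err n"
    proof (intro allI impI)
      fix k m :: nat
      assume kL: "real k \<le> 4 * ?L" and knm: "k * n \<le> m" and m0: "0 < m" and mL: "real m \<le> 10 * real n * ?L"
      have L0: "?L \<ge> 0" using kL by (meson of_nat_0_le_iff order_trans zero_le_mult_iff not_numeral_le_zero zero_le_numeral)
      have n10: "n > 10" using n1 L0 by linarith
      define N where "N = n choose 2"
      define f where "f = n - 1"
      have rf: "real f = real n - 1" using n10 by (simp add: f_def of_nat_diff)
      have rN: "real N = real n * real f / 2" unfolding N_def real_choose_2 rf ..
      have kn: "real k * real n \<le> real m" using knm by (metis of_nat_le_iff of_nat_mult)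
      interpret two_stars N f k m
      proof
        show "k < f" using kL n1 rf by linarith
        have "4 * real f < real n * real f" using n10 rf by (intro mult_strict_right_mono) auto
        then show "2 * f < N" using rN by linarith
        show "m + 2 * f < N" using n2 mL rN rf by (simp add: algebra_simps)
        \<comment> \<open>This follows from \<open>k * n \<le> m\<close>, because N + f = f (n/2 +
          1) and n/2 + 1 is at most n.\<close>
        show "k * (N + f) \<le> f * m"
        proof -
          have "real k * (real n / 2 + 1) \<le> real k * real n" using n10 by (intro mult_left_mono) auto
          then have "real f * (real k * (real n / 2 + 1)) \<le> real f * real m"
            using kn by (intro mult_left_mono) auto
          moreover have eq: "real N + real f = real f * (real n / 2 + 1)"
            by (simp add: rN algebra_simps)
          have "real (k * (N + f)) = real f * (real k * (real n / 2 + 1))"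
            unfolding of_nat_mult of_nat_add eq by (simp only: mult_ac)
          ultimately have "real (k * (N + f)) \<le> real (f * m)" by (simp only: of_nat_mult)
          then show ?thesis by (simp only: of_nat_le_iff)
        qed
        have "2 * k \<le> k * n" using n10 by simp
        then show "2 * k \<le> m" using knm by linarith
        show "0 < m" by fact
      qed
      define x where "x = (20 * ?L + 2) / (real n - 1)"
      have x: "0 \<le> x" "x < 1" using n4 L0 n10 by (auto simp: x_def)
      have mfN: "(real m + real f) / real N \<le> x"
      proof -
        have "real m + real f \<le> real n * (10 * ?L + 1)" using mL rf by (simp add: algebra_simps)
        then have "(real m + real f) / real N \<le> real n * (10 * ?L + 1) / real N"
          by (rule divide_right_mono) simp
        also have "\<dots> = x" unfolding rN x_def rf using n10 by (simp add: field_simps)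
        finally show ?thesis .
      qed
      have Npos: "real N > 0" using f_small by simp
      have slack: "slack \<le> exp (16 * ?L / (real n - 4)) * (1 / (1 - x))"
        unfolding slack_def
      proof (rule mult_mono)
        have "real N / (real N - 2 * real f) = 1 + 4 / (real n - 4)"
        proof -
          have "real N - 2 * real f = (real n - 4) * real f / 2" unfolding rN by (simp add: algebra_simps)
          then show ?thesis unfolding rN using n10 rf by (simp add: field_simps)
        qed
        then have "(real N / (real N - 2 * real f)) ^ k \<le> exp (4 / (real n - 4) * real k)"
          using n10 power_le_exp[of "4 / (real n - 4)" k] by simp
        also have "\<dots> \<le> exp (16 * ?L / (real n - 4))"
        proof -
          have "4 * real k / (real n - 4) \<le> 16 * ?L / (real n - 4)"
            using kL n10 by (intro divide_right_mono) auto
          then show ?thesis by simp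
        qed
        finally show "(real N / (real N - 2 * real f)) ^ k \<le> exp (16 * ?L / (real n - 4))" .
        have "real N / (real N - real m - real f) = 1 / (1 - (real m + real f) / real N)"
          using Npos by (simp add: field_simps)
        also have "\<dots> \<le> 1 / (1 - x)" using mfN x by (intro divide_left_mono) auto
        finally show "real N / (real N - real m - real f) \<le> 1 / (1 - x)" .
      qed (use m_small in auto)
      have extra: "(real k / real f)\<^sup>2 * (real N / real (m - 2 * k + 1)) \<le> 4 * ?L / (real n - 1)"
      proof (cases "k = 0")
        case True
        then show ?thesis using L0 n10 by simp
      next
        case False
        have "real k * (real n - 2) \<le> real (m - 2 * k + 1)"
          using kn km by (simp add: of_nat_diff algebra_simps)
        then have "real N / real (m - 2 * k + 1) \<le> real N / (real k * (real n - 2))"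
          using False n10 by (intro divide_left_mono) auto
        then have "(real k / real f)\<^sup>2 * (real N / real (m - 2 * k + 1)) \<le>
          (real k / real f)\<^sup>2 * (real N / (real k * (real n - 2)))"
          by (rule mult_left_mono) simp
        also have "\<dots> = (real k / real f) * (real n / (2 * (real n - 2)))"
          unfolding rN using False n10 rf by (simp add: field_simps power2_eq_square)
        also have "\<dots> \<le> (real k / real f) * 1"
          using n10 by (intro mult_left_mono) (auto simp: field_simps)
        also have "\<dots> \<le> 4 * ?L / (real n - 1)" using kL rf n10 by (simp add: divide_right_mono)
        finally show ?thesis .
      qed
      have err: "slack * (1 + (real k / real f)\<^sup>2 * (real N / real (m - 2 * k + 1))) - 1 \<le> sm_err n"
      proof -
        have "slack * (1 + (real k / real f)\<^sup>2 * (real N / real (m - 2 * k + 1))) \<le>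
          exp (16 * ?L / (real n - 4)) * (1 / (1 - x)) * (1 + 4 * ?L / (real n - 1))"
          using slack extra x by (intro mult_mono) auto
        then show ?thesis unfolding sm_err_def x_def by simp
      qed
      define d where "d = 2 * real m / real n"
      have d: "d \<ge> 2 * real k" using kn n10 by (simp add: d_def field_simps)
      have dL: "d \<le> 20 * ?L" using mL n10 by (simp add: d_def field_simps)
      \<comment> \<open>The factor for the absent edges at a vertex is (1 - y)^f with f y at most d
        + 2, where d = 2 m / n is the average degree. The second-order term in y contributes at most
        1, hence d + 3.\<close>
      have A: "((real N - real m - real f) / real N) ^ f \<ge> exp (- (d + 3))"
      proof -
        define y where "y = (real m + real f) / real N"
        have y: "0 \<le> y" "y \<le> x" using mfN Npos by (auto simp: y_def)
        have fy: "real f * y = d + 2 * real f / real n"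
          unfolding y_def rN d_def using n10 rf by (simp add: field_simps)
        have fy2: "real f * y \<le> d + 2" unfolding fy using rf n10 by (simp add: field_simps)
        have "real f * (y / (1 - y)) = real f * y + real f * y * (y / (1 - y))"
          using y x by (simp add: field_simps)
        also have "\<dots> \<le> (d + 2) + (20 * ?L + 2) * (x / (1 - x))"
          using fy2 dL y x L0 by (intro add_mono mult_mono frac_le) auto
        also have "\<dots> \<le> d + 3" using n5 unfolding x_def by simp
        finally have "exp (- (d + 3)) \<le> exp (- (real f * (y / (1 - y))))" by simp
        also have "\<dots> = exp (- (y / (1 - y))) ^ f" by (simp add: exp_of_nat_mult[symmetric])
        also have "\<dots> \<le> (1 - y) ^ f" using one_minus_ge_exp[of y] y x by (intro power_mono) auto
        also have "1 - y = (real N - real m - real f) / real N" using Npos by (simp add: y_def field_simps)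
        finally show ?thesis .
      qed
      \<comment> \<open>In essence this is d^k / k!. As d is at least 2 k, it is at least (2 k)^k /
        k!, and Stirling turns this into (2 e)^k up to a polynomial factor: the origin of 1 + ln 2.
        The factor 1/2, from Bernoulli's inequality, pays for having \<open>f - k\<close> and
        \<open>m - k\<close> instead of \<open>f\<close> and \<open>m\<close>.\<close>
      have B: "real (f choose k) * ((real m - real k) / real N) ^ k \<ge> exp ((1 + ln 2) * real k - 1) / (2 * (real k + 1))"
      proof (cases "k = 0")
        case True
        have "exp (- 1 :: real) \<le> 1" by simp
        then have "exp (- 1 :: real) \<le> 2" by linarith
        then show ?thesis using True by simp
      next
        case False
        then have k0: "k > 0" by simp
        have kf: "real k / real f < 1" using k_less by simp
        have "real f \<le> real m"
        proof -
          have "1 * real n \<le> real k * real n" using k0 by (intro mult_right_mono) auto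
          then show ?thesis using kn rf by linarith
        qed
        then have km': "real k / real m \<le> real k / real f" using k0 k_less by (intro divide_left_mono) auto
        have "2 * real k * (1 - real k / real f)\<^sup>2 \<le> d * ((1 - real k / real f) * (1 - real k / real m))"
          unfolding power2_eq_square using d km' kf k0 by (intro mult_mono) auto
        also have "\<dots> = (real f - real k) * ((real m - real k) / real N)"
          unfolding rN d_def using m0 k_less n10 by (simp add: field_simps)
        finally have base: "2 * real k * (1 - real k / real f)\<^sup>2 \<le> (real f - real k) * ((real m - real k) / real N)" .
        have bern: "(1 - real k / real f) ^ (2 * k) \<ge> 1 / 2"
        proof -
          have "1 + real (2 * k) * (- (real k / real f)) \<le> (1 + - (real k / real f)) ^ (2 * k)"
            using kf by (intro Bernoulli_inequality) auto
          moreover have "real (2 * k) * (real k / real f) \<le> 1 / 2"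
          proof -
            have "(real k)\<^sup>2 \<le> (4 * ?L)\<^sup>2" using kL by (intro power_mono) auto
            then have "4 * (real k)\<^sup>2 \<le> real f" using n3 rf by (simp add: power_mult_distrib)
            then show ?thesis using k_less by (simp add: field_simps power2_eq_square)
          qed
          ultimately show ?thesis by simp
        qed
        have "(2 * real k) ^ k * (1 / 2) \<le> (2 * real k) ^ k * (1 - real k / real f) ^ (2 * k)"
          using bern by (intro mult_left_mono) auto
        also have "\<dots> = (2 * real k * (1 - real k / real f)\<^sup>2) ^ k"
          by (simp add: power_mult_distrib power_mult)
        also have "\<dots> \<le> ((real f - real k) * ((real m - real k) / real N)) ^ k"
          using base by (intro power_mono) auto
        also have "\<dots> = (real f - real k) ^ k * ((real m - real k) / real N) ^ k" by (rule power_mult_distrib)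
        also have "\<dots> \<le> (fact k * real (f choose k)) * ((real m - real k) / real N) ^ k"
          using pow_le_fact_choose[of k f] k_less km by (intro mult_right_mono) auto
        also have "\<dots> \<le> (exp (1 - real k) * real k ^ (k + 1) * real (f choose k)) * ((real m - real k) / real N) ^ k"
          using fact_le_exp_pow[OF k0] km by (intro mult_right_mono) auto
        finally have le: "real k ^ k * (2 ^ k * (1 / 2)) \<le>
          real k ^ k * (exp (1 - real k) * real k * (real (f choose k) * ((real m - real k) / real N) ^ k))"
          by (simp add: power_mult_distrib mult_ac)
        have "2 ^ k * (1 / 2) \<le> exp (1 - real k) * real k * (real (f choose k) * ((real m - real k) / real N) ^ k)"
          using mult_left_le_imp_le[OF le] k0 by simp
        also have "\<dots> \<le> exp (1 - real k) * (real k + 1) * (real (f choose k) * ((real m - real k) / real N) ^ k)"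
          using km by (intro mult_right_mono mult_left_mono) auto
        finally have "exp (real k - 1) * (2 ^ k * (1 / 2)) \<le>
          exp (real k - 1) * (exp (1 - real k) * (real k + 1) * (real (f choose k) * ((real m - real k) / real N) ^ k))"
          by (rule mult_left_mono) simp
        also have "\<dots> = (exp (real k - 1) * exp (1 - real k)) *
          ((real k + 1) * (real (f choose k) * ((real m - real k) / real N) ^ k))" by (simp only: mult_ac)
        also have "exp (real k - 1) * exp (1 - real k) = 1" by (simp flip: exp_add)
        finally have "exp (real k - 1) * 2 ^ k \<le>
          (2 * (real k + 1)) * (real (f choose k) * ((real m - real k) / real N) ^ k)" by (simp add: algebra_simps)
        moreover have "exp ((1 + ln 2) * real k - 1) = exp (real k - 1) * 2 ^ k"
        proof -
          have "(2::real) ^ k = exp (real k * ln 2)" by (simp add: exp_of_nat_mult)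
          then show ?thesis by (simp add: algebra_simps flip: exp_add)
        qed
        ultimately show ?thesis by (simp add: divide_le_eq mult_ac)
      qed
      have "exp ((1 + ln 2) * real k - d - 4) / (2 * (real k + 1)) =
        exp ((1 + ln 2) * real k - 1) / (2 * (real k + 1)) * exp (- (d + 3))"
        by (simp flip: exp_add)
      also have "\<dots> \<le> real (f choose k) * ((real m - real k) / real N) ^ k * ((real N - real m - real f) / real N) ^ f"
        using A B km by (intro mult_mono) auto
      also have "\<dots> \<le> q" by (rule q_lower)
      finally have q: "exp ((1 + ln 2) * real k - d - 4) / (2 * (real k + 1)) \<le> q" .
      have inv: "1 / (real n * q) \<le> 2 * (real k + 1) * exp (d + 4 - (1 + ln 2) * real k) / real n"
      proof -
        have "1 / (real n * q) \<le> 1 / (real n * (exp ((1 + ln 2) * real k - d - 4) / (2 * (real k + 1))))"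
          using q n10 q_pos by (intro divide_left_mono mult_left_mono) (auto intro!: mult_pos_pos)
        also have "\<dots> = 2 * (real k + 1) * (1 / exp ((1 + ln 2) * real k - d - 4)) / real n" by simp
        also have "1 / exp ((1 + ln 2) * real k - d - 4) = exp (d + 4 - (1 + ln 2) * real k)"
          by (simp add: exp_minus[symmetric] inverse_eq_divide[symmetric] algebra_simps)
        finally show ?thesis .
      qed
      have mN: "m \<le> card (all_edges n)" using m_small by (simp add: card_all_edges N_def)
      have "subset_prob (all_edges n) m (\<lambda>A. k < min_degree n A) \<le>
        subset_prob (all_edges n) m (\<lambda>A. \<forall>v\<in>{0..<n}. card (A \<inter> edge_cut (all_edges n) {v}) \<noteq> k)"
      proof (rule subset_prob_mono)
        fix A assume A: "A \<subseteq> all_edges n" "k < min_degree n A"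
        then have "Suc k \<le> degree A v" if "v < n" for v
          using le_min_degree_iff[of n "Suc k" A] that by auto
        then show "\<forall>v\<in>{0..<n}. card (A \<inter> edge_cut (all_edges n) {v}) \<noteq> k"
          using degree_eq_card_edge_cut[OF A(1)] edge_cut_Int[OF A(1)] by fastforce
      qed simp
      also have "\<dots> \<le> 1 / (real (card {0..<n}) * q) +
        slack * (1 + (real k / real f)\<^sup>2 * (real N / real (m - 2 * k + 1))) - 1"
      proof (rule no_exact_star)
        show "card (all_edges n) = N" by (simp add: card_all_edges N_def)
        show "edge_cut (all_edges n) {v} \<subseteq> all_edges n" for v by (auto simp: edge_cut_def)
        show "card (edge_cut (all_edges n) {v}) = f" if "v \<in> {0..<n}" for v
          using card_edge_cut_all_edges[of "{v}" n] that by (simp add: f_def)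
        show "\<exists>e. edge_cut (all_edges n) {u} \<inter> edge_cut (all_edges n) {v} = {e}"
          if "u \<in> {0..<n}" "v \<in> {0..<n}" "u \<noteq> v" for u v
          using star_Int_star[of u n v] that by auto
      qed (use n10 in auto)
      finally show "subset_prob (all_edges n) m (\<lambda>A. k < min_degree n A) \<le>
       2 * (real k + 1) * exp (2 * real m / real n + 4 - (1 + ln 2) * real k) / real n + sm_err n"
        using inv err unfolding d_def by simp
    qed
  qed
qed

section \<open>The minimum degree threshold\<close>

lemma proc_prob_at_time:
  assumes "m \<le> n choose 2"
  shows "proc_prob n (\<lambda>xs. Q (proc_graph xs m)) = subset_prob (all_edges n) m Q"
  unfolding proc_prob_eq proc_graph_def
  using assms by (intro ordering_prob_prefix) (auto simp: card_all_edges)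

lemma proc_prob_mono:
  assumes "\<And>xs. xs \<in> permutations_of_set (all_edges n) \<Longrightarrow> P xs \<Longrightarrow> Q xs"
  shows "proc_prob n P \<le> proc_prob n Q"
  unfolding proc_prob_eq using assms by (intro ordering_prob_mono) auto

lemma proc_prob_disj_le: "proc_prob n (\<lambda>xs. P xs \<or> Q xs) \<le> proc_prob n P + proc_prob n Q"
  unfolding proc_prob_eq by (rule ordering_prob_disj_le)

lemma proc_prob_bex_le:
  "finite I \<Longrightarrow> proc_prob n (\<lambda>xs. \<exists>i\<in>I. P i xs) \<le> (\<Sum>i\<in>I. proc_prob n (P i))"
  unfolding proc_prob_eq by (rule ordering_prob_bex_le)

text \<open>Phrased for bad events, since these combine by unions and pass to smaller events;
  complements are taken once, in \<open>tendsto_1_if_rare_not\<close>.\<close>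

definition rare :: "(nat \<Rightarrow> nat set list \<Rightarrow> bool) \<Rightarrow> bool" where
  "rare P \<longleftrightarrow> (\<lambda>n. proc_prob n (P n)) \<longlonglongrightarrow> 0"

lemma proc_prob_nonneg: "0 \<le> proc_prob n P"
  by (simp add: proc_prob_eq ordering_prob_nonneg)

lemma rareI:
  assumes "B \<longlonglongrightarrow> 0" "\<forall>\<^sub>F n in sequentially. proc_prob n (P n) \<le> B n"
  shows "rare P"
  unfolding rare_def
  by (rule tendsto_sandwich[OF _ assms(2) tendsto_const assms(1)]) (simp add: proc_prob_nonneg)

lemma rare_subset:
  assumes "rare Q"
    and "\<forall>\<^sub>F n in sequentially. \<forall>xs\<in>permutations_of_set (all_edges n). P n xs \<longrightarrow> Q n xs"
  shows "rare P"
  using assms(1)[unfolded rare_def] eventually_mono[OF assms(2)]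
  by (rule rareI) (auto intro: proc_prob_mono)

lemma rare_disj: "rare P \<Longrightarrow> rare Q \<Longrightarrow> rare (\<lambda>n xs. P n xs \<or> Q n xs)"
  unfolding rare_def[of P] rare_def[of Q]
  by (rule rareI[OF tendsto_add_zero[of "\<lambda>n. proc_prob n (P n)" _ "\<lambda>n. proc_prob n (Q n)"]])
    (simp_all add: proc_prob_disj_le)

lemma rare_bex:
  assumes lim: "(\<lambda>n. c n * b n) \<longlonglongrightarrow> 0"
    and bound: "\<forall>\<^sub>F n in sequentially. finite (I n) \<and> real (card (I n)) \<le> c n \<and>
      (\<forall>i\<in>I n. proc_prob n (P n i) \<le> b n)"
  shows "rare (\<lambda>n xs. \<exists>i\<in>I n. P n i xs)"
proof (rule rareI[OF tendsto_rabs_zero[OF lim]])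
  show "\<forall>\<^sub>F n in sequentially. proc_prob n (\<lambda>xs. \<exists>i\<in>I n. P n i xs) \<le> \<bar>c n * b n\<bar>"
    using bound
  proof eventually_elim
    case (elim n)
    have "proc_prob n (\<lambda>xs. \<exists>i\<in>I n. P n i xs) \<le> (\<Sum>i\<in>I n. proc_prob n (P n i))"
      using elim by (intro proc_prob_bex_le) auto
    also have "\<dots> \<le> (\<Sum>i\<in>I n. \<bar>b n\<bar>)" using elim by (intro sum_mono) (auto intro: order_trans)
    also have "\<dots> = real (card (I n)) * \<bar>b n\<bar>" by simp
    also have "\<dots> \<le> \<bar>c n\<bar> * \<bar>b n\<bar>" using elim by (intro mult_right_mono) auto
    finally show ?case by (simp add: abs_mult)
  qed
qed

lemma tendsto_1_if_rare_not:
  assumes "rare (\<lambda>n xs. \<not> P n xs)"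
  shows "(\<lambda>n. proc_prob n (P n)) \<longlonglongrightarrow> 1"
proof -
  have "(\<lambda>n. 1 - proc_prob n (\<lambda>xs. \<not> P n xs)) \<longlonglongrightarrow> 1 - 0"
    using assms unfolding rare_def by (intro tendsto_diff tendsto_const)
  then show ?thesis by (simp add: proc_prob_eq ordering_prob_not)
qed

lemma proc_graph_subset:
  "xs \<in> permutations_of_set (all_edges n) \<Longrightarrow> proc_graph xs m \<subseteq> all_edges n"
  unfolding proc_graph_def by (auto dest: permutations_of_setD(1) in_set_takeD)

lemma proc_graph_mono: "a \<le> b \<Longrightarrow> proc_graph xs a \<subseteq> proc_graph xs b"
  unfolding proc_graph_def by (rule set_take_subset_set_take)

lemma card_proc_graph:
  assumes "xs \<in> permutations_of_set (all_edges n)" "m \<le> n choose 2"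
  shows "card (proc_graph xs m) = m"
proof -
  have "distinct xs" "set xs = all_edges n" using assms by (auto dest: permutations_of_setD)
  then have "length xs = n choose 2" using distinct_card[of xs] card_all_edges[of n] by simp
  then show ?thesis
    unfolding proc_graph_def using \<open>distinct xs\<close> assms(2) by (simp add: distinct_card)
qed

lemma min_degree_mono:
  assumes "A \<subseteq> B" "finite B" "n > 0"
  shows "min_degree n A \<le> min_degree n B"
proof -
  have "degree A v \<le> degree B v" for v
    unfolding degree_def using assms by (intro card_mono) auto
  moreover have "\<forall>v<n. min_degree n A \<le> degree A v" using le_min_degree_iff[OF assms(3)] by blast
  ultimately show ?thesis using le_min_degree_iff[OF assms(3)] order_trans by blast
qed

text \<open>Union bound over the vertices, whose mean degree is 2 m / n. The tilt \<open>s\<close>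
  stays free: \<open>ln 2\<close> is optimal for a degree of half the mean and gives the sharp
  threshold, while 1 suffices where the constants are generous.\<close>

lemma min_degree_le_prob:
  assumes n: "n \<ge> 2" and m: "m \<le> n choose 2" and s: "s \<ge> 0"
  shows "subset_prob (all_edges n) m (\<lambda>A. min_degree n A \<le> k)
    \<le> real n * exp (s * real k - (1 - exp (- s)) * (2 * real m / real n))"
proof -
  have mN: "m \<le> card (all_edges n)" using m by (simp add: card_all_edges)
  have "subset_prob (all_edges n) m (\<lambda>A. min_degree n A \<le> k) \<le>
    subset_prob (all_edges n) m (\<lambda>A. \<exists>v\<in>{0..<n}. real (card (A \<inter> edge_cut (all_edges n) {v})) \<le> real k)"
  proof (rule subset_prob_mono)
    fix A assume A: "A \<subseteq> all_edges n" "min_degree n A \<le> k"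
    then have "\<not> Suc k \<le> min_degree n A" by simp
    then obtain v where "v < n" "\<not> Suc k \<le> degree A v" using le_min_degree_iff[of n "Suc k" A] n by fastforce
    then show "\<exists>v\<in>{0..<n}. real (card (A \<inter> edge_cut (all_edges n) {v})) \<le> real k"
      using degree_eq_card_edge_cut[OF A(1)] edge_cut_Int[OF A(1)] by (intro bexI[of _ v]) auto
  qed simp
  also have "\<dots> \<le> (\<Sum>v\<in>{0..<n}. subset_prob (all_edges n) m
      (\<lambda>A. real (card (A \<inter> edge_cut (all_edges n) {v})) \<le> real k))"
    using mN by (intro subset_prob_bex_le) auto
  also have "\<dots> \<le> (\<Sum>v\<in>{0..<n}. exp (s * real k - (1 - exp (- s)) * (2 * real m / real n)))"
  proof (rule sum_mono)
    fix v assume v: "v \<in> {0..<n}"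
    have "real m / real (card (all_edges n)) * real (card (edge_cut (all_edges n) {v})) = 2 * real m / real n"
      using card_edge_cut_all_edges[of "{v}" n] v n
      by (simp add: card_all_edges real_choose_2 of_nat_diff field_simps)
    then have "(1 - exp (- s)) * (real m / real (card (all_edges n))) * real (card (edge_cut (all_edges n) {v})) =
      (1 - exp (- s)) * (2 * real m / real n)" by (simp only: mult.assoc)
    moreover have "edge_cut (all_edges n) {v} \<subseteq> all_edges n" by (auto simp: edge_cut_def)
    ultimately show "subset_prob (all_edges n) m (\<lambda>A. real (card (A \<inter> edge_cut (all_edges n) {v})) \<le> real k)
      \<le> exp (s * real k - (1 - exp (- s)) * (2 * real m / real n))"
      using subset_prob_lower_tail[of "all_edges n" "edge_cut (all_edges n) {v}" m s "real k"] mN s by simp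
  qed
  finally show ?thesis by simp
qed

lemma le_div_add_one_mult: "0 < d \<Longrightarrow> m \<le> (m div d + 1) * (d::nat)"
  using dividend_less_div_times[of d m] by simp

lemma sum_exp_geometric_le:
  assumes K: "finite K" "\<And>k. k \<in> K \<Longrightarrow> x \<le> real k" and c: "c > 0"
  shows "(\<Sum>k\<in>K. exp (- c * real k)) \<le> exp (- c * x) / (1 - exp (- c))"
proof -
  define k0 where "k0 = nat \<lceil>x\<rceil>"
  have k0: "k0 \<le> k" if "k \<in> K" for k using K(2)[OF that] by (simp add: k0_def nat_le_iff ceiling_le_iff)
  obtain M where M: "\<And>k. k \<in> K \<Longrightarrow> k \<le> M" using K(1) by (meson Max_ge)
  have r: "exp (- c) < 1" using c by simp
  have "(\<Sum>k\<in>K. exp (- c * real k)) \<le> (\<Sum>k\<in>{k0..<k0 + Suc M}. exp (- c * real k))"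
  proof (rule sum_mono2)
    show "K \<subseteq> {k0..<k0 + Suc M}"
    proof
      fix k assume "k \<in> K"
      then show "k \<in> {k0..<k0 + Suc M}" using k0[of k] M[of k] by simp
    qed
  qed simp_all
  also have "\<dots> = (\<Sum>j<Suc M. exp (- c * real (k0 + j)))"
    using sum.shift_bounds_nat_ivl[of "\<lambda>k. exp (- c * real k)" 0 k0 "Suc M"]
    by (simp add: atLeast0LessThan add.commute)
  also have "\<dots> = exp (- c * real k0) * (\<Sum>j<Suc M. exp (- c) ^ j)"
    unfolding sum_distrib_left
    by (intro sum.cong refl) (simp add: exp_of_nat_mult[symmetric] distrib_left exp_add[symmetric] mult.commute)
  also have "(\<Sum>j<Suc M. exp (- c) ^ j) = (1 - exp (- c) ^ Suc M) / (1 - exp (- c))"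
    using sum_gp_strict[of "exp (- c)" "Suc M"] r by simp
  also have "\<dots> \<le> 1 / (1 - exp (- c))" using r by (intro divide_right_mono) auto
  also have "exp (- c * real k0) * (1 / (1 - exp (- c))) \<le> exp (- c * x) * (1 / (1 - exp (- c)))"
  proof (intro mult_right_mono)
    have "x \<le> real k0" unfolding k0_def by linarith
    then show "exp (- c * real k0) \<le> exp (- c * x)" using c by simp
  qed (use r in simp)
  finally show ?thesis using mult_left_mono by simp
qed

lemma beta_const_half: "beta_const / 2 = 1 / (1 - ln 2)"
proof -
  have "ln (exp 1 / 2) = 1 - ln (2::real)" by (simp add: ln_div)
  moreover have "2 / x / 2 = 1 / x" for x :: real by simp
  ultimately show ?thesis unfolding beta_const_def by metis
qed

lemma one_minus_ln2_bounds: "11 / 36 \<le> 1 - ln (2::real)" "1 - ln (2::real) \<le> 1 / 3"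
  using ln2_ge_two_thirds ln2_le_25_over_36 by simp_all

text \<open>Uniformity in \<open>m\<close> is obtained by monotonicity: with k = m div (n - 1) the
  graph is contained in the one at time (k + 1) (n - 1). So one event per \<open>k\<close> is
  enough, and only O(ln n) values of \<open>k\<close> occur.\<close>

lemma low_degree_before_threshold:
  assumes a: "0 \<le> a" "a < 1"
  shows "rare (\<lambda>n xs. \<exists>m\<le>n choose 2. real m \<le> a / (1 - ln 2) * real n * ln (real n) \<and>
    m div (n - 1) < min_degree n (proc_graph xs m))"
proof -
  define c :: real where "c = 1 - ln 2"
  have c: "11 / 36 \<le> c" "c \<le> 1 / 3" using one_minus_ln2_bounds by (auto simp: c_def)
  define K where "K n = {k. real (k * (n - 1)) \<le> a / c * real n * ln (real n)}" for n
  define b where "b n = 2 * (4 * ln (real n) + 1) * exp (a * ln (real n) + 7) / real n + sm_err n" for n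
  have ev: "\<forall>\<^sub>F n in sequentially. 5 \<le> ln (real n) \<and> 4 * ln (real n) + 1 \<le> real n / 2 \<and>
    100 \<le> real n \<and> ln (real n) \<le> real n - 1"
    by (intro eventually_conj; real_asymp)
  have "rare (\<lambda>n xs. \<exists>k\<in>K n. k < min_degree n (proc_graph xs ((k + 1) * (n - 1))))"
  proof (rule rare_bex)
    show "(\<lambda>n. (4 * ln (real n) + 1) * b n) \<longlonglongrightarrow> 0" unfolding b_def sm_err_def using a by real_asymp
    show "\<forall>\<^sub>F n in sequentially. finite (K n) \<and> real (card (K n)) \<le> 4 * ln (real n) + 1 \<and>
      (\<forall>k\<in>K n. proc_prob n (\<lambda>xs. k < min_degree n (proc_graph xs ((k + 1) * (n - 1)))) \<le> b n)"
      using ev min_degree_gt_prob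
    proof eventually_elim
      case (elim n)
      let ?L = "ln (real n)"
      have L1: "?L \<ge> 5" and Ln: "4 * ?L + 1 \<le> real n / 2" and n100: "real n \<ge> 100" and Ln1: "?L \<le> real n - 1"
        using elim(1) by auto
      have n1: "real (n - 1) = real n - 1" using n100 by (simp add: of_nat_diff)
      have Kk: "real k * c \<le> a * ?L + 1" "real k \<le> 4 * ?L" if "k \<in> K n" for k
      proof -
        have "real k * (real n - 1) \<le> a / c * real n * ?L" using that n1 by (simp add: K_def)
        then have "real k * c * (real n - 1) \<le> a * real n * ?L"
          using c by (simp add: field_simps)
        also have "\<dots> \<le> (a * ?L + 1) * (real n - 1)"
        proof -
          have "a * ?L \<le> 1 * ?L" using a L1 by (intro mult_right_mono) auto
          then show ?thesis using Ln1 by (simp add: algebra_simps)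
        qed
        finally show kc: "real k * c \<le> a * ?L + 1"
          using n100 mult_right_le_imp_le[of "real k * c" "real n - 1" "a * ?L + 1"] by simp
        have "a * ?L \<le> 1 * ?L" using a L1 by (intro mult_right_mono) auto
        then have "real k * c \<le> ?L + 1" using kc by linarith
        moreover have "real k * (11 / 36) \<le> real k * c" using c by (intro mult_left_mono) auto
        ultimately have "real k * (11 / 36) \<le> ?L + 1" by linarith
        then show "real k \<le> 4 * ?L" using L1 by linarith
      qed
      have sub: "K n \<subseteq> {..nat \<lfloor>4 * ?L\<rfloor>}" using Kk(2) by (auto simp: le_nat_floor)
      have "card (K n) \<le> Suc (nat \<lfloor>4 * ?L\<rfloor>)" using card_mono[OF _ sub] by simp
      moreover have "real (nat \<lfloor>4 * ?L\<rfloor>) \<le> 4 * ?L" using L1 by simp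
      ultimately have cardK: "real (card (K n)) \<le> 4 * ?L + 1" by linarith
      have "proc_prob n (\<lambda>xs. k < min_degree n (proc_graph xs ((k + 1) * (n - 1)))) \<le> b n" if k: "k \<in> K n" for k
      proof -
        let ?m = "(k + 1) * (n - 1)"
        have rm: "real ?m = (real k + 1) * (real n - 1)" by (simp only: of_nat_mult of_nat_add of_nat_1 n1)
        have "(real k + 1) * (real n - 1) \<le> real n / 2 * (real n - 1)"
          using Kk(2)[OF k] Ln n100 by (intro mult_right_mono) auto
        then have "real ?m \<le> real (n choose 2)" unfolding rm real_choose_2 by linarith
        then have mN: "?m \<le> n choose 2" by (simp only: of_nat_le_iff)
        have "real k + 1 \<le> real n" using Kk(2)[OF k] Ln L1 by linarith
        then have "real (k * n) \<le> real ?m" unfolding rm by (simp add: algebra_simps)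
        then have 1: "k * n \<le> ?m" by (simp only: of_nat_le_iff)
        have 2: "0 < ?m" using n100 by simp
        have "(real k + 1) * (real n - 1) \<le> (10 * ?L) * real n"
          using Kk(2)[OF k] L1 n100 by (intro mult_mono) auto
        then have 3: "real ?m \<le> 10 * real n * ?L" unfolding rm by (simp add: mult_ac)
        have "proc_prob n (\<lambda>xs. k < min_degree n (proc_graph xs ?m)) = subset_prob (all_edges n) ?m (\<lambda>A. k < min_degree n A)"
          by (rule proc_prob_at_time[OF mN])
        also have "\<dots> \<le> 2 * (real k + 1) * exp (2 * real ?m / real n + 4 - (1 + ln 2) * real k) / real n + sm_err n"
          using elim(2) Kk(2)[OF k] 1 2 3 by blast
        also have "\<dots> \<le> b n"
        proof -
          \<comment> \<open>With average degree at most 2 (k + 1) the exponent is (1 - ln 2) k + 6,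
            and (1 - ln 2) k exceeds a ln n by at most 1; since a < 1, the exponential stays a power
            of n below the first.\<close>
          have "2 * real ?m / real n \<le> 2 * (real k + 1)"
            unfolding rm using n100 by (simp add: field_simps)
          then have "2 * real ?m / real n + 4 - (1 + ln 2) * real k \<le> a * ?L + 7"
            using Kk(1)[OF k] by (simp add: c_def algebra_simps)
          then show ?thesis
            unfolding b_def using Kk(2)[OF k] L1 by (intro add_right_mono divide_right_mono mult_mono) auto
        qed
        finally show ?thesis .
      qed
      then show ?case using finite_subset[OF sub] cardK by blast
    qed
  qed
  moreover have "\<forall>\<^sub>F n in sequentially. \<forall>xs\<in>permutations_of_set (all_edges n).
    (\<exists>m\<le>n choose 2. real m \<le> a / (1 - ln 2) * real n * ln (real n) \<and>
      m div (n - 1) < min_degree n (proc_graph xs m)) \<longrightarrow>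
    (\<exists>k\<in>K n. k < min_degree n (proc_graph xs ((k + 1) * (n - 1))))"
    using ev
  proof (eventually_elim, intro ballI impI, elim exE conjE)
    fix n xs m assume n: "100 \<le> real n" and xs: "xs \<in> permutations_of_set (all_edges n)"
      and m: "real m \<le> a / (1 - ln 2) * real n * ln (real n)" "m div (n - 1) < min_degree n (proc_graph xs m)"
    let ?k = "m div (n - 1)"
    have "?k * (n - 1) \<le> m" by simp
    then have "real (?k * (n - 1)) \<le> real m" by (simp only: of_nat_le_iff)
    then have "?k \<in> K n" using m(1) unfolding K_def c_def by simp
    moreover have "m \<le> (?k + 1) * (n - 1)" using n by (intro le_div_add_one_mult) simp
    then have "min_degree n (proc_graph xs m) \<le> min_degree n (proc_graph xs ((?k + 1) * (n - 1)))"
      using n finite_subset[OF proc_graph_subset[OF xs]] by (intro min_degree_mono proc_graph_mono) auto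
    ultimately show "\<exists>k\<in>K n. k < min_degree n (proc_graph xs ((k + 1) * (n - 1)))"
      using m(2) by (intro bexI[of _ ?k]) auto
  qed
  ultimately show ?thesis by (rule rare_subset)
qed

text \<open>Here the graph contains the one at time k (n - 1) with k = m div (n - 1). The rounding
  costs the 1 subtracted in \<open>K\<close>. Linearly many \<open>k\<close> remain, but the bounds
  decay geometrically in \<open>k\<close>, so the smallest one dominates.\<close>

lemma high_degree_after_threshold:
  assumes \<epsilon>: "\<epsilon> > 0"
  shows "rare (\<lambda>n xs. \<exists>m\<le>n choose 2. (1 + \<epsilon>) / (1 - ln 2) * real n * ln (real n) \<le> real m \<and>
    min_degree n (proc_graph xs m) \<le> m div (n - 1))"
proof -
  define c :: real where "c = 1 - ln 2"
  have c: "c > 0" using one_minus_ln2_bounds by (simp add: c_def)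
  define K where "K n = {k. (1 + \<epsilon>) / c * ln (real n) - 1 \<le> real k \<and> k * (n - 1) \<le> n choose 2}" for n
  define B where "B n = real n * exp 1 * (exp (- (1 + \<epsilon>) * ln (real n) + c) / (1 - exp (- c)))" for n
  have ev: "\<forall>\<^sub>F n in sequentially. 2 \<le> real n" by real_asymp
  have "rare (\<lambda>n xs. \<exists>k\<in>K n. min_degree n (proc_graph xs (k * (n - 1))) \<le> k)"
  proof (rule rareI)
    show "B \<longlonglongrightarrow> 0" unfolding B_def using \<epsilon> c by real_asymp
    show "\<forall>\<^sub>F n in sequentially. proc_prob n (\<lambda>xs. \<exists>k\<in>K n. min_degree n (proc_graph xs (k * (n - 1))) \<le> k) \<le> B n"
      using ev
    proof eventually_elim
      case n2: (elim n)
      have n1: "real (n - 1) = real n - 1" using n2 by (simp add: of_nat_diff)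
      have Kn: "real k \<le> real n" if "k \<in> K n" for k
      proof -
        have "real (k * (n - 1)) \<le> real (n choose 2)" using that unfolding K_def by (simp only: of_nat_le_iff mem_Collect_eq)
        then have "real k * (real n - 1) \<le> (real n / 2) * (real n - 1)" using n1 by (simp add: real_choose_2)
        then show ?thesis using mult_right_le_imp_le[of "real k" "real n - 1" "real n / 2"] n2 by simp
      qed
      then have finK: "finite (K n)" using finite_subset[of "K n" "{..n}"] by auto
      have step: "proc_prob n (\<lambda>xs. min_degree n (proc_graph xs (k * (n - 1))) \<le> k)
        \<le> real n * exp 1 * exp (- c * real k)" if k: "k \<in> K n" for k
      proof -
        have kN: "k * (n - 1) \<le> n choose 2" using k by (simp add: K_def)
        have "proc_prob n (\<lambda>xs. min_degree n (proc_graph xs (k * (n - 1))) \<le> k) =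
          subset_prob (all_edges n) (k * (n - 1)) (\<lambda>A. min_degree n A \<le> k)"
          by (rule proc_prob_at_time[OF kN])
        also have "\<dots> \<le> real n * exp (ln 2 * real k - (1 - exp (- ln 2)) * (2 * real (k * (n - 1)) / real n))"
          using n2 kN by (intro min_degree_le_prob) auto
        \<comment> \<open>At s = ln 2 the factor 1 - exp (-s) is 1/2, so the mean degree of about 2
          k contributes -k; together with k ln 2 this is the rate -(1 - ln 2) k. The correction k /
          n comes from n - 1 in place of n.\<close>
        also have "ln 2 * real k - (1 - exp (- ln 2)) * (2 * real (k * (n - 1)) / real n) = - c * real k + real k / real n"
          using n2 n1 by (simp add: exp_minus c_def field_simps)
        also have "real n * exp (- c * real k + real k / real n) \<le> real n * exp (- c * real k + 1)"
          using Kn[OF k] n2 by (intro mult_left_mono) (auto simp: divide_le_eq)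
        also have "\<dots> = real n * exp 1 * exp (- c * real k)" by (simp only: exp_add mult_ac)
        finally show ?thesis .
      qed
      have "proc_prob n (\<lambda>xs. \<exists>k\<in>K n. min_degree n (proc_graph xs (k * (n - 1))) \<le> k)
        \<le> (\<Sum>k\<in>K n. proc_prob n (\<lambda>xs. min_degree n (proc_graph xs (k * (n - 1))) \<le> k))"
        by (rule proc_prob_bex_le[OF finK])
      also have "\<dots> \<le> (\<Sum>k\<in>K n. real n * exp 1 * exp (- c * real k))" by (rule sum_mono) (rule step)
      also have "\<dots> = real n * exp 1 * (\<Sum>k\<in>K n. exp (- c * real k))" by (rule sum_distrib_left[symmetric])
      also have "\<dots> \<le> real n * exp 1 * (exp (- c * ((1 + \<epsilon>) / c * ln (real n) - 1)) / (1 - exp (- c)))"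
        using finK c by (intro mult_left_mono sum_exp_geometric_le) (auto simp: K_def)
      also have "- c * ((1 + \<epsilon>) / c * ln (real n) - 1) = - (1 + \<epsilon>) * ln (real n) + c" using c by (simp add: field_simps)
      finally show ?case unfolding B_def .
    qed
  qed
  moreover have "\<forall>\<^sub>F n in sequentially. \<forall>xs\<in>permutations_of_set (all_edges n).
    (\<exists>m\<le>n choose 2. (1 + \<epsilon>) / (1 - ln 2) * real n * ln (real n) \<le> real m \<and>
      min_degree n (proc_graph xs m) \<le> m div (n - 1)) \<longrightarrow>
    (\<exists>k\<in>K n. min_degree n (proc_graph xs (k * (n - 1))) \<le> k)"
    using ev
  proof (eventually_elim, intro ballI impI, elim exE conjE)
    fix n xs m assume n2: "2 \<le> real n" and xs: "xs \<in> permutations_of_set (all_edges n)"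
      and m: "m \<le> n choose 2" "(1 + \<epsilon>) / (1 - ln 2) * real n * ln (real n) \<le> real m"
        "min_degree n (proc_graph xs m) \<le> m div (n - 1)"
    let ?L = "ln (real n)" and ?k = "m div (n - 1)"
    have n1: "real (n - 1) = real n - 1" using n2 by (simp add: of_nat_diff)
    have km: "?k * (n - 1) \<le> m" by simp
    have "m \<le> (?k + 1) * (n - 1)" using n2 by (intro le_div_add_one_mult) simp
    then have "real m \<le> real ((?k + 1) * (n - 1))" by (simp only: of_nat_le_iff)
    then have "real m \<le> (real ?k + 1) * (real n - 1)"
      by (simp only: of_nat_mult of_nat_add of_nat_1 n1)
    moreover have "(1 + \<epsilon>) / c * ?L * (real n - 1) \<le> (1 + \<epsilon>) / c * ?L * real n"
      using \<epsilon> c n2 by (intro mult_left_mono) auto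
    moreover have "(1 + \<epsilon>) / c * ?L * real n \<le> real m" using m(2) by (simp add: c_def mult_ac)
    ultimately have "(1 + \<epsilon>) / c * ?L * (real n - 1) \<le> (real ?k + 1) * (real n - 1)" by linarith
    then have "(1 + \<epsilon>) / c * ?L \<le> real ?k + 1"
      using mult_right_le_imp_le[of "(1 + \<epsilon>) / c * ?L" "real n - 1" "real ?k + 1"] n2 by simp
    moreover have "?k * (n - 1) \<le> n choose 2" using km m(1) by (rule le_trans)
    ultimately have "?k \<in> K n" unfolding K_def by simp
    moreover have "min_degree n (proc_graph xs (?k * (n - 1))) \<le> min_degree n (proc_graph xs m)"
      using n2 finite_subset[OF proc_graph_subset[OF xs]] km by (intro min_degree_mono proc_graph_mono) auto
    ultimately show "\<exists>k\<in>K n. min_degree n (proc_graph xs (k * (n - 1))) \<le> k"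
      using m(3) by (intro bexI[of _ ?k]) auto
  qed
  ultimately show ?thesis by (rule rare_subset)
qed

theorem min_degree_threshold:
  fixes \<epsilon> :: real
  assumes "\<epsilon> > 0"
  shows "(\<lambda>n. proc_prob n (\<lambda>xs.
             (\<forall>m \<le> n choose 2. real m \<le> (1 - \<epsilon>) * beta_const / 2 * real n * ln (real n) \<longrightarrow>
                 min_degree n (proc_graph xs m) \<le> m div (n - 1)) \<and>
             (\<forall>m \<le> n choose 2. (1 + \<epsilon>) * beta_const / 2 * real n * ln (real n) \<le> real m \<longrightarrow>
                 min_degree n (proc_graph xs m) > m div (n - 1))))
          \<longlonglongrightarrow> 1"
proof (rule tendsto_1_if_rare_not, rule rare_subset)
  \<comment> \<open>For \<epsilon> > 1 the factor 1 - \<epsilon> is negative; the maximum keeps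
    \<open>a\<close> in the range required below the threshold.\<close>
  define a where "a = max 0 (1 - \<epsilon>)"
  have a: "0 \<le> a" "a < 1" "1 - \<epsilon> \<le> a" using assms by (auto simp: a_def)
  show "rare (\<lambda>n xs. (\<exists>m\<le>n choose 2. real m \<le> a / (1 - ln 2) * real n * ln (real n) \<and>
      m div (n - 1) < min_degree n (proc_graph xs m)) \<or>
    (\<exists>m\<le>n choose 2. (1 + \<epsilon>) / (1 - ln 2) * real n * ln (real n) \<le> real m \<and>
      min_degree n (proc_graph xs m) \<le> m div (n - 1)))"
    using low_degree_before_threshold[OF a(1,2)] high_degree_after_threshold[OF assms] by (rule rare_disj)
  have beta: "x * beta_const / 2 = x / (1 - ln 2)" for x
    using beta_const_half by (metis times_divide_eq_right mult.right_neutral)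
  have "\<forall>\<^sub>F n in sequentially. 0 \<le> ln (real n)" by real_asymp
  then have "\<forall>\<^sub>F n in sequentially. (1 - \<epsilon>) / (1 - ln 2) * real n * ln (real n) \<le> a / (1 - ln 2) * real n * ln (real n)"
    by eventually_elim (use a(3) one_minus_ln2_bounds in \<open>auto intro!: mult_right_mono divide_right_mono\<close>)
  then show "\<forall>\<^sub>F n in sequentially. \<forall>xs\<in>permutations_of_set (all_edges n). \<not>
      ((\<forall>m \<le> n choose 2. real m \<le> (1 - \<epsilon>) * beta_const / 2 * real n * ln (real n) \<longrightarrow>
          min_degree n (proc_graph xs m) \<le> m div (n - 1)) \<and>
       (\<forall>m \<le> n choose 2. (1 + \<epsilon>) * beta_const / 2 * real n * ln (real n) \<le> real m \<longrightarrow>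
          min_degree n (proc_graph xs m) > m div (n - 1))) \<longrightarrow>
    (\<exists>m\<le>n choose 2. real m \<le> a / (1 - ln 2) * real n * ln (real n) \<and>
      m div (n - 1) < min_degree n (proc_graph xs m)) \<or>
    (\<exists>m\<le>n choose 2. (1 + \<epsilon>) / (1 - ln 2) * real n * ln (real n) \<le> real m \<and>
      min_degree n (proc_graph xs m) \<le> m div (n - 1))"
    unfolding beta by eventually_elim (meson not_le order_trans)
qed

section \<open>Tree packing in the random graph process\<close>

lemma binomial_le_exp_pow:
  assumes w: "w > 0"
  shows "real (n choose w) \<le> (exp 1 * real n / real w) ^ w"
proof -
  have fact: "real w ^ w \<le> exp 1 ^ w * fact w"
    using w
  proof (induction w rule: nat_induct_non_zero)
    case (Suc k)
    have k: "real k > 0" using Suc by simp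
    have "(1 + 1 / real k) ^ k \<le> exp 1" using power_le_exp[of "1 / real k" k] k by simp
    then have "(1 + 1 / real k) ^ k * real k ^ k \<le> exp 1 * real k ^ k" by (rule mult_right_mono) simp
    also have "(1 + 1 / real k) ^ k * real k ^ k = real (Suc k) ^ k"
      using k by (simp add: power_mult_distrib[symmetric] distrib_right add.commute)
    also have "exp 1 * real k ^ k \<le> exp 1 * (exp 1 ^ k * fact k)" using Suc by (intro mult_left_mono) auto
    finally have "real (Suc k) * real (Suc k) ^ k \<le> real (Suc k) * (exp 1 * (exp 1 ^ k * fact k))"
      by (rule mult_left_mono) simp
    then show ?case by (simp add: mult_ac)
  qed simp
  have "(n choose w) * fact w \<le> n ^ w" by (rule binomial_fact_pow)
  then have "real ((n choose w) * fact w) \<le> real (n ^ w)" by (simp only: of_nat_le_iff)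
  then have "real (n choose w) * fact w \<le> real n ^ w" by simp
  then have *: "real (n choose w) * fact w * exp 1 ^ w \<le> real n ^ w * exp 1 ^ w"
    by (rule mult_right_mono) simp
  have "real (n choose w) * real w ^ w \<le> real (n choose w) * (exp 1 ^ w * fact w)"
    using fact by (rule mult_left_mono) simp
  also have "\<dots> = real (n choose w) * fact w * exp 1 ^ w" by (simp only: mult_ac)
  also note *
  also have "real n ^ w * exp 1 ^ w = (exp 1 * real n) ^ w" by (simp only: power_mult_distrib mult.commute)
  finally have "real (n choose w) * real w ^ w \<le> (exp 1 * real n) ^ w" .
  then show ?thesis using w by (simp add: power_divide pos_le_divide_eq)
qed

text \<open>The right-hand side is the Chernoff rate per edge for a set of relative size y to be
  denser by a factor 1/y. It vanishes to second order at y = 1, so y has to stay away from 1. With r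
  = sqrt y and ln r \<le> r - 1 it is at least (1 - r)^2; as r \<le> 995/1000, this is at least
  1/40000, and 1/50000 leaves room for the logarithm on the left.\<close>

lemma entropy_bound:
  fixes y :: real
  assumes y: "0 < y" "y \<le> 99 / 100"
  shows "(1 - ln y) / 50000 \<le> - ln y - 1 + y"
proof -
  define r where "r = sqrt y"
  have r: "r > 0" "r * r = y" using y by (auto simp: r_def)
  have "r * r \<le> (995 / 1000) * (995 / 1000)" using y r by simp
  then have r2: "r \<le> 995 / 1000" using r(1) by (meson mult_strict_mono not_le less_imp_le zero_le_numeral zero_le_divide_iff)
  have "ln y = 2 * ln r" using y by (simp add: r_def ln_sqrt)
  moreover have "ln r \<le> r - 1" using r(1) by (rule ln_le_minus_one)
  ultimately have ly: "- ln y \<ge> 2 * (1 - r)" by simp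
  have "(1 - r) * (1 - r - 2 / 50000) \<ge> (5 / 1000) * (5 / 1000 - 2 / 50000)"
    using r2 by (intro mult_mono) auto
  moreover have "(1 - 1 / 50000) * (2 * (1 - r)) - 1 + r * r = (1 - r) * (1 - r - 2 / 50000)"
    by (simp add: field_simps)
  moreover have "1 / 50000 \<le> (5 / 1000) * (5 / 1000 - 2 / 50000 :: real)" by simp
  ultimately have "(1 - 1 / 50000) * (2 * (1 - r)) - 1 + r * r \<ge> 1 / 50000" by linarith
  moreover have "(1 - 1 / 50000) * (2 * (1 - r)) \<le> (1 - 1 / 50000) * (- ln y)"
    using ly by (intro mult_left_mono) auto
  ultimately have "(1 - 1 / 50000) * (- ln y) - 1 + y \<ge> 1 / 50000" using r(2) by linarith
  then show ?thesis by (simp add: field_simps)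
qed

text \<open>The quadratic Taylor bound is precise enough only near 0, hence the eighth power of exp
  (1/8).\<close>

lemma exp_minus_1_le: "1 - exp (- 1 :: real) \<ge> 63 / 100"
proof -
  have "1 + 1 / 8 + (1 / 8)\<^sup>2 / 2 \<le> exp (1 / 8 :: real)" by (rule exp_lower_Taylor_quadratic) simp
  then have "(1 + 1 / 8 + (1 / 8)\<^sup>2 / 2) ^ 8 \<le> exp (1 / 8 :: real) ^ 8" by (rule power_mono) simp
  also have "\<dots> = exp 1" by (simp flip: exp_of_nat_mult)
  finally have "100 / 37 \<le> exp (1::real)" by (simp add: power2_eq_square power_divide)
  then have "inverse (exp (1::real)) \<le> inverse (100 / 37)" by (rule le_imp_inverse_le) simp
  then show ?thesis by (simp add: exp_minus)
qed

lemma dense_set_prob: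
  assumes n: "n \<ge> 2" and m: "m \<le> n choose 2" and mn: "real m \<ge> 600000 * real n"
  shows "subset_prob (all_edges n) m (\<lambda>A. \<exists>W\<subseteq>{0..<n}. W \<noteq> {} \<and> 100 * card W \<le> 99 * n \<and>
      m * (card W - 1) < card (inner_edges A W) * (n - 1)) \<le> real n * exp (- 5 * ln (real n))"
proof -
  let ?L = "ln (real n)"
  let ?\<W> = "{W. W \<subseteq> {0..<n} \<and> 2 \<le> card W \<and> 100 * card W \<le> 99 * n}"
  have n1: "real (n - 1) = real n - 1" using n by (simp add: of_nat_diff)
  have mN: "m \<le> card (all_edges n)" using m by (simp add: card_all_edges)
  define b where "b W = exp (- real (card W) * (1 + ln (real n / real (card W))) - 5 * ?L)" for W :: "nat set"
  have single: "subset_prob (all_edges n) m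
      (\<lambda>A. real m * (real (card W) - 1) / (real n - 1) \<le> real (card (A \<inter> inner_edges (all_edges n) W))) \<le> b W"
    if W: "W \<in> ?\<W>" for W
  proof -
    define w where "w = card W"
    have w: "2 \<le> w" "100 * w \<le> 99 * n" "W \<subseteq> {0..<n}" using W by (auto simp: w_def)
    have wr: "real w \<ge> 2" "real w > 0" "real w \<le> 99 / 100 * real n" using w by linarith+
    define x where "x = real n / real w"
    have x: "x > 1" using wr by (simp add: x_def)
    define a where "a = real m * (real w - 1) / (real n - 1)"
    have cW: "real (card (inner_edges (all_edges n) W)) = real w * (real w - 1) / 2"
      using card_inner_all_edges[OF w(3)] by (simp add: real_choose_2 w_def)
    \<comment> \<open>The level \<open>a\<close> is x = n / w times the mean number of edges inside
      \<open>W\<close>, so \<open>ln x\<close> is the optimal tilt and the exponent becomes a (ln x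
      - 1 + 1/x).\<close>
    have "subset_prob (all_edges n) m (\<lambda>A. a \<le> real (card (A \<inter> inner_edges (all_edges n) W)))
      \<le> exp ((exp (ln x) - 1) * (real m / real (card (all_edges n))) * real (card (inner_edges (all_edges n) W)) - ln x * a)"
      using mN x by (intro subset_prob_upper_tail) (auto simp: inner_edges_def)
    also have "(exp (ln x) - 1) * (real m / real (card (all_edges n))) * real (card (inner_edges (all_edges n) W)) - ln x * a
      = - (a * (ln x - 1 + 1 / x))"
    proof -
      have e: "exp (ln x) = x" using x by simp
      have "(x - 1) * (real m / real (card (all_edges n))) * real (card (inner_edges (all_edges n) W)) = a * (1 - 1 / x)"
        unfolding cW card_all_edges real_choose_2 a_def x_def using wr n by (simp add: field_simps)
      then show ?thesis unfolding e by (simp add: algebra_simps)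
    qed
    also have "exp (- (a * (ln x - 1 + 1 / x))) \<le> b W"
    proof -
      have ent: "ln x - 1 + 1 / x \<ge> (1 + ln x) / 50000"
      proof -
        have "real w / real n > 0" "real w / real n \<le> 99 / 100" using wr n by (auto simp: divide_le_eq)
        then have "(1 - ln (real w / real n)) / 50000 \<le> - ln (real w / real n) - 1 + real w / real n"
          by (rule entropy_bound)
        moreover have "ln (real w / real n) = - ln x" unfolding x_def using wr n by (simp add: ln_div)
        moreover have "real w / real n = 1 / x" unfolding x_def by simp
        ultimately show ?thesis by simp
      qed
      have lx: "ln x > 0" using x by simp
      \<comment> \<open>Since w - 1 is at least w / 2, the constant 600000 = 2 * 6 * 50000 gives an
        exponent of at least 6 w (1 + ln x). One sixth pays for the at most (e n / w)^w sets of size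
        w; the other five yield the factor n^(-5), because w (1 + ln x) is at least ln n.\<close>
      have a: "a \<ge> 300000 * real w"
      proof -
        have "300000 * real w * (real n - 1) \<le> 300000 * real w * real n" by (intro mult_left_mono) auto
        also have "\<dots> = (600000 * real n) * (real w / 2)" by simp
        also have "\<dots> \<le> real m * (real w - 1)" using mn wr by (intro mult_mono) auto
        finally have "300000 * real w * (real n - 1) \<le> real m * (real w - 1)" .
        then show ?thesis unfolding a_def using n by (simp add: le_divide_eq)
      qed
      have "6 * (real w * (1 + ln x)) = (300000 * real w) * ((1 + ln x) / 50000)" by simp
      also have "\<dots> \<le> a * (ln x - 1 + 1 / x)" using a ent lx by (intro mult_mono) auto
      finally have "6 * (real w * (1 + ln x)) \<le> a * (ln x - 1 + 1 / x)" .
      moreover have "real w * (1 + ln x) \<ge> ?L"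
      proof -
        have lnx: "ln x = ?L - ln (real w)" unfolding x_def using wr n by (simp add: ln_div)
        have "(real w - 1) * ln (real w) \<le> (real w - 1) * ?L"
          using wr n by (intro mult_left_mono) auto
        moreover have "ln (real w) \<le> real w - 1" using wr by (intro ln_le_minus_one) auto
        ultimately show ?thesis unfolding lnx by (simp add: algebra_simps)
      qed
      ultimately have "real w * (1 + ln x) + 5 * ?L \<le> a * (ln x - 1 + 1 / x)" by linarith
      then show ?thesis unfolding b_def w_def[symmetric] x_def[symmetric] by simp
    qed
    finally show ?thesis unfolding a_def w_def .
  qed
  have "subset_prob (all_edges n) m (\<lambda>A. \<exists>W\<subseteq>{0..<n}. W \<noteq> {} \<and> 100 * card W \<le> 99 * n \<and>
      m * (card W - 1) < card (inner_edges A W) * (n - 1))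
    \<le> subset_prob (all_edges n) m (\<lambda>A. \<exists>W\<in>?\<W>. real m * (real (card W) - 1) / (real n - 1) \<le>
      real (card (A \<inter> inner_edges (all_edges n) W)))"
  proof (rule subset_prob_mono)
    fix A assume A: "A \<subseteq> all_edges n"
      and "\<exists>W\<subseteq>{0..<n}. W \<noteq> {} \<and> 100 * card W \<le> 99 * n \<and>
        m * (card W - 1) < card (inner_edges A W) * (n - 1)"
    then obtain W where W: "W \<subseteq> {0..<n}" "W \<noteq> {}" "100 * card W \<le> 99 * n"
      "m * (card W - 1) < card (inner_edges A W) * (n - 1)" by blast
    have finW: "finite W" using W(1) finite_subset by blast
    then have W1: "1 \<le> card W" using W(2) by (simp add: Suc_le_eq card_gt_0_iff)
    have W2: "2 \<le> card W"
    proof (rule ccontr)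
      assume "\<not> 2 \<le> card W"
      then have "card W choose 2 = 0" by simp
      then have "card (inner_edges (all_edges n) W) = 0" using card_inner_all_edges[OF W(1)] by simp
      moreover have "card (inner_edges A W) \<le> card (inner_edges (all_edges n) W)"
        using A by (intro card_mono) (auto simp: inner_edges_def)
      ultimately show False using W(4) by simp
    qed
    have "real (m * (card W - 1)) \<le> real (card (inner_edges A W) * (n - 1))" using W(4) by (simp only: of_nat_le_iff less_imp_le)
    then have "real m * (real (card W) - 1) \<le> real (card (inner_edges A W)) * (real n - 1)"
      using W1 n1 by (simp add: of_nat_diff)
    then have "real m * (real (card W) - 1) / (real n - 1) \<le> real (card (inner_edges A W))"
      using n by (simp add: divide_le_eq)
    then show "\<exists>W\<in>?\<W>. real m * (real (card W) - 1) / (real n - 1) \<le>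
      real (card (A \<inter> inner_edges (all_edges n) W))"
      using W W2 inner_edges_Int[OF A] by (intro bexI[of _ W]) auto
  qed simp
  also have "\<dots> \<le> (\<Sum>W\<in>?\<W>. subset_prob (all_edges n) m (\<lambda>A. real m * (real (card W) - 1) / (real n - 1) \<le>
      real (card (A \<inter> inner_edges (all_edges n) W))))"
    using mN by (intro subset_prob_bex_le) auto
  also have "\<dots> \<le> (\<Sum>W\<in>?\<W>. b W)" by (rule sum_mono) (rule single)
  also have "\<dots> \<le> (\<Sum>W\<in>(\<Union>w\<in>{1..n}. subsets_of_size {0..<n} w). b W)"
  proof (rule sum_mono2)
    show "?\<W> \<subseteq> (\<Union>w\<in>{1..n}. subsets_of_size {0..<n} w)"
      by (auto simp: subsets_of_size_def)
  qed (auto simp: b_def)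
  also have "\<dots> = (\<Sum>w\<in>{1..n}. \<Sum>W\<in>subsets_of_size {0..<n} w. b W)"
    by (rule sum.UNION_disjoint) (auto simp: subsets_of_size_def)
  also have "\<dots> \<le> (\<Sum>w\<in>{1..n}. exp (- 5 * ?L))"
  proof (rule sum_mono)
    fix w assume w: "w \<in> {1..n}"
    have "(\<Sum>W\<in>subsets_of_size {0..<n} w. b W) =
      (\<Sum>W\<in>subsets_of_size {0..<n} w. exp (- real w * (1 + ln (real n / real w)) - 5 * ?L))"
      by (intro sum.cong) (auto simp: b_def subsets_of_size_def)
    also have "\<dots> = real (n choose w) * exp (- real w * (1 + ln (real n / real w)) - 5 * ?L)"
      by (simp add: card_subsets_of_size)
    also have "\<dots> \<le> (exp 1 * real n / real w) ^ w * exp (- real w * (1 + ln (real n / real w)) - 5 * ?L)"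
      using binomial_le_exp_pow[of w n] w by (intro mult_right_mono) auto
    also have "(exp 1 * real n / real w) ^ w = exp (real w * (1 + ln (real n / real w)))"
    proof -
      have "exp 1 * real n / real w = exp (1 + ln (real n / real w))" using w n by (simp add: exp_add)
      then show ?thesis by (simp add: exp_of_nat_mult)
    qed
    also have "exp (real w * (1 + ln (real n / real w))) * exp (- real w * (1 + ln (real n / real w)) - 5 * ?L) = exp (- 5 * ?L)"
      by (simp flip: exp_add)
    finally show "(\<Sum>W\<in>subsets_of_size {0..<n} w. b W) \<le> exp (- 5 * ?L)" .
  qed
  also have "\<dots> = real n * exp (- 5 * ?L)" by simp
  finally show ?thesis .
qed

text \<open>The part \<open>F0\<close> of \<open>F\<close> already present at time \<open>m0\<close>
  is prescribed exactly, so that \<open>F - F0\<close> must appear later and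
  \<open>ordering_prob_two_times\<close> applies; then the absence of \<open>F - F0\<close> is
  dropped. The at most 2^(card F) choices of \<open>F0\<close> double the base of the power.\<close>

lemma two_times_sparse_prob:
  assumes X: "finite X" and F: "F \<subseteq> X" and D: "D \<subseteq> X" and FD: "F \<inter> D = {}"
    and m: "m0 \<le> m1" "m1 \<le> card X" and s: "s \<ge> 0"
  shows "ordering_prob X (\<lambda>xs. F \<subseteq> set (take m1 xs) \<and> real (card (set (take m0 xs) \<inter> D)) \<le> a)
    \<le> (2 * (real m1 / real (card X))) ^ card F *
      exp (s * a - (1 - exp (- s)) * ((real m0 - real (card F)) / real (card X)) * real (card D))"
proof -
  let ?p = "real m1 / real (card X)"
  let ?e = "exp (s * a - (1 - exp (- s)) * ((real m0 - real (card F)) / real (card X)) * real (card D))"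
  let ?Q = "\<lambda>F0 A. F0 \<subseteq> A \<and> A \<inter> (F - F0) = {} \<and> real (card (A \<inter> D)) \<le> a"
  have finF: "finite F" using X F finite_subset by blast
  have "ordering_prob X (\<lambda>xs. F \<subseteq> set (take m1 xs) \<and> real (card (set (take m0 xs) \<inter> D)) \<le> a)
    \<le> ordering_prob X (\<lambda>xs. \<exists>F0\<in>Pow F. ?Q F0 (set (take m0 xs)) \<and> F - F0 \<subseteq> set (take m1 xs))"
  proof (rule ordering_prob_mono[OF X])
    fix xs assume "F \<subseteq> set (take m1 xs) \<and> real (card (set (take m0 xs) \<inter> D)) \<le> a"
    then show "\<exists>F0\<in>Pow F. ?Q F0 (set (take m0 xs)) \<and> F - F0 \<subseteq> set (take m1 xs)"
      by (intro bexI[of _ "F \<inter> set (take m0 xs)"]) auto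
  qed
  also have "\<dots> \<le> (\<Sum>F0\<in>Pow F. ordering_prob X (\<lambda>xs. ?Q F0 (set (take m0 xs)) \<and> F - F0 \<subseteq> set (take m1 xs)))"
    using finF by (intro ordering_prob_bex_le) auto
  also have "\<dots> \<le> (\<Sum>F0\<in>Pow F. ?p ^ card F * ?e)"
  proof (rule sum_mono)
    fix F0 assume "F0 \<in> Pow F"
    then have F0: "F0 \<subseteq> F" by simp
    have finF0: "finite F0" using F0 finF finite_subset by blast
    have cF: "card (F - F0) + card F0 = card F"
      using F0 finF finF0 by (simp add: card_Diff_subset card_mono)
    have "ordering_prob X (\<lambda>xs. ?Q F0 (set (take m0 xs)) \<and> F - F0 \<subseteq> set (take m1 xs))
      \<le> ?p ^ card (F - F0) * subset_prob X m0 (?Q F0)"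
      using F m by (intro ordering_prob_two_times[OF X]) auto
    also have "\<dots> \<le> ?p ^ card (F - F0) * subset_prob X m0 (\<lambda>A. F0 \<subseteq> A \<and> real (card (A \<inter> D)) \<le> a)"
      using X by (intro mult_left_mono subset_prob_mono) auto
    also have "\<dots> \<le> ?p ^ card (F - F0) * ((real m0 / real (card X)) ^ card F0 *
      exp (s * a - (1 - exp (- s)) * ((real m0 - real (card F0)) / real (card X)) * real (card D)))"
      using F0 F D FD m s by (intro mult_left_mono subset_prob_superset_lower_tail[OF X]) auto
    also have "\<dots> \<le> ?p ^ card (F - F0) * (?p ^ card F0 * ?e)"
    proof (intro mult_left_mono mult_mono)
      show "(real m0 / real (card X)) ^ card F0 \<le> ?p ^ card F0"
        using m by (intro power_mono divide_right_mono) auto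
      have "(real m0 - real (card F)) / real (card X) \<le> (real m0 - real (card F0)) / real (card X)"
        using cF by (intro divide_right_mono) auto
      then have "(1 - exp (- s)) * ((real m0 - real (card F)) / real (card X)) * real (card D) \<le>
        (1 - exp (- s)) * ((real m0 - real (card F0)) / real (card X)) * real (card D)"
        using s by (intro mult_right_mono mult_left_mono) auto
      then show "exp (s * a - (1 - exp (- s)) * ((real m0 - real (card F0)) / real (card X)) * real (card D)) \<le> ?e"
        by simp
    qed auto
    also have "\<dots> = ?p ^ card F * ?e" unfolding cF[symmetric] power_add by simp
    finally show "ordering_prob X (\<lambda>xs. ?Q F0 (set (take m0 xs)) \<and> F - F0 \<subseteq> set (take m1 xs)) \<le> ?p ^ card F * ?e" .
  qed
  also have "\<dots> = (2 * ?p) ^ card F * ?e"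
    unfolding power_mult_distrib[of 2 ?p] using finF by (simp add: card_Pow)
  finally show ?thesis .
qed

text \<open>Here \<open>12474 / 10000 = (63 / 100) * (198 / 100)\<close>, where \<open>63 / 100\<close> bounds \<open>1 - exp (- 1)\<close> and
  \<open>198 / 100\<close> comes from \<open>2 * (n - card U) \<ge> (198 / 100) * n\<close>.\<close>
lemma small_cut_prob:
  assumes n: "n \<ge> 2" and m: "m0 \<le> m1" "m1 \<le> n choose 2" "n \<le> m1"
    and rate: "(real m0 / real n - 1 / 100) * (12474 / 10000) \<ge> real t + \<gamma>" and m0: "real m0 \<ge> real n"
  shows "proc_prob n (\<lambda>xs. \<exists>U\<subseteq>{0..<n}. 2 \<le> card U \<and> 100 * card U \<le> n \<and>
      (card U + 1) div 2 \<le> card (inner_edges (proc_graph xs m1) U) \<and>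
      card (edge_cut (proc_graph xs m0) U) \<le> t * card U)
    \<le> (\<Sum>u\<in>{1..n}. (exp 1 * sqrt (real n) * (4 * exp 1 * (real m1 / (real n - 1))) * exp (- \<gamma>)) ^ u)"
proof -
  let ?X = "all_edges n"
  let ?\<U> = "{U. U \<subseteq> {0..<n} \<and> 2 \<le> card U \<and> 100 * card U \<le> n}"
  define f where "f U = (card U + 1) div 2" for U :: "nat set"
  define y where "y = exp 1 * sqrt (real n) * (4 * exp 1 * (real m1 / (real n - 1))) * exp (- \<gamma>)"
  \<comment> \<open>Normalised by the bound (e n / u)^u on the number of sets of size u, so that all
    sets of that size together contribute at most y^u.\<close>
  define b where "b U = y ^ card U / (exp 1 * real n / real (card U)) ^ card U" for U :: "nat set"
  have cX: "card ?X = n choose 2" by (rule card_all_edges)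
  have y0: "y \<ge> 0" unfolding y_def using n by simp
  have single: "proc_prob n (\<lambda>xs. \<exists>F\<in>subsets_of_size (inner_edges ?X U) (f U).
      F \<subseteq> set (take m1 xs) \<and> real (card (set (take m0 xs) \<inter> edge_cut ?X U)) \<le> real (t * card U)) \<le> b U"
    if U: "U \<in> ?\<U>" for U
  proof -
    define u where "u = card U"
    have u: "2 \<le> u" "100 * u \<le> n" "U \<subseteq> {0..<n}" using U by (auto simp: u_def)
    have ur: "real u \<ge> 2" "real u \<le> real n / 100" using u by linarith+
    define g where "g = f U"
    have g: "u \<le> 2 * g" "g \<le> u" "g > 0" using u by (auto simp: g_def f_def u_def)
    have sub: "inner_edges ?X U \<subseteq> ?X" "edge_cut ?X U \<subseteq> ?X" "inner_edges ?X U \<inter> edge_cut ?X U = {}"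
      by (auto simp: inner_edges_def edge_cut_def)
    have finI: "finite (inner_edges ?X U)" using sub(1) by (rule finite_subset) simp
    let ?p = "real m1 / real (card ?X)"
    have cut: "real (card (edge_cut ?X U)) = real u * (real n - real u)"
      using card_edge_cut_all_edges[OF u(3)] u by (simp add: u_def of_nat_diff)
    \<comment> \<open>The Chernoff exponent at tilt 1. The chosen inner edges take \<open>g\<close>
      from the \<open>m0\<close> draws, and \<open>g \<le> u\<close> is at most n / 100: this is the
      1/100 in \<open>rate\<close>.\<close>
    have expo: "1 * real (t * card U) - (1 - exp (- 1)) * ((real m0 - real g) / real (card ?X)) * real (card (edge_cut ?X U))
      \<le> - \<gamma> * real u"
    proof -
      have mg: "real m0 - real g \<ge> real n * (real m0 / real n - 1 / 100)" "real m0 - real g \<ge> 0"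
        using g ur m0 n by (auto simp: field_simps)
      have "(63 / 100) * (198 / 100) * (real m0 / real n - 1 / 100) * real u
        = (63 / 100) * ((real n * (real m0 / real n - 1 / 100)) * ((198 / 100) / real n) * real u)"
        using n by simp
      also have "\<dots> \<le> (1 - exp (- 1)) * ((real m0 - real g) * (2 * (real n - real u) / (real n * (real n - 1))) * real u)"
      proof -
        have "100 * real u \<le> real n" using ur(2) by simp
        then have "(198 / 100) * (real n - 1) \<le> 2 * (real n - real u)" by (simp add: field_simps)
        then have "(198 / 100) * (real n - 1) / (real n * (real n - 1)) \<le> 2 * (real n - real u) / (real n * (real n - 1))"
          using n by (intro divide_right_mono) auto
        then have r: "(198 / 100) / real n \<le> 2 * (real n - real u) / (real n * (real n - 1))"
          using n nonzero_mult_divide_mult_cancel_right[of "real n - 1" "198 / 100" "real n"] by simp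
        have nn: "0 \<le> real n * (real m0 / real n - 1 / 100)" using m0 n by (simp add: field_simps)
        have "(real n * (real m0 / real n - 1 / 100)) * ((198 / 100) / real n) \<le>
          (real m0 - real g) * (2 * (real n - real u) / (real n * (real n - 1)))"
          using mg r nn by (intro mult_mono) auto
        then have "(real n * (real m0 / real n - 1 / 100)) * ((198 / 100) / real n) * real u \<le>
          (real m0 - real g) * (2 * (real n - real u) / (real n * (real n - 1))) * real u"
          by (rule mult_right_mono) simp
        moreover have "0 \<le> (real n * (real m0 / real n - 1 / 100)) * ((198 / 100) / real n) * real u"
          by (rule mult_nonneg_nonneg[OF mult_nonneg_nonneg[OF nn]]) simp_all
        ultimately show ?thesis by (intro mult_mono[OF exp_minus_1_le]) simp_all
      qed
      also have "\<dots> = (1 - exp (- 1)) * ((real m0 - real g) / real (card ?X)) * real (card (edge_cut ?X U))"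
      proof -
        have "a * (2 * b / d) * c = a / (d / 2) * (c * b)" for a b c d :: real by simp
        then show ?thesis unfolding cut cX real_choose_2 by (simp only: mult.assoc)
      qed
      finally have le: "(63 / 100) * (198 / 100) * (real m0 / real n - 1 / 100) * real u
        \<le> (1 - exp (- 1)) * ((real m0 - real g) / real (card ?X)) * real (card (edge_cut ?X U))" .
      have "(real t + \<gamma>) * real u \<le> (real m0 / real n - 1 / 100) * (12474 / 10000) * real u"
        using rate by (intro mult_right_mono) auto
      then have "real t * real u + \<gamma> * real u \<le> (63 / 100) * (198 / 100) * (real m0 / real n - 1 / 100) * real u"
        by (simp add: algebra_simps)
      then show ?thesis using le unfolding u_def[symmetric] by simp
    qed
    have "proc_prob n (\<lambda>xs. \<exists>F\<in>subsets_of_size (inner_edges ?X U) (f U).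
      F \<subseteq> set (take m1 xs) \<and> real (card (set (take m0 xs) \<inter> edge_cut ?X U)) \<le> real (t * card U))
      \<le> (\<Sum>F\<in>subsets_of_size (inner_edges ?X U) (f U). ordering_prob ?X (\<lambda>xs.
      F \<subseteq> set (take m1 xs) \<and> real (card (set (take m0 xs) \<inter> edge_cut ?X U)) \<le> real (t * card U)))"
      unfolding proc_prob_eq using finI by (intro ordering_prob_bex_le) auto
    also have "\<dots> \<le> (\<Sum>F\<in>subsets_of_size (inner_edges ?X U) (f U). (2 * ?p) ^ g * exp (- \<gamma> * real u))"
    proof (rule sum_mono)
      fix F assume "F \<in> subsets_of_size (inner_edges ?X U) (f U)"
      then have F: "F \<subseteq> inner_edges ?X U" "card F = g" by (auto simp: subsets_of_size_def g_def)
      have "ordering_prob ?X (\<lambda>xs. F \<subseteq> set (take m1 xs) \<and>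
        real (card (set (take m0 xs) \<inter> edge_cut ?X U)) \<le> real (t * card U)) \<le>
        (2 * ?p) ^ card F * exp (1 * real (t * card U) -
          (1 - exp (- 1)) * ((real m0 - real (card F)) / real (card ?X)) * real (card (edge_cut ?X U)))"
        using F sub m cX by (intro two_times_sparse_prob) auto
      also have "\<dots> \<le> (2 * ?p) ^ g * exp (- \<gamma> * real u)"
        unfolding F(2) using expo by (intro mult_left_mono) auto
      finally show "ordering_prob ?X (\<lambda>xs. F \<subseteq> set (take m1 xs) \<and>
        real (card (set (take m0 xs) \<inter> edge_cut ?X U)) \<le> real (t * card U)) \<le> (2 * ?p) ^ g * exp (- \<gamma> * real u)" .
    qed
    also have "\<dots> = real ((u choose 2) choose g) * ((2 * ?p) ^ g * exp (- \<gamma> * real u))"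
      using finI card_inner_all_edges[OF u(3)] by (simp add: card_subsets_of_size u_def g_def)
    \<comment> \<open>There are \<open>u choose 2\<close> possible inner edges, and g \<ge> u/2
      makes this at most u g.\<close>
    also have "\<dots> \<le> (exp 1 * real u) ^ g * ((2 * ?p) ^ g * exp (- \<gamma> * real u))"
    proof (rule mult_right_mono)
      have "real ((u choose 2) choose g) \<le> (exp 1 * real (u choose 2) / real g) ^ g"
        using g by (intro binomial_le_exp_pow)
      also have "\<dots> \<le> (exp 1 * real u) ^ g"
      proof (rule power_mono)
        have "real (u choose 2) \<le> real u * real g"
        proof -
          have "real u * (real u - 1) / 2 \<le> real u * (real u / 2)" by (simp add: field_simps)
          also have "\<dots> \<le> real u * real g" using g by (intro mult_left_mono) auto
          finally show ?thesis unfolding real_choose_2 .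
        qed
        then show "exp 1 * real (u choose 2) / real g \<le> exp 1 * real u" using g by (simp add: divide_le_eq mult.assoc)
      qed simp
      finally show "real ((u choose 2) choose g) \<le> (exp 1 * real u) ^ g" .
    qed simp
    also have "\<dots> \<le> b U"
    proof -
      \<comment> \<open>Each chosen edge contributes a factor z u / n. As z \<ge> 1 and u \<le> n,
        the bounds u/2 \<le> g \<le> u allow z^g to be raised to z^u and (u/n)^g to
        (u/n)^(u/2).\<close>
      define z where "z = 4 * exp 1 * (real m1 / (real n - 1))"
      have z1: "z \<ge> 1"
      proof -
        have "1 \<le> real m1 / (real n - 1)" using m(3) n by (simp add: le_divide_eq)
        moreover have "(1::real) \<le> 4 * exp 1" using exp_ge_add_one_self[of 1] by linarith
        ultimately show ?thesis unfolding z_def using mult_mono[of 1 "4 * exp 1" 1 "real m1 / (real n - 1)"] by simp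
      qed
      have zr: "exp 1 * real u * (2 * ?p) = z * (real u / real n)"
        unfolding z_def cX real_choose_2 using n by (simp add: field_simps)
      have rn: "0 \<le> real u / real n" "real u / real n \<le> 1" using ur n by (auto simp: divide_le_eq)
      have "(exp 1 * real u) ^ g * (2 * ?p) ^ g = z ^ g * (real u / real n) ^ g"
        unfolding power_mult_distrib[symmetric] zr ..
      also have "\<dots> \<le> z ^ u * sqrt (real u / real n) ^ u"
      proof (rule mult_mono)
        show "z ^ g \<le> z ^ u" using g z1 by (intro power_increasing) auto
        have "(real u / real n) ^ g = sqrt (real u / real n) ^ (2 * g)"
          unfolding power_mult using rn by simp
        also have "\<dots> \<le> sqrt (real u / real n) ^ u" using g rn by (intro power_decreasing) auto
        finally show "(real u / real n) ^ g \<le> sqrt (real u / real n) ^ u" .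
      qed (use z1 rn in auto)
      finally have "(exp 1 * real u) ^ g * ((2 * ?p) ^ g * exp (- \<gamma> * real u)) \<le>
        z ^ u * sqrt (real u / real n) ^ u * exp (- \<gamma> * real u)"
        by (simp add: mult.assoc[symmetric] mult_right_mono)
      also have "\<dots> = (z * sqrt (real u / real n) * exp (- \<gamma>)) ^ u"
        by (simp add: power_mult_distrib exp_of_nat_mult[symmetric] mult.commute)
      also have "\<dots> \<le> (y / (exp 1 * real n / real u)) ^ u"
      proof (rule power_mono)
        \<comment> \<open>Only half a factor u / n per vertex is available, whereas choosing the set
          costs n / u. The rest is estimated by sqrt n, which is why \<gamma> has to exceed (ln n) /
          2.\<close>
        have "sqrt (real u / real n) \<le> sqrt (real n) * (real u / real n)"
        proof -
          have "real u / real n \<le> real n * (real u / real n)\<^sup>2"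
            using ur n by (simp add: field_simps power2_eq_square)
          then have "sqrt (real u / real n) \<le> sqrt (real n * (real u / real n)\<^sup>2)" by (rule real_sqrt_le_mono)
          then show ?thesis using rn by (simp add: real_sqrt_mult)
        qed
        then have "z * sqrt (real u / real n) * exp (- \<gamma>) \<le> z * (sqrt (real n) * (real u / real n)) * exp (- \<gamma>)"
          using z1 by (intro mult_right_mono mult_left_mono) auto
        also have "\<dots> = y / (exp 1 * real n / real u)"
          unfolding y_def z_def[symmetric] using ur n by (simp add: field_simps)
        finally show "z * sqrt (real u / real n) * exp (- \<gamma>) \<le> y / (exp 1 * real n / real u)" .
      qed (use z1 rn in auto)
      also have "\<dots> = b U" unfolding b_def u_def by (rule power_divide)
      finally show ?thesis .
    qed
    finally show ?thesis .
  qed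
  have "proc_prob n (\<lambda>xs. \<exists>U\<subseteq>{0..<n}. 2 \<le> card U \<and> 100 * card U \<le> n \<and>
      (card U + 1) div 2 \<le> card (inner_edges (proc_graph xs m1) U) \<and>
      card (edge_cut (proc_graph xs m0) U) \<le> t * card U)
    \<le> proc_prob n (\<lambda>xs. \<exists>U\<in>?\<U>. \<exists>F\<in>subsets_of_size (inner_edges ?X U) (f U).
      F \<subseteq> set (take m1 xs) \<and> real (card (set (take m0 xs) \<inter> edge_cut ?X U)) \<le> real (t * card U))"
  proof (rule proc_prob_mono)
    fix xs assume xs: "xs \<in> permutations_of_set ?X"
      and "\<exists>U\<subseteq>{0..<n}. 2 \<le> card U \<and> 100 * card U \<le> n \<and>
      (card U + 1) div 2 \<le> card (inner_edges (proc_graph xs m1) U) \<and>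
      card (edge_cut (proc_graph xs m0) U) \<le> t * card U"
    then obtain U where U: "U \<in> ?\<U>" "f U \<le> card (inner_edges (proc_graph xs m1) U)"
      "card (edge_cut (proc_graph xs m0) U) \<le> t * card U" unfolding f_def by blast
    obtain F where F: "F \<subseteq> inner_edges (proc_graph xs m1) U" "card F = f U"
      by (rule obtain_subset_with_card_n[OF U(2)]) blast
    have "F \<in> subsets_of_size (inner_edges ?X U) (f U)"
      using F proc_graph_subset[OF xs, of m1] by (auto simp: subsets_of_size_def inner_edges_def)
    moreover have "F \<subseteq> set (take m1 xs)" using F by (auto simp: inner_edges_def proc_graph_def)
    moreover have "set (take m0 xs) \<inter> edge_cut ?X U = edge_cut (proc_graph xs m0) U"
      using edge_cut_Int[OF proc_graph_subset[OF xs, of m0]] by (simp add: proc_graph_def)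
    then have "real (card (set (take m0 xs) \<inter> edge_cut ?X U)) \<le> real (t * card U)"
      using U(3) by (simp only: of_nat_le_iff)
    ultimately show "\<exists>U\<in>?\<U>. \<exists>F\<in>subsets_of_size (inner_edges ?X U) (f U).
      F \<subseteq> set (take m1 xs) \<and> real (card (set (take m0 xs) \<inter> edge_cut ?X U)) \<le> real (t * card U)"
      using U(1) by blast
  qed
  also have "\<dots> \<le> (\<Sum>U\<in>?\<U>. proc_prob n (\<lambda>xs. \<exists>F\<in>subsets_of_size (inner_edges ?X U) (f U).
      F \<subseteq> set (take m1 xs) \<and> real (card (set (take m0 xs) \<inter> edge_cut ?X U)) \<le> real (t * card U)))"
    by (rule proc_prob_bex_le) simp
  also have "\<dots> \<le> (\<Sum>U\<in>?\<U>. b U)" by (rule sum_mono) (rule single)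
  also have "\<dots> \<le> (\<Sum>U\<in>(\<Union>u\<in>{1..n}. subsets_of_size {0..<n} u). b U)"
  proof (rule sum_mono2)
    show "?\<U> \<subseteq> (\<Union>u\<in>{1..n}. subsets_of_size {0..<n} u)"
      by (auto simp: subsets_of_size_def)
    show "0 \<le> b U" for U unfolding b_def using y0 by simp
  qed simp
  also have "\<dots> = (\<Sum>u\<in>{1..n}. \<Sum>U\<in>subsets_of_size {0..<n} u. b U)"
    by (rule sum.UNION_disjoint) (auto simp: subsets_of_size_def)
  also have "\<dots> \<le> (\<Sum>u\<in>{1..n}. y ^ u)"
  proof (rule sum_mono)
    fix u assume u: "u \<in> {1..n}"
    have "(\<Sum>U\<in>subsets_of_size {0..<n} u. b U) =
      (\<Sum>U\<in>subsets_of_size {0..<n} u. y ^ u / (exp 1 * real n / real u) ^ u)"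
      by (intro sum.cong) (auto simp: b_def subsets_of_size_def)
    also have "\<dots> = real (n choose u) * (y ^ u / (exp 1 * real n / real u) ^ u)"
      by (simp add: card_subsets_of_size)
    also have "\<dots> \<le> (exp 1 * real n / real u) ^ u * (y ^ u / (exp 1 * real n / real u) ^ u)"
      using binomial_le_exp_pow[of u n] u y0 by (intro mult_right_mono) auto
    also have "\<dots> = y ^ u" using u n by simp
    finally show "(\<Sum>U\<in>subsets_of_size {0..<n} u. b U) \<le> y ^ u" .
  qed
  finally show ?thesis unfolding y_def .
qed

text \<open>The constants are chosen such that, for \<open>t \<le> 27 / 10 * ln n\<close>, at time \<open>time_lo n t\<close> the expected number
  of vertices of degree below \<open>t\<close> is at least \<open>n powr (1 / 10)\<close>, up to logarithmic factors, and less than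
  \<open>n powr (1 / 2)\<close>: then such vertices exist, but no two of them are joined by an edge.\<close>
definition time_lo :: "nat \<Rightarrow> nat \<Rightarrow> nat" where
  "time_lo n t = (if real t \<le> 27 / 10 * ln (real n)
    then nat \<lceil>real n * (9 / 20 * ln (real n) + 5 / 6 * real t)\<rceil> else t * (n - 1))"

text \<open>At 4 n (ln n + t) edges the average degree is 8 (ln n + t), so a Chernoff bound at tilt
  1 puts the minimum degree above t with much to spare. For large t this would exceed the number of
  edges; the complete graph then takes over.\<close>

definition time_hi :: "nat \<Rightarrow> nat \<Rightarrow> nat" where
  "time_hi n t = min (n choose 2) (nat \<lceil>4 * real n * (ln (real n) + real t)\<rceil>)"

text \<open>27/10 ln n is the value of \<open>t\<close> at which 9/20 ln n + 5/6 t equals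
  \<open>t\<close>, so below it the first formula exceeds t n and above it t n is larger. The 1/2
  makes one lower bound valid in both cases: t (n - 1) falls short of t n by \<open>t\<close>, which
  is at most n / 2.\<close>

lemma times:
  "\<forall>\<^sub>F n in sequentially. \<forall>t. 1 \<le> t \<longrightarrow> 2 * t \<le> n \<longrightarrow>
    t * (n - 1) \<le> time_lo n t \<and> time_lo n t \<le> time_hi n t \<and>
    real n * (9 / 20 * ln (real n) + 5 / 6 * real t - 1 / 2) \<le> real (time_lo n t)"
proof -
  have "\<forall>\<^sub>F n in sequentially. ln (real n) \<ge> 1"
    and "\<forall>\<^sub>F n in sequentially. real n * (27 / 10 * ln (real n)) + 1 \<le> real n * (real n - 1) / 2"
    and "\<forall>\<^sub>F n in sequentially. real n \<ge> 2"
    by real_asymp+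
  then show ?thesis
  proof eventually_elim
    fix n :: nat
    let ?L = "ln (real n)"
    assume L: "?L \<ge> 1" and big: "real n * (27 / 10 * ?L) + 1 \<le> real n * (real n - 1) / 2" and n: "real n \<ge> 2"
    have n1: "real (n - 1) = real n - 1" using n by (simp add: of_nat_diff)
    show "\<forall>t. 1 \<le> t \<longrightarrow> 2 * t \<le> n \<longrightarrow>
      t * (n - 1) \<le> time_lo n t \<and> time_lo n t \<le> time_hi n t \<and>
      real n * (9 / 20 * ?L + 5 / 6 * real t - 1 / 2) \<le> real (time_lo n t)"
    proof (intro allI impI)
      fix t assume t: "1 \<le> t" "2 * t \<le> n"
      have rt: "real t \<ge> 1" "2 * real t \<le> real n" using t by linarith+
      show "t * (n - 1) \<le> time_lo n t \<and> time_lo n t \<le> time_hi n t \<and>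
        real n * (9 / 20 * ?L + 5 / 6 * real t - 1 / 2) \<le> real (time_lo n t)"
      proof (cases "real t \<le> 27 / 10 * ?L")
        case True
        define x where "x = real n * (9 / 20 * ?L + 5 / 6 * real t)"
        have lo: "time_lo n t = nat \<lceil>x\<rceil>" using True by (simp add: time_lo_def x_def)
        have x0: "0 \<le> x" using L by (simp add: x_def)
        have lox: "x \<le> real (time_lo n t)" "real (time_lo n t) \<le> x + 1" unfolding lo using x0 by linarith+
        have "real t * (real n - 1) \<le> real n * real t" using rt by (simp add: algebra_simps)
        also have "\<dots> \<le> x" unfolding x_def using True by (intro mult_left_mono) auto
        finally have "real (t * (n - 1)) \<le> real (time_lo n t)" using lox n1 by simp
        then have 1: "t * (n - 1) \<le> time_lo n t" by (simp only: of_nat_le_iff)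
        have "x \<le> real n * (27 / 10 * ?L)" unfolding x_def using True by (intro mult_left_mono) auto
        then have "real (time_lo n t) \<le> real (n choose 2)" using lox big unfolding real_choose_2 by linarith
        then have 2: "time_lo n t \<le> n choose 2" by (simp only: of_nat_le_iff)
        have "x \<le> real n * (4 * (?L + real t))" unfolding x_def using L by (intro mult_left_mono) auto
        then have 3: "time_lo n t \<le> nat \<lceil>4 * real n * (?L + real t)\<rceil>"
          unfolding lo by (intro nat_mono ceiling_mono) (simp add: mult_ac)
        have "real n * (9 / 20 * ?L + 5 / 6 * real t - 1 / 2) \<le> x" unfolding x_def by (intro mult_left_mono) auto
        then show ?thesis using 1 2 3 lox unfolding time_hi_def by simp
      next
        case False
        then have lo: "time_lo n t = t * (n - 1)" by (simp add: time_lo_def)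
        have rlo: "real (time_lo n t) = real t * (real n - 1)" unfolding lo using n1 by simp
        have "real t * (real n - 1) \<le> real n / 2 * (real n - 1)" using rt n by (intro mult_right_mono) auto
        then have "real (time_lo n t) \<le> real (n choose 2)" unfolding rlo real_choose_2 by simp
        then have 2: "time_lo n t \<le> n choose 2" by (simp only: of_nat_le_iff)
        have "real (time_lo n t) \<le> 4 * real n * (?L + real t)"
        proof -
          have "real t * (real n - 1) \<le> (?L + real t) * real n" using L rt n by (intro mult_mono) auto
          also have "\<dots> \<le> (?L + real t) * (4 * real n)" using L rt by (intro mult_left_mono) auto
          finally show ?thesis unfolding rlo by (simp add: mult_ac)
        qed
        then have 3: "time_lo n t \<le> nat \<lceil>4 * real n * (?L + real t)\<rceil>" by linarith
        have "real n * (9 / 20 * ?L + 5 / 6 * real t - 1 / 2) \<le> real n * real t - real n / 2"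
        proof -
          have "real n * (9 / 20 * ?L + 5 / 6 * real t - 1 / 2) \<le> real n * (real t - 1 / 2)"
            using False by (intro mult_left_mono) auto
          then show ?thesis by (simp add: algebra_simps)
        qed
        also have "\<dots> \<le> real (time_lo n t)" unfolding rlo using rt by (simp add: algebra_simps)
        finally show ?thesis using 2 3 lo unfolding time_hi_def by simp
      qed
    qed
  qed
qed

section \<open>The bad events and the deterministic reduction to them\<close>

definition late_degree :: "nat \<Rightarrow> nat set list \<Rightarrow> nat \<Rightarrow> bool" where
  "late_degree n xs t \<longleftrightarrow> real t \<le> 27 / 10 * ln (real n) \<and> t \<le> min_degree n (proc_graph xs (time_lo n t))"

definition dense_set :: "nat \<Rightarrow> nat set list \<Rightarrow> nat \<Rightarrow> bool" where
  "dense_set n xs t \<longleftrightarrow> (\<exists>W\<subseteq>{0..<n}. W \<noteq> {} \<and> 100 * card W \<le> 99 * n \<and>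
    time_lo n t * (card W - 1) < card (inner_edges (proc_graph xs (time_lo n t)) W) * (n - 1))"

text \<open>Inner edges are counted at the late time and the cut at the early time, the weaker
  condition in both cases. Hence if the event fails, no such set exists at any time in
  between.\<close>

definition small_cut :: "nat \<Rightarrow> nat set list \<Rightarrow> nat \<Rightarrow> bool" where
  "small_cut n xs t \<longleftrightarrow> (\<exists>U\<subseteq>{0..<n}. 2 \<le> card U \<and> 100 * card U \<le> n \<and>
    (card U + 1) div 2 \<le> card (inner_edges (proc_graph xs (time_hi n t)) U) \<and>
    card (edge_cut (proc_graph xs (time_lo n t)) U) \<le> t * card U)"

definition low_degree :: "nat \<Rightarrow> nat set list \<Rightarrow> nat \<Rightarrow> bool" where
  "low_degree n xs t \<longleftrightarrow> min_degree n (proc_graph xs (time_hi n t)) < t"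

text \<open>The number of trees asked for at time \<open>m\<close> plays the role of
  \<open>t\<close>. Since t (n - 1) \<le> m is at most n (n - 1) / 2, only t \<le> n/2 occurs, and
  the single pair of times for this \<open>t\<close> serves every such \<open>m\<close>.\<close>

lemma tree_packing_eq_if_good:
  assumes n: "n \<ge> 2" and xs: "xs \<in> permutations_of_set (all_edges n)" and m: "m \<le> n choose 2"
    and times: "\<And>t. 1 \<le> t \<Longrightarrow> 2 * t \<le> n \<Longrightarrow> t * (n - 1) \<le> time_lo n t \<and> time_lo n t \<le> time_hi n t"
    and good: "\<And>t. 1 \<le> t \<Longrightarrow> 2 * t \<le> n \<Longrightarrow>
      \<not> late_degree n xs t \<and> \<not> dense_set n xs t \<and> \<not> small_cut n xs t \<and> \<not> low_degree n xs t"
  shows "tree_packing n (proc_graph xs m) = min (min_degree n (proc_graph xs m)) (m div (n - 1))"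
proof -
  let ?G = "proc_graph xs"
  define t where "t = min (min_degree n (?G m)) (m div (n - 1))"
  have sub: "?G i \<subseteq> all_edges n" for i using proc_graph_subset[OF xs] .
  have fin: "finite (?G i)" for i using sub by (rule finite_subset) simp
  have "partition_connected n t (?G m)"
  proof (cases "t = 0")
    case True
    then show ?thesis by (simp add: partition_connected_def)
  next
    case False
    have tm: "t * (n - 1) \<le> m"
    proof -
      have "t * (n - 1) \<le> m div (n - 1) * (n - 1)" by (intro mult_le_mono1) (simp add: t_def)
      then show ?thesis using div_times_less_eq_dividend order_trans by blast
    qed
    have "real (t * (n - 1)) \<le> real (n choose 2)" using tm m by (simp only: of_nat_le_iff)
    then have "real t * (real n - 1) \<le> real n / 2 * (real n - 1)" using n by (simp add: real_choose_2 of_nat_diff)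
    then have "real t \<le> real n / 2"
      using mult_right_le_imp_le[of "real t" "real n - 1" "real n / 2"] n by simp
    then have t: "1 \<le> t" "2 * t \<le> n" using False by linarith+
    note T = times[OF t] and good = good[OF t]
    let ?lo = "time_lo n t" and ?hi = "time_hi n t"
    have hiN: "?hi \<le> n choose 2" by (simp add: time_hi_def)
    then have cardlo: "card (?G ?lo) = ?lo" using T by (intro card_proc_graph[OF xs]) simp
    \<comment> \<open>For small \<open>t\<close> the degree condition holds at \<open>m\<close> but
      not yet at the early time; for large \<open>t\<close> the early time is the first at which
      there are enough edges at all.\<close>
    have lo: "?lo \<le> m"
    proof (cases "real t \<le> 27 / 10 * ln (real n)")
      case True
      show ?thesis
      proof (rule ccontr)
        assume "\<not> ?lo \<le> m"
        then have "min_degree n (?G m) \<le> min_degree n (?G ?lo)"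
          using n fin by (intro min_degree_mono proc_graph_mono) auto
        then have "t \<le> min_degree n (?G ?lo)" by (simp add: t_def)
        then show False using good True by (simp add: late_degree_def)
      qed
    next
      case False
      then show ?thesis using tm by (simp add: time_lo_def)
    qed
    have pc: "partition_connected n t (?G i)" if i: "?lo \<le> i" "i \<le> ?hi" "t \<le> min_degree n (?G i)" for i
    proof (rule partition_connectedI[OF sub proc_graph_mono[OF i(1)] n])
      show "t * (n - 1) \<le> card (?G ?lo)" using T cardlo by simp
      fix U assume U: "U \<subseteq> {0..<n}" "100 * card U \<le> n"
      show "t * card U \<le> card (edge_cut (?G i) U)"
      proof (rule edge_cut_lower_bound[OF sub _ i(3) _ U(1), where a = "n div 100"])
        fix U' assume U': "U' \<subseteq> {0..<n}" "2 \<le> card U'" "card U' \<le> n div 100"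
          "(card U' + 1) div 2 \<le> card (inner_edges (?G i) U')"
        have "card (inner_edges (?G i) U') \<le> card (inner_edges (?G ?hi) U')"
          using proc_graph_mono[OF i(2), of xs] fin by (intro card_mono) (auto simp: inner_edges_def)
        then have "(card U' + 1) div 2 \<le> card (inner_edges (?G ?hi) U')" using U'(4) by linarith
        moreover have "100 * card U' \<le> n" using U'(3) by linarith
        ultimately have "\<not> card (edge_cut (?G ?lo) U') \<le> t * card U'"
          using good U'(1,2) unfolding small_cut_def by blast
        moreover have "card (edge_cut (?G ?lo) U') \<le> card (edge_cut (?G i) U')"
          using proc_graph_mono[OF i(1), of xs] fin by (intro card_mono) (auto simp: edge_cut_def)
        ultimately show "t * card U' \<le> card (edge_cut (?G i) U')" by linarith
      qed (use n U(2) in auto)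
    next
      fix W assume W: "W \<subseteq> {0..<n}" "W \<noteq> {}" "100 * card W \<le> 99 * n"
      then have "\<not> ?lo * (card W - 1) < card (inner_edges (?G ?lo) W) * (n - 1)"
        using good unfolding dense_set_def by blast
      then show "card (inner_edges (?G ?lo) W) * (n - 1) \<le> card (?G ?lo) * (card W - 1)"
        unfolding cardlo by simp
    qed
    show ?thesis
    proof (cases "m \<le> ?hi")
      case True
      then show ?thesis using lo by (intro pc) (auto simp: t_def)
    next
      case False
      \<comment> \<open>Past the late time nothing new is estimated: the minimum degree has reached
        \<open>t\<close> by then, and partition connectivity is monotone.\<close>
      have "partition_connected n t (?G ?hi)" using T good by (intro pc) (auto simp: low_degree_def)
      then show ?thesis by (rule partition_connected_mono[OF _ proc_graph_mono fin]) (use False in simp)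
    qed
  qed
  then show ?thesis
    using tree_packing_eqI[OF sub n, of m] card_proc_graph[OF xs m] unfolding t_def by simp
qed

section \<open>The bad events are rare\<close>

lemma finite_half: "finite {t. 1 \<le> t \<and> 2 * t \<le> (n::nat)}"
  by (rule finite_subset[of _ "{1..n}"]) auto

lemma card_half: "card {t. 1 \<le> t \<and> 2 * t \<le> (n::nat)} \<le> n"
  using card_mono[of "{1..n}" "{t. 1 \<le> t \<and> 2 * t \<le> n}"] by force

lemma rare_late_degree: "rare (\<lambda>n xs. \<exists>t\<in>{t. 1 \<le> t \<and> 2 * t \<le> n}. late_degree n xs t)"
proof -
  define I where "I n = {t. 1 \<le> t \<and> 2 * t \<le> n \<and> real t \<le> 27 / 10 * ln (real n)}" for n
  define b where "b n = 2 * (27 / 10 * ln (real n)) * exp (9 / 10 * ln (real n) + 8) / real n + sm_err n" for n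
  have ev: "\<forall>\<^sub>F n in sequentially. 1 \<le> ln (real n) \<and> 2 \<le> real n"
    by (intro eventually_conj; real_asymp)
  have "rare (\<lambda>n xs. \<exists>t\<in>I n. t \<le> min_degree n (proc_graph xs (time_lo n t)))"
  proof (rule rare_bex)
    show "(\<lambda>n. 27 / 10 * ln (real n) * b n) \<longlonglongrightarrow> 0" unfolding b_def sm_err_def by real_asymp
    show "\<forall>\<^sub>F n in sequentially. finite (I n) \<and> real (card (I n)) \<le> 27 / 10 * ln (real n) \<and>
      (\<forall>t\<in>I n. proc_prob n (\<lambda>xs. t \<le> min_degree n (proc_graph xs (time_lo n t))) \<le> b n)"
      using ev min_degree_gt_prob times
    proof eventually_elim
      case (elim n)
      let ?L = "ln (real n)"
      have L: "?L \<ge> 1" and n: "real n \<ge> 2" using elim(1) by auto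
      have sub: "I n \<subseteq> {1..nat \<lfloor>27 / 10 * ?L\<rfloor>}" by (auto simp: I_def le_nat_floor)
      have "card (I n) \<le> nat \<lfloor>27 / 10 * ?L\<rfloor>" using card_mono[OF _ sub] by simp
      moreover have "real (nat \<lfloor>27 / 10 * ?L\<rfloor>) \<le> 27 / 10 * ?L" using L by (intro of_nat_floor) simp
      ultimately have cardI: "real (card (I n)) \<le> 27 / 10 * ?L" by linarith
      have "proc_prob n (\<lambda>xs. t \<le> min_degree n (proc_graph xs (time_lo n t))) \<le> b n" if t: "t \<in> I n" for t
      proof -
        let ?m = "time_lo n t"
        define k where "k = t - 1"
        have tk: "t = Suc k" using t by (simp add: k_def I_def)
        have rt: "real t = real k + 1" "real t \<le> 27 / 10 * ?L" using tk t by (simp_all add: I_def)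
        have mN: "?m \<le> n choose 2" using elim(3) t by (auto simp: time_hi_def I_def)
        define x where "x = real n * (9 / 20 * ?L + 5 / 6 * real t)"
        have lo: "?m = nat \<lceil>x\<rceil>" using rt(2) by (simp add: time_lo_def x_def)
        have x0: "0 < x" unfolding x_def using L n by (intro mult_pos_pos add_pos_nonneg) auto
        have lox: "x \<le> real ?m" "real ?m \<le> x + 1" unfolding lo using x0 by linarith+
        have "real k \<le> 9 / 20 * ?L + 5 / 6 * real t" using rt L by linarith
        then have "real n * real k \<le> x" unfolding x_def by (rule mult_left_mono) simp
        then have "real (k * n) \<le> real ?m" using lox by (simp add: mult.commute)
        then have 1: "k * n \<le> ?m" by (simp only: of_nat_le_iff)
        have 2: "0 < ?m" using lox x0 by linarith
        have "9 / 20 * ?L + 5 / 6 * real t \<le> 27 / 10 * ?L" using rt(2) by linarith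
        then have "x \<le> real n * (27 / 10 * ?L)" unfolding x_def by (rule mult_left_mono) simp
        moreover have "1 \<le> real n * ?L" using mult_mono[of 1 "real n" 1 ?L] n L by simp
        ultimately have 3: "real ?m \<le> 10 * real n * ?L" using lox by linarith
        have 4: "real k \<le> 4 * ?L" using rt L by linarith
        have "proc_prob n (\<lambda>xs. t \<le> min_degree n (proc_graph xs ?m)) = subset_prob (all_edges n) ?m (\<lambda>A. k < min_degree n A)"
          using proc_prob_at_time[OF mN, of "\<lambda>A. k < min_degree n A"] by (simp add: tk Suc_le_eq)
        also have "\<dots> \<le> 2 * (real k + 1) * exp (2 * real ?m / real n + 4 - (1 + ln 2) * real k) / real n + sm_err n"
          using elim(2) 1 2 3 4 by blast
        also have "\<dots> \<le> b n"
        proof -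
          have "2 * real ?m / real n \<le> 2 * (x + 1) / real n" using lox by (intro divide_right_mono) auto
          also have "\<dots> = 9 / 10 * ?L + 5 / 3 * real t + 2 / real n" unfolding x_def using n by (simp add: field_simps)
          also have "\<dots> \<le> 9 / 10 * ?L + 5 / 3 * real t + 1" using n by simp
          finally have "2 * real ?m / real n \<le> 9 / 10 * ?L + 5 / 3 * real k + 8 / 3" using rt by linarith
          \<comment> \<open>At the early time the average degree is about 9/10 ln n + 5/3 t. The
            slope 5/3 is just below 1 + ln 2, so the dependence on \<open>t\<close> cancels and the
            failure bound is n^(-1/10) up to logarithmic factors.\<close>
          moreover have "5 / 3 * real k \<le> (1 + ln 2) * real k" using ln2_ge_two_thirds by (intro mult_right_mono) auto
          ultimately show ?thesis
            unfolding b_def using rt L by (intro add_right_mono divide_right_mono mult_mono) auto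
        qed
        finally show ?thesis .
      qed
      then show ?case using finite_subset[OF sub] cardI by blast
    qed
  qed
  then show ?thesis by (rule rare_subset) (auto simp: late_degree_def I_def)
qed

text \<open>The early time grows like n ln n even for t = 1, so it eventually exceeds the 600000 n
  edges needed for dense sets. The bound n^(-4) for each \<open>t\<close> leaves room for a plain
  union.\<close>

lemma rare_dense_set: "rare (\<lambda>n xs. \<exists>t\<in>{t. 1 \<le> t \<and> 2 * t \<le> n}. dense_set n xs t)"
proof (rule rare_bex)
  show "(\<lambda>n. real n * (real n * exp (- 5 * ln (real n)))) \<longlonglongrightarrow> 0" by real_asymp
  have "\<forall>\<^sub>F n in sequentially. 600000 \<le> 9 / 20 * ln (real n) - 1 / 2 \<and> 2 \<le> real n"
    by (intro eventually_conj; real_asymp)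
  then show "\<forall>\<^sub>F n in sequentially. finite {t. 1 \<le> t \<and> 2 * t \<le> n} \<and> real (card {t. 1 \<le> t \<and> 2 * t \<le> n}) \<le> real n \<and>
    (\<forall>t\<in>{t. 1 \<le> t \<and> 2 * t \<le> n}. proc_prob n (\<lambda>xs. dense_set n xs t) \<le> real n * exp (- 5 * ln (real n)))"
    using times
  proof eventually_elim
    case (elim n)
    have "proc_prob n (\<lambda>xs. dense_set n xs t) \<le> real n * exp (- 5 * ln (real n))" if t: "1 \<le> t" "2 * t \<le> n" for t
    proof -
      have mN: "time_lo n t \<le> n choose 2" using elim(2) t by (auto simp: time_hi_def)
      have "600000 * real n \<le> real n * (9 / 20 * ln (real n) + 5 / 6 * real t - 1 / 2)"
        using elim(1) by (subst mult.commute) (intro mult_left_mono, auto)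
      also have "\<dots> \<le> real (time_lo n t)" using elim(2) t by blast
      finally show ?thesis
        using dense_set_prob[of n "time_lo n t"] elim(1) mN unfolding dense_set_def
        by (subst proc_prob_at_time[OF mN]) simp
    qed
    then show ?case using finite_half card_half by auto
  qed
qed

lemma rare_low_degree: "rare (\<lambda>n xs. \<exists>t\<in>{t. 1 \<le> t \<and> 2 * t \<le> n}. low_degree n xs t)"
proof (rule rare_bex)
  show "(\<lambda>n. real n * (real n * exp (- 5 * ln (real n)))) \<longlonglongrightarrow> 0" by real_asymp
  have "\<forall>\<^sub>F n in sequentially. 1 \<le> ln (real n) \<and> 2 \<le> real n"
    by (intro eventually_conj; real_asymp)
  then show "\<forall>\<^sub>F n in sequentially. finite {t. 1 \<le> t \<and> 2 * t \<le> n} \<and> real (card {t. 1 \<le> t \<and> 2 * t \<le> n}) \<le> real n \<and>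
    (\<forall>t\<in>{t. 1 \<le> t \<and> 2 * t \<le> n}. proc_prob n (\<lambda>xs. low_degree n xs t) \<le> real n * exp (- 5 * ln (real n)))"
  proof eventually_elim
    case (elim n)
    let ?L = "ln (real n)"
    have L: "?L \<ge> 1" and n: "real n \<ge> 2" using elim by auto
    have "proc_prob n (\<lambda>xs. low_degree n xs t) \<le> real n * exp (- 5 * ?L)" if t: "1 \<le> t" "2 * t \<le> n" for t
    proof -
      let ?m = "time_hi n t"
      have mN: "?m \<le> n choose 2" by (simp add: time_hi_def)
      have eq: "proc_prob n (\<lambda>xs. low_degree n xs t) = subset_prob (all_edges n) ?m (\<lambda>A. min_degree n A < t)"
        unfolding low_degree_def by (rule proc_prob_at_time[OF mN])
      show ?thesis
      proof (cases "?m = n choose 2")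
        case True
        \<comment> \<open>If the cap in \<open>time_hi\<close> applies, the graph is complete and
          has minimum degree n - 1, which is at least \<open>t\<close> because 2 t \<le> n.\<close>
        have "\<not> min_degree n A < t" if A: "A \<subseteq> all_edges n" "card A = ?m" for A
        proof -
          have "A = all_edges n" using A True card_subset_eq[of "all_edges n" A] by (simp add: card_all_edges)
          then have "degree A v = n - 1" if "v < n" for v
            using degree_eq_card_edge_cut[of A n v] card_edge_cut_all_edges[of "{v}" n] that by simp
          moreover have "t \<le> n - 1" using t by auto
          ultimately have "t \<le> min_degree n A" using le_min_degree_iff[of n t A] n by simp
          then show ?thesis by simp
        qed
        then have "{A \<in> subsets_of_size (all_edges n) ?m. min_degree n A < t} = {}"
          by (auto simp: subsets_of_size_def)
        then have "subset_prob (all_edges n) ?m (\<lambda>A. min_degree n A < t) = 0"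
          unfolding subset_prob_def by (simp only: card.empty of_nat_0 div_0)
        then show ?thesis using eq by simp
      next
        case False
        then have "?m = nat \<lceil>4 * real n * (?L + real t)\<rceil>" by (simp add: time_hi_def min_def split: if_splits)
        then have "4 * real n * (?L + real t) \<le> real ?m" by linarith
        then have "8 * (?L + real t) * real n \<le> 2 * real ?m" by (simp add: algebra_simps)
        then have d: "2 * real ?m / real n \<ge> 8 * (?L + real t)" using n by (simp add: le_divide_eq)
        \<comment> \<open>Since 63/100 * 8 exceeds 5, the exponent covers both 5 ln n and the
          summand \<open>t - 1\<close>.\<close>
        have "(63 / 100) * (8 * (?L + real t)) \<le> (1 - exp (- 1)) * (2 * real ?m / real n)"
          using L d by (intro mult_mono exp_minus_1_le) auto
        then have "1 * real (t - 1) - (1 - exp (- 1)) * (2 * real ?m / real n) \<le> - 5 * ?L"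
          using t L by auto
        then have "real n * exp (1 * real (t - 1) - (1 - exp (- 1)) * (2 * real ?m / real n)) \<le> real n * exp (- 5 * ?L)"
          by (intro mult_left_mono) simp_all
        moreover have "subset_prob (all_edges n) ?m (\<lambda>A. min_degree n A \<le> t - 1) \<le>
          real n * exp (1 * real (t - 1) - (1 - exp (- 1)) * (2 * real ?m / real n))"
          using n mN by (intro min_degree_le_prob) auto
        moreover have "subset_prob (all_edges n) ?m (\<lambda>A. min_degree n A < t) \<le> subset_prob (all_edges n) ?m (\<lambda>A. min_degree n A \<le> t - 1)"
          by (intro subset_prob_mono) auto
        ultimately show ?thesis using eq by linarith
      qed
    qed
    then show ?case using finite_half card_half by auto
  qed
qed

text \<open>The bound for a single \<open>t\<close> is only about n^(-6/100), so multiplying by the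
  number of values of \<open>t\<close> would be ruinous. A factor exp (-t / 60) is kept for each
  \<open>t\<close>, and the sum over all \<open>t\<close> becomes a convergent geometric
  series.\<close>

lemma rare_small_cut: "rare (\<lambda>n xs. \<exists>t\<in>{t. 1 \<le> t \<and> 2 * t \<le> n}. small_cut n xs t)"
proof (rule rareI)
  define Y where "Y n = 3000 * exp 4 * ln (real n) * exp (- (6 / 100) * ln (real n))" for n
  define B where "B n = 2 * Y n * (1 / (1 - exp (- (1 / 60))))" for n
  show "B \<longlonglongrightarrow> 0" unfolding B_def Y_def by real_asymp
  have "\<forall>\<^sub>F n in sequentially. 4 \<le> ln (real n) \<and> 100 \<le> real n \<and> Y n \<le> 1 / 2"
    unfolding Y_def by (intro eventually_conj; real_asymp)
  then show "\<forall>\<^sub>F n in sequentially. proc_prob n (\<lambda>xs. \<exists>t\<in>{t. 1 \<le> t \<and> 2 * t \<le> n}. small_cut n xs t) \<le> B n"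
    using times
  proof eventually_elim
    case (elim n)
    let ?L = "ln (real n)" and ?I = "{t. 1 \<le> t \<and> 2 * t \<le> n}"
    have L: "?L \<ge> 4" and n: "real n \<ge> 100" and Y: "Y n \<le> 1 / 2" using elim(1) by auto
    have Y0: "Y n \<ge> 0" using L by (simp add: Y_def)
    have step: "proc_prob n (\<lambda>xs. small_cut n xs t) \<le> 2 * Y n * exp (- (1 / 60) * real t)" if t: "t \<in> ?I" for t
    proof -
      let ?lo = "time_lo n t" and ?hi = "time_hi n t"
      have T: "?lo \<le> ?hi" "real n * (9 / 20 * ?L + 5 / 6 * real t - 1 / 2) \<le> real ?lo"
        using elim(2) t by auto
      have rt: "real t \<ge> 1" using t by simp
      have hiN: "?hi \<le> n choose 2" by (simp add: time_hi_def)
      \<comment> \<open>12474/10000 times 9/20 is slightly above 56/100, which beats the 1/2 coming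
        from sqrt n and leaves n^(-6/100). The same factor times 5/6 exceeds 1 + 1/30, which gives
        the decay in \<open>t\<close>.\<close>
      define \<gamma> where "\<gamma> = 56 / 100 * ?L + real t / 30 - 1"
      have rlo: "9 / 20 * ?L + 5 / 6 * real t - 1 / 2 \<le> real ?lo / real n"
        using T(2) n by (simp add: le_divide_eq mult.commute)
      have "(9 / 20 * ?L + 5 / 6 * real t - 1 / 2 - 1 / 100) * (12474 / 10000) \<le> (real ?lo / real n - 1 / 100) * (12474 / 10000)"
        using rlo by (intro mult_right_mono) auto
      then have rate: "real t + \<gamma> \<le> (real ?lo / real n - 1 / 100) * (12474 / 10000)"
        unfolding \<gamma>_def using L rt by simp
      have lon: "real n \<le> real ?lo"
      proof -
        have "real n * 1 \<le> real n * (9 / 20 * ?L + 5 / 6 * real t - 1 / 2)"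
          using L rt by (intro mult_left_mono) auto
        then show ?thesis using T(2) by simp
      qed
      define y where "y = exp 1 * sqrt (real n) * (4 * exp 1 * (real ?hi / (real n - 1))) * exp (- \<gamma>)"
      have y0: "0 \<le> y" unfolding y_def using n by simp
      have "proc_prob n (\<lambda>xs. small_cut n xs t) \<le> (\<Sum>u\<in>{1..n}. y ^ u)"
        unfolding small_cut_def y_def
        using n T(1) hiN rate lon by (intro small_cut_prob) auto
      moreover have yY: "y \<le> Y n * exp (- (1 / 60) * real t)"
      proof -
        have "real ?hi \<le> 4 * real n * (?L + real t) + 1"
        proof -
          have "real ?hi \<le> real (nat \<lceil>4 * real n * (?L + real t)\<rceil>)" by (simp add: time_hi_def)
          moreover have "0 \<le> 4 * real n * (?L + real t)" using L by simp
          ultimately show ?thesis by linarith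
        qed
        also have "\<dots> \<le> 5 * (?L + real t) * (real n - 1)"
        proof -
          have "(?L + real t) * 100 \<le> (?L + real t) * real n" using L n by (intro mult_left_mono) auto
          then show ?thesis using L rt by (simp add: algebra_simps)
        qed
        finally have hi: "real ?hi / (real n - 1) \<le> 5 * (?L + real t)" using n by (simp add: divide_le_eq)
        also have "\<dots> \<le> 5 * (2 * ?L * real t)"
        proof -
          have "?L * 1 \<le> ?L * real t" "1 * real t \<le> ?L * real t" using L rt by (intro mult_mono; simp)+
          then show ?thesis by simp
        qed
        \<comment> \<open>The late time is linear in \<open>t\<close>; half of the decay exp (-t /
          30) is spent on absorbing this factor, and exp (-t / 60) remains.\<close>
        also have "\<dots> \<le> 5 * (2 * ?L * (60 * exp (real t / 60)))"
        proof -
          have "real t / 60 \<le> exp (real t / 60)" using exp_ge_add_one_self[of "real t / 60"] by linarith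
          then show ?thesis using L by (intro mult_left_mono) auto
        qed
        finally have hi: "real ?hi / (real n - 1) \<le> 600 * ?L * exp (real t / 60)" by simp
        have sq: "sqrt (real n) = exp (?L / 2)" using n by (simp add: powr_half_sqrt[symmetric] powr_def)
        have "y \<le> exp 1 * exp (?L / 2) * (4 * exp 1 * (600 * ?L * exp (real t / 60))) * exp (- \<gamma>)"
          unfolding y_def sq using hi by (intro mult_right_mono mult_left_mono) auto
        also have "\<dots> = 2400 * ?L * (exp 1 * exp (?L / 2) * exp 1 * exp (real t / 60) * exp (- \<gamma>))" by simp
        also have "exp 1 * exp (?L / 2) * exp 1 * exp (real t / 60) * exp (- \<gamma>) =
          exp (3 - 6 / 100 * ?L - real t / 60)"
          unfolding \<gamma>_def by (simp flip: exp_add)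
        also have "2400 * ?L * exp (3 - 6 / 100 * ?L - real t / 60) \<le> 3000 * ?L * exp (4 - 6 / 100 * ?L - real t / 60)"
          using L by (intro mult_mono) auto
        also have "exp (4 - 6 / 100 * ?L - real t / 60) = exp 4 * exp (- (6 / 100) * ?L) * exp (- (1 / 60) * real t)"
          by (simp flip: exp_add)
        finally show ?thesis unfolding Y_def by (simp add: mult_ac)
      qed
      moreover have "(\<Sum>u\<in>{1..n}. y ^ u) \<le> 2 * y"
      proof -
        have "exp (- (1 / 60) * real t) \<le> 1" by simp
        then have "Y n * exp (- (1 / 60) * real t) \<le> 1 / 2 * 1" using Y Y0 by (intro mult_mono) auto
        then have yh: "y \<le> 1 / 2" using yY by linarith
        have "(\<Sum>u\<in>{1..n}. y ^ u) = (\<Sum>u<n. y * y ^ u)"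
          by (rule sum.reindex_bij_witness[where i = Suc and j = "\<lambda>u. u - 1"]) (auto simp flip: power_Suc)
        also have "\<dots> = y * (\<Sum>u<n. y ^ u)" by (rule sum_distrib_left[symmetric])
        also have "(\<Sum>u<n. y ^ u) = (1 - y ^ n) / (1 - y)" using sum_gp_strict[of y n] yh by simp
        also have "\<dots> \<le> 1 / (1 / 2)" using yh y0 by (intro frac_le) auto
        finally show ?thesis using y0 by (simp add: mult_left_mono)
      qed
      ultimately show ?thesis by linarith
    qed
    have "proc_prob n (\<lambda>xs. \<exists>t\<in>?I. small_cut n xs t) \<le> (\<Sum>t\<in>?I. proc_prob n (\<lambda>xs. small_cut n xs t))"
      by (rule proc_prob_bex_le[OF finite_half])
    also have "\<dots> \<le> (\<Sum>t\<in>?I. 2 * Y n * exp (- (1 / 60) * real t))" by (rule sum_mono) (rule step)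
    also have "\<dots> = 2 * Y n * (\<Sum>t\<in>?I. exp (- (1 / 60) * real t))" by (rule sum_distrib_left[symmetric])
    also have "\<dots> \<le> 2 * Y n * (exp (- (1 / 60) * 0) / (1 - exp (- (1 / 60))))"
      using finite_half Y0 by (intro mult_left_mono sum_exp_geometric_le) auto
    also have "\<dots> = B n" by (simp add: B_def)
    finally show ?case .
  qed
qed

theorem tree_packing_process:
  "(\<lambda>n. proc_prob n (\<lambda>xs. \<forall>m \<le> n choose 2.
      tree_packing n (proc_graph xs m) =
        min (min_degree n (proc_graph xs m)) (m div (n - 1)))) \<longlonglongrightarrow> 1"
proof (rule tendsto_1_if_rare_not, rule rare_subset)
  let ?E = "\<lambda>P n xs. \<exists>t\<in>{t. 1 \<le> t \<and> 2 * t \<le> n}. P n xs t"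
  show "rare (\<lambda>n xs. (?E late_degree n xs \<or> ?E dense_set n xs) \<or> (?E small_cut n xs \<or> ?E low_degree n xs))"
    by (intro rare_disj rare_late_degree rare_dense_set rare_small_cut rare_low_degree)
  show "\<forall>\<^sub>F n in sequentially. \<forall>xs\<in>permutations_of_set (all_edges n). \<not> (\<forall>m \<le> n choose 2.
      tree_packing n (proc_graph xs m) = min (min_degree n (proc_graph xs m)) (m div (n - 1))) \<longrightarrow>
    (?E late_degree n xs \<or> ?E dense_set n xs) \<or> (?E small_cut n xs \<or> ?E low_degree n xs)"
    using eventually_ge_at_top[of "2::nat"] times
  proof (eventually_elim, intro ballI impI)
    fix n xs assume n: "2 \<le> n" and xs: "xs \<in> permutations_of_set (all_edges n)"
      and times: "\<forall>t. 1 \<le> t \<longrightarrow> 2 * t \<le> n \<longrightarrow>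
        t * (n - 1) \<le> time_lo n t \<and> time_lo n t \<le> time_hi n t \<and>
        real n * (9 / 20 * ln (real n) + 5 / 6 * real t - 1 / 2) \<le> real (time_lo n t)"
      and bad: "\<not> (\<forall>m \<le> n choose 2.
        tree_packing n (proc_graph xs m) = min (min_degree n (proc_graph xs m)) (m div (n - 1)))"
    show "(?E late_degree n xs \<or> ?E dense_set n xs) \<or> (?E small_cut n xs \<or> ?E low_degree n xs)"
    proof (rule ccontr)
      assume good: "\<not> ((?E late_degree n xs \<or> ?E dense_set n xs) \<or> (?E small_cut n xs \<or> ?E low_degree n xs))"
      have "tree_packing n (proc_graph xs m) = min (min_degree n (proc_graph xs m)) (m div (n - 1))"
        if "m \<le> n choose 2" for m
        using times good by (intro tree_packing_eq_if_good[OF n xs that]) blast+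
      then show False using bad by blast
    qed
  qed
qed

theorem theorem2p3:
  shows "((\<lambda>n. proc_prob n (\<lambda>xs. \<forall>m \<le> n choose 2.
            tree_packing n (proc_graph xs m) =
              min (min_degree n (proc_graph xs m)) (m div (n - 1))))
          \<longlonglongrightarrow> 1) \<and>
        (\<forall>\<epsilon>::real. \<epsilon> > 0 \<longrightarrow>
          ((\<lambda>n. proc_prob n (\<lambda>xs.
             (\<forall>m \<le> n choose 2. real m \<le> (1 - \<epsilon>) * beta_const / 2 * real n * ln (real n) \<longrightarrow>
                 min_degree n (proc_graph xs m) \<le> m div (n - 1)) \<and>
             (\<forall>m \<le> n choose 2. (1 + \<epsilon>) * beta_const / 2 * real n * ln (real n) \<le> real m \<longrightarrow>
                 min_degree n (proc_graph xs m) > m div (n - 1))))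
          \<longlonglongrightarrow> 1))"
  using tree_packing_process min_degree_threshold by blast

end
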